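(* Let $M$ be an $n$-dimensional submanifold of codimension $r$ in a locally product Riemannian manifold $(\widetilde{M},\widetilde{g},\widetilde{P})$, and suppose that the structure $(P,g,u_{\alpha},\xi_{\alpha},(a_{\alpha\beta})_{r})$ induced on $M$ by $\widetilde P$ is normal. Let $\mathcal{A}=(a_{\alpha\beta})_{r}$. If the normal connection $\nabla^{\bot}$ vanishes identically (i.e. $l_{\alpha\beta}=0$) and the determinant of the matrix $I_{r}-\mathcal{A}^{2}$ does not vanish at any point $x\in M$, then the $(1,1)$-tensor field $P$ commutes with the Weingarten operators $A_\alpha$: $$PA_{\alpha}=A_{\alpha}P\qquad\text{for every }\alpha\in\{1,\dots,r\}.$$
   Context: An almost product Riemannian manifold $(\widetilde M,\widetilde g,\widetilde P)$ is a Riemannian manifold $(\widetilde M,\widetilde g)$ with a $(1,1)$-tensor field $\widetilde P$ such that $\widetilde P^2=I$ and $\widetilde g(\widetilde PU,\widetilde PV)=\widetilde g(U,V)$ for all vector fields $U,V$. It is a locally product Riemannian manifold if moreover $\widetilde\nabla\widetilde P=0$, where $\widetilde\nabla$ is the Levi-Civita connection of $\widetilde g$. $M$ is isometrically immersed with induced metric $g$ and Levi-Civita connection $\nabla$; $\chi(M)$ denotes the vector fields on $M$; $(N_1,\dots,N_r)$ is a smooth orthonormal frame of the normal bundle of $M$. The induced structure is defined by the tangential/normal decompositions $$\widetilde P X=PX+\sum_{\alpha}u_\alpha(X)N_\alpha,\qquad \widetilde P N_\alpha=\xi_\alpha+\sum_\beta a_{\alpha\beta}N_\beta\qquad (X\in\chi(M)),$$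 where $P$ is a $(1,1)$-tensor field on $M$, $u_\alpha$ are 1-forms, $\xi_\alpha$ are tangent vector fields and $a_{\alpha\beta}$ are real functions on $M$. The Weingarten operators $A_\alpha$ and the normal connection forms $l_{\alpha\beta}$ are defined by $\widetilde\nabla_XN_\alpha=-A_\alpha X+\nabla^\bot_XN_\alpha$, $\nabla^\bot_XN_\alpha=\sum_\beta l_{\alpha\beta}(X)N_\beta$. The Nijenhuis tensor is $N_P(X,Y)=[PX,PY]+P^2[X,Y]-P[PX,Y]-P[X,PY]$, and the exterior derivative convention is $2du(X,Y)=X(u(Y))-Y(u(X))-u([X,Y])$. The induced structure is called normal if $N_P(X,Y)-2\sum_\alpha du_\alpha(X,Y)\xi_\alpha=0$ for all $X,Y\in\chi(M)$. $I_r$ is the $r\times r$ identity matrix. *)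

theory Defs
  imports "HOL-Analysis.Analysis" "HOL-Library.Function_Algebras"
begin

text \<open>
  Real functions and tangent vectors (which are operators on real functions) are added and
  scaled pointwise; the additive structure comes from \<^theory>\<open>HOL-Library.Function_Algebras\<close>.
\<close>

instantiation "fun" :: (type, real_vector) real_vector
begin

definition scaleR_fun :: "real \<Rightarrow> ('a \<Rightarrow> 'b) \<Rightarrow> 'a \<Rightarrow> 'b" where
  "scaleR_fun c f = (\<lambda>x. c *\<^sub>R f x)"

instance
  by standard
    (simp_all add: scaleR_fun_def plus_fun_def fun_eq_iff scaleR_add_right scaleR_add_left)

end

section \<open>Smooth manifolds\<close>

text \<open>
  The order-\<open>k\<close> and smoothness predicates are only meant for open \<open>S\<close>; there
  \<^const>\<open>differentiable_on\<close> is differentiability at every point.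
\<close>

primrec Ck_on :: "nat \<Rightarrow> 'x::real_normed_vector set \<Rightarrow> ('x \<Rightarrow> 'y::real_normed_vector) \<Rightarrow> bool" where
  "Ck_on 0 S f = continuous_on S f"
| "Ck_on (Suc k) S f =
     (f differentiable_on S \<and> (\<forall>e. Ck_on k S (\<lambda>x. frechet_derivative f (at x) e)))"

definition smooth_on :: "'x::real_normed_vector set \<Rightarrow> ('x \<Rightarrow> 'y::real_normed_vector) \<Rightarrow> bool" where
  "smooth_on S f \<longleftrightarrow> (\<forall>k. Ck_on k S f)"

text \<open>A chart is a pair of an open domain and a coordinate map with values in the model space.\<close>

type_synonym ('a, 'e) chart = "'a set \<times> ('a \<Rightarrow> 'e)"

definition is_chart :: "('a::topological_space, 'e::euclidean_space) chart \<Rightarrow> bool" where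
  "is_chart c \<longleftrightarrow> (case c of (U, \<phi>) \<Rightarrow>
     open U \<and> open (\<phi> ` U) \<and> homeomorphism U (\<phi> ` U) \<phi> (inv_into U \<phi>))"

text \<open>
  The manifold is the whole type \<open>'a\<close>, of dimension \<open>DIM('e)\<close>. The Hausdorff property and second
  countability are class constraints. The atlas need not be maximal: smoothness of functions with
  respect to an atlas and to the maximal atlas containing it agree.
\<close>

definition smooth_manifold ::
  "('a::{t2_space,second_countable_topology}, 'e::euclidean_space) chart set \<Rightarrow> bool" where
  "smooth_manifold \<A> \<longleftrightarrow>
     (\<forall>c\<in>\<A>. is_chart c) \<and> (\<Union>c\<in>\<A>. fst c) = UNIV \<and>
     (\<forall>(U, \<phi>)\<in>\<A>. \<forall>(V, \<psi>)\<in>\<A>. smooth_on (\<phi> ` (U \<inter> V)) (\<psi> \<circ> inv_into U \<phi>))"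

definition smooth_fun ::
  "('a::topological_space, 'e::euclidean_space) chart set \<Rightarrow> ('a \<Rightarrow> real) \<Rightarrow> bool" where
  "smooth_fun \<A> h \<longleftrightarrow> (\<forall>(U, \<phi>)\<in>\<A>. smooth_on (\<phi> ` U) (h \<circ> inv_into U \<phi>))"

definition smooth_map ::
  "('a::topological_space, 'e::euclidean_space) chart set \<Rightarrow>
   ('b::topological_space, 'd::euclidean_space) chart set \<Rightarrow> ('a \<Rightarrow> 'b) \<Rightarrow> bool" where
  "smooth_map \<A> \<B> f \<longleftrightarrow> continuous_on UNIV f \<and>
     (\<forall>(U, \<phi>)\<in>\<A>. \<forall>(V, \<psi>)\<in>\<B>. smooth_on (\<phi> ` (U \<inter> f -` V)) (\<psi> \<circ> f \<circ> inv_into U \<phi>))"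

section \<open>Tangent vectors and vector fields\<close>

text \<open>
  A tangent vector at \<open>p\<close> is identified with its action on smooth functions: it is
  \<open>h \<mapsto> \<Sum>\<^sub>i e\<^sub>i \<partial>h/\<partial>x\<^sub>i (p)\<close>, a directional derivative in some chart around \<open>p\<close>.
  It is set to \<open>0\<close> on non-smooth functions, so that equality of tangent vectors is plain equality.
\<close>

type_synonym 'a tvec = "('a \<Rightarrow> real) \<Rightarrow> real"

definition tangent_space ::
  "('a::topological_space, 'e::euclidean_space) chart set \<Rightarrow> 'a \<Rightarrow> 'a tvec set" where
  "tangent_space \<A> p = {v. \<exists>(U, \<phi>)\<in>\<A>. \<exists>e. p \<in> U \<and>
     v = (\<lambda>h. if smooth_fun \<A> h
               then frechet_derivative (h \<circ> inv_into U \<phi>) (at (\<phi> p)) e else 0)}"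

text \<open>The differential of \<open>f\<close>; \<open>\<B>\<close> is the atlas of the target.\<close>

definition differential ::
  "('b::topological_space, 'd::euclidean_space) chart set \<Rightarrow> ('a \<Rightarrow> 'b) \<Rightarrow> 'a tvec \<Rightarrow> 'b tvec" where
  "differential \<B> f v = (\<lambda>h. if smooth_fun \<B> h then v (h \<circ> f) else 0)"

definition vector_fields ::
  "('a::topological_space, 'e::euclidean_space) chart set \<Rightarrow> ('a \<Rightarrow> 'a tvec) set" where
  "vector_fields \<A> = {X. (\<forall>p. X p \<in> tangent_space \<A> p) \<and>
     (\<forall>h. smooth_fun \<A> h \<longrightarrow> smooth_fun \<A> (\<lambda>p. X p h))}"

text \<open>Smooth sections of the pull-back \<open>f\<^sup>*(TN)\<close>, for \<open>f\<close> from \<open>(M,\<A>)\<close> to \<open>(N,\<B>)\<close>.\<close>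

definition vector_fields_along ::
  "('a::topological_space, 'e::euclidean_space) chart set \<Rightarrow>
   ('b::topological_space, 'd::euclidean_space) chart set \<Rightarrow> ('a \<Rightarrow> 'b) \<Rightarrow> ('a \<Rightarrow> 'b tvec) set" where
  "vector_fields_along \<A> \<B> f = {V. (\<forall>p. V p \<in> tangent_space \<B> (f p)) \<and>
     (\<forall>h. smooth_fun \<B> h \<longrightarrow> smooth_fun \<A> (\<lambda>p. V p h))}"

definition lie_bracket :: "('a \<Rightarrow> 'a tvec) \<Rightarrow> ('a \<Rightarrow> 'a tvec) \<Rightarrow> 'a \<Rightarrow> 'a tvec" where
  "lie_bracket X Y = (\<lambda>p h. X p (\<lambda>q. Y q h) - Y p (\<lambda>q. X q h))"

section \<open>Tensor fields\<close>

definition linear_map_on :: "'x::real_vector set \<Rightarrow> ('x \<Rightarrow> 'y::real_vector) \<Rightarrow> bool" where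
  "linear_map_on S L \<longleftrightarrow>
     (\<forall>u\<in>S. \<forall>v\<in>S. L (u + v) = L u + L v) \<and> (\<forall>c. \<forall>v\<in>S. L (c *\<^sub>R v) = c *\<^sub>R L v)"

definition one_form ::
  "('a::topological_space, 'e::euclidean_space) chart set \<Rightarrow> ('a \<Rightarrow> 'a tvec \<Rightarrow> real) \<Rightarrow> bool" where
  "one_form \<A> u \<longleftrightarrow> (\<forall>p. linear_map_on (tangent_space \<A> p) (u p)) \<and>
     (\<forall>X\<in>vector_fields \<A>. smooth_fun \<A> (\<lambda>p. u p (X p)))"

definition tensor_field_11 ::
  "('a::topological_space, 'e::euclidean_space) chart set \<Rightarrow> ('a \<Rightarrow> 'a tvec \<Rightarrow> 'a tvec) \<Rightarrow> bool" where
  "tensor_field_11 \<A> T \<longleftrightarrow>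
     (\<forall>p. T p ` tangent_space \<A> p \<subseteq> tangent_space \<A> p \<and> linear_map_on (tangent_space \<A> p) (T p)) \<and>
     (\<forall>X\<in>vector_fields \<A>. (\<lambda>p. T p (X p)) \<in> vector_fields \<A>)"

definition riemannian_metric ::
  "('a::topological_space, 'e::euclidean_space) chart set \<Rightarrow>
   ('a \<Rightarrow> 'a tvec \<Rightarrow> 'a tvec \<Rightarrow> real) \<Rightarrow> bool" where
  "riemannian_metric \<A> g \<longleftrightarrow>
     (\<forall>p. \<forall>v\<in>tangent_space \<A> p.
        linear_map_on (tangent_space \<A> p) (g p v) \<and>
        (\<forall>w\<in>tangent_space \<A> p. g p v w = g p w v) \<and>
        (v \<noteq> 0 \<longrightarrow> g p v v > 0)) \<and>
     (\<forall>X\<in>vector_fields \<A>. \<forall>Y\<in>vector_fields \<A>. smooth_fun \<A> (\<lambda>p. g p (X p) (Y p)))"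

text \<open>\<open>2 du(X,Y) = X(u(Y)) - Y(u(X)) - u([X,Y])\<close>\<close>

definition ext_deriv ::
  "('a \<Rightarrow> 'a tvec \<Rightarrow> real) \<Rightarrow> ('a \<Rightarrow> 'a tvec) \<Rightarrow> ('a \<Rightarrow> 'a tvec) \<Rightarrow> 'a \<Rightarrow> real" where
  "ext_deriv u X Y = (\<lambda>p.
     (X p (\<lambda>q. u q (Y q)) - Y p (\<lambda>q. u q (X q)) - u p (lie_bracket X Y p)) / 2)"

definition nijenhuis ::
  "('a \<Rightarrow> 'a tvec \<Rightarrow> 'a tvec) \<Rightarrow> ('a \<Rightarrow> 'a tvec) \<Rightarrow> ('a \<Rightarrow> 'a tvec) \<Rightarrow> 'a \<Rightarrow> 'a tvec" where
  "nijenhuis P X Y = (\<lambda>p.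
     lie_bracket (\<lambda>q. P q (X q)) (\<lambda>q. P q (Y q)) p
     + P p (P p (lie_bracket X Y p))
     - P p (lie_bracket (\<lambda>q. P q (X q)) Y p)
     - P p (lie_bracket X (\<lambda>q. P q (Y q)) p))"

section \<open>Connections\<close>

text \<open>\<open>nabla X Y\<close> is the covariant derivative of \<open>Y\<close> in the direction \<open>X\<close>.\<close>

definition affine_connection ::
  "('a::topological_space, 'e::euclidean_space) chart set \<Rightarrow>
   (('a \<Rightarrow> 'a tvec) \<Rightarrow> ('a \<Rightarrow> 'a tvec) \<Rightarrow> 'a \<Rightarrow> 'a tvec) \<Rightarrow> bool" where
  "affine_connection \<A> nabla \<longleftrightarrow>
     (\<forall>X\<in>vector_fields \<A>. \<forall>Y\<in>vector_fields \<A>. nabla X Y \<in> vector_fields \<A>) \<and>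
     (\<forall>X\<in>vector_fields \<A>. \<forall>Y\<in>vector_fields \<A>. \<forall>Z\<in>vector_fields \<A>.
        nabla (X + Y) Z = nabla X Z + nabla Y Z \<and> nabla X (Y + Z) = nabla X Y + nabla X Z) \<and>
     (\<forall>X\<in>vector_fields \<A>. \<forall>Y\<in>vector_fields \<A>. \<forall>h. smooth_fun \<A> h \<longrightarrow>
        nabla (\<lambda>p. h p *\<^sub>R X p) Y = (\<lambda>p. h p *\<^sub>R nabla X Y p) \<and>
        nabla X (\<lambda>p. h p *\<^sub>R Y p) = (\<lambda>p. X p h *\<^sub>R Y p + h p *\<^sub>R nabla X Y p))"

definition levi_civita ::
  "('a::topological_space, 'e::euclidean_space) chart set \<Rightarrow>
   ('a \<Rightarrow> 'a tvec \<Rightarrow> 'a tvec \<Rightarrow> real) \<Rightarrow>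
   (('a \<Rightarrow> 'a tvec) \<Rightarrow> ('a \<Rightarrow> 'a tvec) \<Rightarrow> 'a \<Rightarrow> 'a tvec) \<Rightarrow> bool" where
  "levi_civita \<A> g nabla \<longleftrightarrow> affine_connection \<A> nabla \<and>
     (\<forall>X\<in>vector_fields \<A>. \<forall>Y\<in>vector_fields \<A>. nabla X Y - nabla Y X = lie_bracket X Y) \<and>
     (\<forall>X\<in>vector_fields \<A>. \<forall>Y\<in>vector_fields \<A>. \<forall>Z\<in>vector_fields \<A>. \<forall>p.
        X p (\<lambda>q. g q (Y q) (Z q)) = g p (nabla X Y p) (Z p) + g p (Y p) (nabla X Z p))"

text \<open>
  The covariant derivative along \<open>f\<close> induced by \<open>nabla\<close>, that is, the pull-back connection on
  \<open>f\<^sup>*(TN)\<close>. It gives a meaning to \<open>nabla_X V\<close> when \<open>X\<close> is a vector field on the submanifold and \<open>V\<close> is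
  only defined along it. It is the unique operator with these properties; the last one says that
  it agrees with \<open>nabla\<close> on vector fields that are restrictions of fields on the ambient manifold.
\<close>

definition induced_connection_along ::
  "('a::topological_space, 'e::euclidean_space) chart set \<Rightarrow>
   ('b::topological_space, 'd::euclidean_space) chart set \<Rightarrow> ('a \<Rightarrow> 'b) \<Rightarrow>
   (('b \<Rightarrow> 'b tvec) \<Rightarrow> ('b \<Rightarrow> 'b tvec) \<Rightarrow> 'b \<Rightarrow> 'b tvec) \<Rightarrow>
   (('a \<Rightarrow> 'a tvec) \<Rightarrow> ('a \<Rightarrow> 'b tvec) \<Rightarrow> 'a \<Rightarrow> 'b tvec) \<Rightarrow> bool" where
  "induced_connection_along \<A> \<B> f nabla D \<longleftrightarrow>
     (\<forall>X\<in>vector_fields \<A>. \<forall>V\<in>vector_fields_along \<A> \<B> f. D X V \<in> vector_fields_along \<A> \<B> f) \<and>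
     (\<forall>X\<in>vector_fields \<A>. \<forall>Y\<in>vector_fields \<A>. \<forall>V\<in>vector_fields_along \<A> \<B> f.
        D (X + Y) V = D X V + D Y V) \<and>
     (\<forall>X\<in>vector_fields \<A>. \<forall>V\<in>vector_fields_along \<A> \<B> f. \<forall>W\<in>vector_fields_along \<A> \<B> f.
        D X (V + W) = D X V + D X W) \<and>
     (\<forall>X\<in>vector_fields \<A>. \<forall>V\<in>vector_fields_along \<A> \<B> f. \<forall>h. smooth_fun \<A> h \<longrightarrow>
        D (\<lambda>p. h p *\<^sub>R X p) V = (\<lambda>p. h p *\<^sub>R D X V p) \<and>
        D X (\<lambda>p. h p *\<^sub>R V p) = (\<lambda>p. X p h *\<^sub>R V p + h p *\<^sub>R D X V p)) \<and>
     (\<forall>X\<in>vector_fields \<A>. \<forall>Y\<in>vector_fields \<B>. \<forall>Z\<in>vector_fields \<B>. \<forall>p.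
        Z (f p) = differential \<B> f (X p) \<longrightarrow> D X (Y \<circ> f) p = nabla Z Y (f p))"

section \<open>Locally product manifolds and submanifolds\<close>

definition almost_product_riemannian ::
  "('a::topological_space, 'e::euclidean_space) chart set \<Rightarrow>
   ('a \<Rightarrow> 'a tvec \<Rightarrow> 'a tvec \<Rightarrow> real) \<Rightarrow> ('a \<Rightarrow> 'a tvec \<Rightarrow> 'a tvec) \<Rightarrow> bool" where
  "almost_product_riemannian \<A> g P \<longleftrightarrow>
     riemannian_metric \<A> g \<and> tensor_field_11 \<A> P \<and>
     (\<forall>p. \<forall>v\<in>tangent_space \<A> p. P p (P p v) = v) \<and>
     (\<forall>p. \<forall>v\<in>tangent_space \<A> p. \<forall>w\<in>tangent_space \<A> p. g p (P p v) (P p w) = g p v w)"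

text \<open>\<open>nabla\<close> is the Levi-Civita connection of \<open>g\<close>; the last clause is \<open>(nabla_X P) Y = 0\<close>.\<close>

definition locally_product_riemannian ::
  "('a::topological_space, 'e::euclidean_space) chart set \<Rightarrow>
   ('a \<Rightarrow> 'a tvec \<Rightarrow> 'a tvec \<Rightarrow> real) \<Rightarrow>
   (('a \<Rightarrow> 'a tvec) \<Rightarrow> ('a \<Rightarrow> 'a tvec) \<Rightarrow> 'a \<Rightarrow> 'a tvec) \<Rightarrow>
   ('a \<Rightarrow> 'a tvec \<Rightarrow> 'a tvec) \<Rightarrow> bool" where
  "locally_product_riemannian \<A> g nabla P \<longleftrightarrow>
     almost_product_riemannian \<A> g P \<and> levi_civita \<A> g nabla \<and>
     (\<forall>X\<in>vector_fields \<A>. \<forall>Y\<in>vector_fields \<A>. \<forall>p.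
        nabla X (\<lambda>q. P q (Y q)) p - P p (nabla X Y p) = 0)"

definition isometric_immersion ::
  "('a::topological_space, 'e::euclidean_space) chart set \<Rightarrow>
   ('b::topological_space, 'd::euclidean_space) chart set \<Rightarrow>
   ('a \<Rightarrow> 'a tvec \<Rightarrow> 'a tvec \<Rightarrow> real) \<Rightarrow> ('b \<Rightarrow> 'b tvec \<Rightarrow> 'b tvec \<Rightarrow> real) \<Rightarrow> ('a \<Rightarrow> 'b) \<Rightarrow> bool" where
  "isometric_immersion \<A> \<B> g g' f \<longleftrightarrow> smooth_map \<A> \<B> f \<and>
     (\<forall>p. inj_on (differential \<B> f) (tangent_space \<A> p)) \<and>
     (\<forall>p. \<forall>v\<in>tangent_space \<A> p. \<forall>w\<in>tangent_space \<A> p.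
        g p v w = g' (f p) (differential \<B> f v) (differential \<B> f w))"

text \<open>
  That the \<open>N \<alpha>\<close> span the normal spaces follows when the index type has as many elements as the
  codimension.
\<close>

definition orthonormal_normal_frame ::
  "('a::topological_space, 'e::euclidean_space) chart set \<Rightarrow>
   ('b::topological_space, 'd::euclidean_space) chart set \<Rightarrow>
   ('b \<Rightarrow> 'b tvec \<Rightarrow> 'b tvec \<Rightarrow> real) \<Rightarrow> ('a \<Rightarrow> 'b) \<Rightarrow> ('r::finite \<Rightarrow> 'a \<Rightarrow> 'b tvec) \<Rightarrow> bool" where
  "orthonormal_normal_frame \<A> \<B> g' f N \<longleftrightarrow>
     (\<forall>\<alpha>. N \<alpha> \<in> vector_fields_along \<A> \<B> f) \<and>
     (\<forall>p \<alpha>. \<forall>v\<in>tangent_space \<A> p. g' (f p) (differential \<B> f v) (N \<alpha> p) = 0) \<and>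
     (\<forall>p \<alpha> \<beta>. g' (f p) (N \<alpha> p) (N \<beta> p) = (if \<alpha> = \<beta> then 1 else 0))"

definition induced_structure ::
  "('a::topological_space, 'e::euclidean_space) chart set \<Rightarrow>
   ('b::topological_space, 'd::euclidean_space) chart set \<Rightarrow>
   ('b \<Rightarrow> 'b tvec \<Rightarrow> 'b tvec) \<Rightarrow> ('a \<Rightarrow> 'b) \<Rightarrow> ('r::finite \<Rightarrow> 'a \<Rightarrow> 'b tvec) \<Rightarrow>
   ('a \<Rightarrow> 'a tvec \<Rightarrow> 'a tvec) \<Rightarrow> ('r \<Rightarrow> 'a \<Rightarrow> 'a tvec \<Rightarrow> real) \<Rightarrow>
   ('r \<Rightarrow> 'a \<Rightarrow> 'a tvec) \<Rightarrow> ('a \<Rightarrow> real ^ 'r ^ 'r) \<Rightarrow> bool" where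
  "induced_structure \<A> \<B> P' f N P u \<xi> a \<longleftrightarrow>
     tensor_field_11 \<A> P \<and> (\<forall>\<alpha>. one_form \<A> (u \<alpha>)) \<and> (\<forall>\<alpha>. \<xi> \<alpha> \<in> vector_fields \<A>) \<and>
     (\<forall>\<alpha> \<beta>. smooth_fun \<A> (\<lambda>p. a p $ \<alpha> $ \<beta>)) \<and>
     (\<forall>X\<in>vector_fields \<A>. \<forall>p.
        P' (f p) (differential \<B> f (X p)) =
          differential \<B> f (P p (X p)) + (\<Sum>\<alpha>\<in>UNIV. u \<alpha> p (X p) *\<^sub>R N \<alpha> p)) \<and>
     (\<forall>\<alpha> p. P' (f p) (N \<alpha> p) =
          differential \<B> f (\<xi> \<alpha> p) + (\<Sum>\<beta>\<in>UNIV. a p $ \<alpha> $ \<beta> *\<^sub>R N \<beta> p))"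

definition normal_structure ::
  "('a::topological_space, 'e::euclidean_space) chart set \<Rightarrow>
   ('a \<Rightarrow> 'a tvec \<Rightarrow> 'a tvec) \<Rightarrow> ('r::finite \<Rightarrow> 'a \<Rightarrow> 'a tvec \<Rightarrow> real) \<Rightarrow>
   ('r \<Rightarrow> 'a \<Rightarrow> 'a tvec) \<Rightarrow> bool" where
  "normal_structure \<A> P u \<xi> \<longleftrightarrow>
     (\<forall>X\<in>vector_fields \<A>. \<forall>Y\<in>vector_fields \<A>. \<forall>p.
        nijenhuis P X Y p - 2 *\<^sub>R (\<Sum>\<alpha>\<in>UNIV. ext_deriv (u \<alpha>) X Y p *\<^sub>R \<xi> \<alpha> p) = 0)"

text \<open>
  The Weingarten formula, with \<open>D\<close> the ambient covariant derivative along \<open>f\<close>. It determines the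
  Weingarten operators \<open>A \<alpha>\<close> and the forms \<open>l \<alpha> \<beta>\<close> of the normal connection.
\<close>

definition weingarten_formula ::
  "('a::topological_space, 'e::euclidean_space) chart set \<Rightarrow>
   ('b::topological_space, 'd::euclidean_space) chart set \<Rightarrow> ('a \<Rightarrow> 'b) \<Rightarrow>
   (('a \<Rightarrow> 'a tvec) \<Rightarrow> ('a \<Rightarrow> 'b tvec) \<Rightarrow> 'a \<Rightarrow> 'b tvec) \<Rightarrow> ('r::finite \<Rightarrow> 'a \<Rightarrow> 'b tvec) \<Rightarrow>
   ('r \<Rightarrow> 'a \<Rightarrow> 'a tvec \<Rightarrow> 'a tvec) \<Rightarrow> ('r \<Rightarrow> 'r \<Rightarrow> 'a \<Rightarrow> 'a tvec \<Rightarrow> real) \<Rightarrow> bool" where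
  "weingarten_formula \<A> \<B> f D N A l \<longleftrightarrow>
     (\<forall>\<alpha>. tensor_field_11 \<A> (A \<alpha>)) \<and> (\<forall>\<alpha> \<beta>. one_form \<A> (l \<alpha> \<beta>)) \<and>
     (\<forall>\<alpha>. \<forall>X\<in>vector_fields \<A>. \<forall>p.
        D X (N \<alpha>) p =
          - differential \<B> f (A \<alpha> p (X p)) + (\<Sum>\<beta>\<in>UNIV. l \<alpha> \<beta> p (X p) *\<^sub>R N \<beta> p))"

end

theory Submission
  imports Defs
begin

text \<open>
  Write \<open>B\<^sub>\<alpha> = A\<^sub>\<alpha> P - P A\<^sub>\<alpha>\<close>. Since \<open>P'\<close> is parallel and the normal connection vanishes, the Gauss
  and Weingarten formulas express the derivatives of \<open>P\<close> and \<open>u\<^sub>\<alpha>\<close> through the \<open>A\<^sub>\<alpha>\<close>, and the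
  tensor in the normality condition becomes
  \<open>\<Sum>\<^sub>\<alpha> u\<^sub>\<alpha>(Y) B\<^sub>\<alpha> X - u\<^sub>\<alpha>(X) B\<^sub>\<alpha> Y\<close>. Thus \<open>\<Sum>\<^sub>\<alpha> u\<^sub>\<alpha>(Y) g(B\<^sub>\<alpha> X, Z)\<close> is symmetric in \<open>X, Y\<close>; as \<open>P\<close>
  and \<open>A\<^sub>\<alpha>\<close> are self-adjoint, it is also skew in \<open>X, Z\<close>, and so it vanishes. Taking \<open>Y = \<xi>\<^sub>\<beta>\<close>, where
  \<open>u\<^sub>\<alpha>(\<xi>\<^sub>\<beta>)\<close> are the entries of the invertible matrix \<open>I - a\<^sup>2\<close>, gives \<open>B\<^sub>\<alpha> = 0\<close>.

  That the derivative along the immersion is metric, torsion-free and commutes with \<open>P'\<close> is only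
  given for restrictions of ambient fields. It extends to all fields along the immersion because,
  multiplied by a bump function, such a field is a combination of restrictions with smooth
  coefficients.
\<close>

section \<open>Calculus of smooth functions\<close>

text \<open>Two features of the setting shape the proof. A tangent vector is a directional
  derivative in a chart, yet it acts on globally defined functions. Coordinates must be cut off
  before a vector can be applied to them, and identities are proved after multiplication by powers
  of the cut-off, which is cancelled at the one point where it is known to be nonzero. For the same
  reason a Lie bracket is not tangent by definition; this takes the symmetry of second derivatives.

  Moreover, the connection of \<open>M\<close> is not given but extracted from \<open>D\<close>. A
  dimension count shows that the normal frame completes the tangent space of \<open>M\<close>, so
  \<open>D\<close> splits into a tangential and a normal part. Self-adjointness of
  \<open>A \<alpha>\<close> is a consequence: the normal part of the torsion identity is the
  symmetry of the second fundamental form. By this symmetry the terms of the Nijenhuis tensor that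
  contain \<open>P p (\<xi> \<alpha> p)\<close> cancel, and those with
  \<open>\<xi> \<alpha> p\<close> alone are exactly the exterior derivatives subtracted in the
  normality condition, so only commutators survive.\<close>

lemma Ck_on_subset: "Ck_on k T f \<Longrightarrow> S \<subseteq> T \<Longrightarrow> Ck_on k S f"
  by (induction k arbitrary: f) (auto intro: continuous_on_subset differentiable_on_subset)

text \<open>A derivative at a point depends only on values near that point. As each \<open>T\<close>
  is open, \<open>f\<close> and \<open>g\<close> have the same derivatives throughout
  \<open>T\<close>, so the hypothesis passes to the derivatives with the same \<open>T\<close>. This
  allows a function to be given by different formulas on different patches.\<close>

lemma Ck_on_local:
  assumes "\<And>x. x \<in> S \<Longrightarrow> \<exists>T g. open T \<and> x \<in> T \<and> Ck_on k T g \<and> (\<forall>y\<in>T. f y = g y)"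
  shows "Ck_on k S f"
  using assms
proof (induction k arbitrary: f)
  case 0
  have "isCont f x" if x: "x \<in> S" for x
  proof -
    obtain T g where T: "open T" "x \<in> T" "continuous_on T g" "\<forall>y\<in>T. f y = g y"
      using 0(1)[OF x] by auto
    have "continuous_on T f" by (rule continuous_on_eq[OF T(3)]) (use T in simp)
    then show ?thesis using T(1,2) continuous_on_eq_continuous_at by blast
  qed
  then show ?case by (simp add: continuous_at_imp_continuous_on)
next
  case (Suc k)
  have "f differentiable (at x)" if x: "x \<in> S" for x
  proof -
    obtain T g where T: "open T" "x \<in> T" "g differentiable_on T" "\<forall>y\<in>T. f y = g y"
      using Suc.prems(1)[OF x] by auto
    then have "g differentiable (at x)" by (simp add: differentiable_on_eq_differentiable_at)
    then show ?thesis
      using T unfolding differentiable_def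
      by (metis has_derivative_transform_within_open)
  qed
  then have "f differentiable_on S"
    by (simp add: differentiable_at_imp_differentiable_on)
  moreover have "Ck_on k S (\<lambda>x. frechet_derivative f (at x) e)" for e
  proof (rule Suc.IH)
    fix x assume "x \<in> S"
    from Suc.prems[OF this] obtain T g where T: "open T" "x \<in> T" "Ck_on (Suc k) T g" "\<forall>y\<in>T. f y = g y"
      by blast
    have "frechet_derivative f (at y) e = frechet_derivative g (at y) e" if "y \<in> T" for y
    proof -
      have "g differentiable (at y)"
        using T that by (simp add: differentiable_on_eq_differentiable_at)
      then show ?thesis
        using T that by (metis frechet_derivative_transform_within_open)
    qed
    then show "\<exists>T g. open T \<and> x \<in> T \<and> Ck_on k T g \<and> (\<forall>y\<in>T. frechet_derivative f (at y) e = g y)"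
      using T by (intro exI[of _ T] exI[of _ "\<lambda>y. frechet_derivative g (at y) e"]) auto
  qed
  ultimately show ?case by simp
qed

lemma Ck_on_cong:
  assumes "open S" "Ck_on k S g" "\<And>x. x \<in> S \<Longrightarrow> f x = g x"
  shows "Ck_on k S f"
  using assms by (intro Ck_on_local) blast

lemma Ck_on_SucD: "open S \<Longrightarrow> Ck_on (Suc k) S f \<Longrightarrow> Ck_on k S f"
  by (induction k arbitrary: f) (auto intro: differentiable_imp_continuous_on)

lemma Ck_on_differentiable:
  "open S \<Longrightarrow> Ck_on (Suc k) S f \<Longrightarrow> x \<in> S \<Longrightarrow> f differentiable (at x)"
  by (simp add: differentiable_on_eq_differentiable_at)

text \<open>Lets an explicit formula \<open>f'\<close> replace \<open>frechet_derivative f\<close>,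
  so that closure properties become inductions on \<open>k\<close> with the usual differentiation
  rules.\<close>

lemma Ck_on_Suc_has_derivative:
  assumes "open S" "\<And>x. x \<in> S \<Longrightarrow> (f has_derivative f' x) (at x)" "\<And>e. Ck_on k S (\<lambda>x. f' x e)"
  shows "Ck_on (Suc k) S f"
proof -
  have "frechet_derivative f (at x) = f' x" if "x \<in> S" for x
    using assms(2)[OF that] by (metis frechet_derivative_at)
  moreover have "f differentiable_on S"
    using assms(2) by (meson differentiable_at_imp_differentiable_on differentiable_def)
  ultimately show ?thesis
    using assms Ck_on_cong[OF assms(1) assms(3)] by simp
qed

lemma Ck_on_const: "Ck_on k S (\<lambda>x. c)"
  by (induction k arbitrary: c) auto

lemma Ck_on_bounded_linear: "bounded_linear f \<Longrightarrow> open S \<Longrightarrow> Ck_on k S f"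
proof (cases k)
  case (Suc j)
  assume "bounded_linear f" "open S"
  then show ?thesis unfolding Suc
    by (intro Ck_on_Suc_has_derivative[of S f "\<lambda>_. f"] bounded_linear_imp_has_derivative Ck_on_const)
qed (simp add: linear_continuous_on)

lemma Ck_on_add:
  assumes "open S" "Ck_on k S f" "Ck_on k S g"
  shows "Ck_on k S (\<lambda>x. f x + g x)"
  using assms(2,3)
proof (induction k arbitrary: f g)
  case (Suc k)
  show ?case
  proof (rule Ck_on_Suc_has_derivative[OF assms(1)])
    fix x assume "x \<in> S"
    then show "((\<lambda>x. f x + g x) has_derivative
        (\<lambda>e. frechet_derivative f (at x) e + frechet_derivative g (at x) e)) (at x)"
      using Suc.prems assms(1)
      by (auto intro!: has_derivative_add
          simp: frechet_derivative_works[symmetric] differentiable_on_eq_differentiable_at)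
  next
    fix e
    show "Ck_on k S (\<lambda>x. frechet_derivative f (at x) e + frechet_derivative g (at x) e)"
      by (rule Suc.IH) (use Suc.prems in auto)
  qed
qed (simp add: continuous_on_add)

lemma Ck_on_mult:
  fixes f g :: "_ \<Rightarrow> real"
  assumes "open S" "Ck_on k S f" "Ck_on k S g"
  shows "Ck_on k S (\<lambda>x. f x * g x)"
  using assms(2,3)
proof (induction k arbitrary: f g)
  case (Suc k)
  show ?case
  proof (rule Ck_on_Suc_has_derivative[OF assms(1)])
    fix x assume "x \<in> S"
    then show "((\<lambda>x. f x * g x) has_derivative
        (\<lambda>e. f x * frechet_derivative g (at x) e + frechet_derivative f (at x) e * g x)) (at x)"
      using Suc.prems assms(1)
      by (auto intro!: has_derivative_mult
          simp: frechet_derivative_works[symmetric] differentiable_on_eq_differentiable_at)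
  next
    fix e
    show "Ck_on k S (\<lambda>x. f x * frechet_derivative g (at x) e + frechet_derivative f (at x) e * g x)"
      by (intro Ck_on_add Suc.IH assms(1))
        (use Suc.prems Ck_on_SucD[OF assms(1)] in auto)
  qed
qed (simp add: continuous_on_mult)

lemma Ck_on_sum:
  assumes "open S" "\<And>i. i \<in> I \<Longrightarrow> Ck_on k S (f i)"
  shows "Ck_on k S (\<lambda>x. \<Sum>i\<in>I. f i x)"
  using assms(2)
  by (induction I rule: infinite_finite_induct) (auto intro: Ck_on_const Ck_on_add assms(1))

lemma Ck_on_inner:
  fixes f :: "_ \<Rightarrow> 'y::real_inner"
  assumes "open S" "Ck_on k S f"
  shows "Ck_on k S (\<lambda>x. f x \<bullet> i)"
  using assms(2)
proof (induction k arbitrary: f)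
  case (Suc k)
  show ?case
  proof (rule Ck_on_Suc_has_derivative[OF assms(1)])
    fix x assume "x \<in> S"
    then show "((\<lambda>x. f x \<bullet> i) has_derivative (\<lambda>e. frechet_derivative f (at x) e \<bullet> i)) (at x)"
      using Suc.prems assms(1)
      by (auto intro!: has_derivative_inner_left
          simp: frechet_derivative_works[symmetric] differentiable_on_eq_differentiable_at)
  qed (use Suc in auto)
qed (auto intro: continuous_intros)

text \<open>Expanding the derivative of \<open>f\<close> in \<open>Basis\<close> turns the chain
  rule into a finite sum of products of real functions, one factor being a partial derivative of
  \<open>g\<close> composed with \<open>f\<close>. The induction hypothesis covers that factor
  because it holds for all \<open>g\<close>.\<close>

lemma Ck_on_compose:
  fixes f :: "'x::real_normed_vector \<Rightarrow> 'y::euclidean_space" and g :: "'y \<Rightarrow> real"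
  assumes "open S" "open T" "f ` S \<subseteq> T" "Ck_on k S f" "Ck_on k T g"
  shows "Ck_on k S (\<lambda>x. g (f x))"
  using assms(4,5)
proof (induction k arbitrary: g)
  case 0
  then show ?case
    using assms(3) by (auto intro: continuous_on_compose2)
next
  case (Suc k)
  have f: "Ck_on k S f" using Ck_on_SucD[OF assms(1) Suc.prems(1)] .
  show ?case
  proof (rule Ck_on_Suc_has_derivative[OF assms(1)])
    fix x assume x: "x \<in> S"
    define f' g' where "f' = frechet_derivative f (at x)" and "g' = frechet_derivative g (at (f x))"
    have df: "(f has_derivative f') (at x)"
      unfolding f'_def frechet_derivative_works[symmetric]
      using Ck_on_differentiable[OF assms(1) Suc.prems(1) x] .
    have dg: "(g has_derivative g') (at (f x))"
      unfolding g'_def frechet_derivative_works[symmetric]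
      using Ck_on_differentiable[OF assms(2) Suc.prems(2)] x assms(3) by blast
    have lin: "linear g'" using dg by (rule has_derivative_linear)
    have "g' (f' e) = (\<Sum>i\<in>Basis. (f' e \<bullet> i) * g' i)" for e
      using Linear_Algebra.linear_componentwise[OF lin, of "f' e" 1] by simp
    moreover have "((\<lambda>x. g (f x)) has_derivative (\<lambda>e. g' (f' e))) (at x)"
      using diff_chain_at[OF df dg] by (simp add: o_def)
    ultimately show "((\<lambda>x. g (f x)) has_derivative
      (\<lambda>e. \<Sum>i\<in>Basis. (frechet_derivative f (at x) e \<bullet> i) * frechet_derivative g (at (f x)) i)) (at x)"
      unfolding f'_def g'_def by presburger
  next
    fix e
    have "Ck_on k S (\<lambda>x. (frechet_derivative f (at x) e \<bullet> i) * frechet_derivative g (at (f x)) i)" for i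
      by (rule Ck_on_mult[OF assms(1)], rule Ck_on_inner[OF assms(1)])
        (use Suc.prems f in \<open>auto intro: Suc.IH[of "\<lambda>y. frechet_derivative g (at y) i"]\<close>)
    then show "Ck_on k S (\<lambda>x. \<Sum>i\<in>Basis.
        (frechet_derivative f (at x) e \<bullet> i) * frechet_derivative g (at (f x)) i)"
      by (intro Ck_on_sum assms(1))
  qed
qed

section \<open>Closure properties of smooth maps\<close>

lemma smooth_on_subset: "smooth_on T f \<Longrightarrow> S \<subseteq> T \<Longrightarrow> smooth_on S f"
  by (auto simp: smooth_on_def intro: Ck_on_subset)

lemma smooth_on_local:
  assumes "\<And>x. x \<in> S \<Longrightarrow> \<exists>T g. open T \<and> x \<in> T \<and> smooth_on T g \<and> (\<forall>y\<in>T. f y = g y)"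
  shows "smooth_on S f"
  using assms unfolding smooth_on_def by (metis Ck_on_local)

lemma smooth_on_differentiable:
  "open S \<Longrightarrow> smooth_on S f \<Longrightarrow> x \<in> S \<Longrightarrow> f differentiable (at x)"
  unfolding smooth_on_def by (metis Ck_on_differentiable)

lemma smooth_on_has_derivative:
  "open S \<Longrightarrow> smooth_on S f \<Longrightarrow> x \<in> S \<Longrightarrow> (f has_derivative frechet_derivative f (at x)) (at x)"
  by (metis smooth_on_differentiable frechet_derivative_works)

lemma smooth_on_frechet_derivative:
  "smooth_on S f \<Longrightarrow> smooth_on S (\<lambda>x. frechet_derivative f (at x) e)"
  unfolding smooth_on_def by (metis Ck_on.simps(2))

lemma smooth_on_const: "smooth_on S (\<lambda>x. c)"
  by (simp add: smooth_on_def Ck_on_const)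

lemma smooth_on_bounded_linear: "bounded_linear f \<Longrightarrow> open S \<Longrightarrow> smooth_on S f"
  by (simp add: smooth_on_def Ck_on_bounded_linear)

lemma smooth_on_add:
  "open S \<Longrightarrow> smooth_on S f \<Longrightarrow> smooth_on S g \<Longrightarrow> smooth_on S (\<lambda>x. f x + g x)"
  by (simp add: smooth_on_def Ck_on_add)

lemma smooth_on_mult:
  fixes f g :: "_ \<Rightarrow> real"
  shows "open S \<Longrightarrow> smooth_on S f \<Longrightarrow> smooth_on S g \<Longrightarrow> smooth_on S (\<lambda>x. f x * g x)"
  by (simp add: smooth_on_def Ck_on_mult)

lemma smooth_on_sum:
  "open S \<Longrightarrow> (\<And>i. i \<in> I \<Longrightarrow> smooth_on S (f i)) \<Longrightarrow> smooth_on S (\<lambda>x. \<Sum>i\<in>I. f i x)"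
  by (simp add: smooth_on_def Ck_on_sum)

lemma smooth_on_compose:
  fixes f :: "'x::real_normed_vector \<Rightarrow> 'y::euclidean_space" and g :: "'y \<Rightarrow> real"
  shows "open S \<Longrightarrow> open T \<Longrightarrow> f ` S \<subseteq> T \<Longrightarrow> smooth_on S f \<Longrightarrow> smooth_on T g \<Longrightarrow>
    smooth_on S (\<lambda>x. g (f x))"
  unfolding smooth_on_def by (metis Ck_on_compose)

text \<open>The index \<open>n\<close> closes the family under derivatives, up to linear combinations.\<close>

definition flat_exp :: "nat \<Rightarrow> real \<Rightarrow> real" where
  "flat_exp n t = (if t > 0 then exp (- 1 / t) / t ^ n else 0)"

text \<open>Away from 0 this is the quotient rule. At 0 the right-hand side is 0, and the difference
  quotient tends to 0 because the exponential decay beats every power.\<close>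

lemma flat_exp_has_derivative:
  "(flat_exp n has_field_derivative flat_exp (n + 2) t - n * flat_exp (n + 1) t) (at t)"
proof -
  consider "t > 0" | "t < 0" | "t = 0" by linarith
  then show ?thesis
  proof cases
    case 1
    \<comment> \<open>Natural subtraction truncates \<open>n - Suc 0\<close> at
      \<open>n = 0\<close>; there the factor \<open>n\<close> makes both sides 0.\<close>
    have n: "real n * t ^ (n - Suc 0) = real n * t ^ n / t"
      using 1 by (cases n) auto
    have "((\<lambda>t. exp (- 1 / t) / t ^ n) has_field_derivative
        (exp (- 1 / t) * (1 / t\<^sup>2) * t ^ n - exp (- 1 / t) * (real n * t ^ (n - Suc 0))) / (t ^ n * t ^ n)) (at t)"
      using 1 by (auto intro!: derivative_eq_intros simp: power2_eq_square)
    moreover have "(exp (- 1 / t) * (1 / t\<^sup>2) * t ^ n - exp (- 1 / t) * (real n * t ^ (n - Suc 0))) / (t ^ n * t ^ n) =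
        flat_exp (n + 2) t - n * flat_exp (n + 1) t"
      using 1 unfolding flat_exp_def n by (simp add: field_simps power2_eq_square)
    ultimately have "((\<lambda>t. exp (- 1 / t) / t ^ n) has_field_derivative
        flat_exp (n + 2) t - n * flat_exp (n + 1) t) (at t)"
      by simp
    from has_field_derivative_transform_within_open[OF this, of "{0<..}"] show ?thesis
      using 1 by (auto simp: flat_exp_def)
  next
    case 2
    have "((\<lambda>t. 0) has_field_derivative flat_exp (n + 2) t - n * flat_exp (n + 1) t) (at t)"
      using 2 by (simp add: flat_exp_def)
    from has_field_derivative_transform_within_open[OF this, of "{..<0}"] show ?thesis
      using 2 by (auto simp: flat_exp_def)
  next
    case 3
    have "((\<lambda>h. (flat_exp n (0 + h) - flat_exp n 0) / h) \<longlongrightarrow> 0) (at 0)"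
      unfolding filterlim_at_split
    proof
      have "eventually (\<lambda>h. (flat_exp n (0 + h) - flat_exp n 0) / h = 0) (at_left 0)"
        by (auto simp: eventually_at_filter flat_exp_def)
      then show "((\<lambda>h. (flat_exp n (0 + h) - flat_exp n 0) / h) \<longlongrightarrow> 0) (at_left 0)"
        by (simp add: tendsto_eventually)
      \<comment> \<open>Substituting \<open>h = 1 / x\<close> turns this into the limit of
        \<open>x ^ Suc n / exp x\<close> at infinity.\<close>
      have "((\<lambda>h::real. exp (- 1 / h) / h ^ n / h) \<longlongrightarrow> 0) (at_right 0)"
        unfolding filterlim_at_right_to_top
      proof (rule Lim_transform_eventually[OF tendsto_power_div_exp_0[of "Suc n"]])
        show "\<forall>\<^sub>F x::real in at_top. x ^ Suc n / exp x = exp (- 1 / inverse x) / inverse x ^ n / inverse x"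
          using eventually_gt_at_top[of "0::real"]
          by eventually_elim (simp add: exp_minus field_simps)
      qed
      moreover have "eventually (\<lambda>h. exp (- 1 / h) / h ^ n / h = (flat_exp n (0 + h) - flat_exp n 0) / h) (at_right 0)"
        using eventually_at_right_less[of 0] by eventually_elim (simp add: flat_exp_def)
      ultimately show "((\<lambda>h. (flat_exp n (0 + h) - flat_exp n 0) / h) \<longlongrightarrow> 0) (at_right 0)"
        by (rule Lim_transform_eventually)
    qed
    then show ?thesis
      using 3 by (simp add: DERIV_def flat_exp_def)
  qed
qed

lemma smooth_on_flat_exp: "smooth_on UNIV (flat_exp n)"
proof -
  have "Ck_on k UNIV (flat_exp n)" for k
  proof (induction k arbitrary: n)
    case 0
    then show ?case
      using flat_exp_has_derivative DERIV_isCont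
      by (metis Ck_on.simps(1) continuous_at_imp_continuous_on)
  next
    case (Suc k)
    show ?case
    proof (rule Ck_on_Suc_has_derivative)
      fix t
      show "(flat_exp n has_derivative
          (\<lambda>e. (flat_exp (n + 2) t + (- n) * flat_exp (n + 1) t) * e)) (at t)"
        using flat_exp_has_derivative[of n t] by (simp add: has_field_derivative_def)
    next
      fix e
      show "Ck_on k UNIV (\<lambda>t. (flat_exp (n + 2) t + (- n) * flat_exp (n + 1) t) * e)"
        by (intro Ck_on_mult Ck_on_add Ck_on_const Suc.IH open_UNIV)
    qed simp
  qed
  then show ?thesis by (simp add: smooth_on_def)
qed

section \<open>Symmetry of mixed second derivatives\<close>

lemma directional_MVT:
  fixes f :: "'x::real_normed_vector \<Rightarrow> real"
  assumes "h > 0" "\<And>t. 0 \<le> t \<Longrightarrow> t \<le> h \<Longrightarrow> f differentiable (at (x + t *\<^sub>R u))"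
  shows "\<exists>t. 0 < t \<and> t < h \<and> f (x + h *\<^sub>R u) - f x = h * frechet_derivative f (at (x + t *\<^sub>R u)) u"
proof -
  have "((\<lambda>t. f (x + t *\<^sub>R u)) has_real_derivative frechet_derivative f (at (x + t *\<^sub>R u)) u) (at t)"
    if "0 \<le> t" "t \<le> h" for t
  proof -
    have 1: "((\<lambda>t. x + t *\<^sub>R u) has_derivative (\<lambda>s. s *\<^sub>R u)) (at t)"
      by (auto intro!: derivative_eq_intros)
    have 2: "(f has_derivative frechet_derivative f (at (x + t *\<^sub>R u))) (at (x + t *\<^sub>R u))"
      using assms(2)[OF that] frechet_derivative_works by blast
    have "linear (frechet_derivative f (at (x + t *\<^sub>R u)))"
      using 2 by (rule has_derivative_linear)
    then show ?thesis
      using diff_chain_at[OF 1 2]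
      by (simp add: has_field_derivative_def o_def linear_cmul mult_commute_abs)
  qed
  from MVT2[OF assms(1), of "\<lambda>t. f (x + t *\<^sub>R u)", OF this]
  show ?thesis by auto
qed

text \<open>The second difference is the increment along \<open>u\<close> of
  \<open>F z = f (z + h *\<^sub>R v) - f z\<close>. The mean value theorem along \<open>u\<close>
  and then along \<open>v\<close> produces the two factors \<open>h\<close>. The extra
  \<open>h\<close> in the radius puts the point into an open ball even if
  \<open>u = v = 0\<close>.\<close>

lemma second_difference:
  fixes f :: "'x::real_normed_vector \<Rightarrow> real"
  assumes "h > 0" "h * (norm u + norm v) < r" "Ck_on 2 (ball x r) f"
  shows "\<exists>y\<in>ball x (h * (norm u + norm v) + h).
    f (x + h *\<^sub>R u + h *\<^sub>R v) - f (x + h *\<^sub>R u) - f (x + h *\<^sub>R v) + f x =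
      h\<^sup>2 * frechet_derivative (\<lambda>z. frechet_derivative f (at z) u) (at y) v"
proof -
  have near: "norm (s *\<^sub>R u + t *\<^sub>R v) \<le> h * (norm u + norm v)" if "0 \<le> s" "s \<le> h" "0 \<le> t" "t \<le> h" for s t
  proof -
    have "norm (s *\<^sub>R u + t *\<^sub>R v) \<le> s * norm u + t * norm v"
      using norm_triangle_ineq[of "s *\<^sub>R u" "t *\<^sub>R v"] that by simp
    also have "\<dots> \<le> h * (norm u + norm v)"
      using that by (auto simp: distrib_left intro!: add_mono mult_right_mono)
    finally show ?thesis .
  qed
  have inb: "x + s *\<^sub>R u + t *\<^sub>R v \<in> ball x r" if "0 \<le> s" "s \<le> h" "0 \<le> t" "t \<le> h" for s t
    using near[OF that] assms(2) norm_minus_cancel[of "s *\<^sub>R u + t *\<^sub>R v"]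
    by (simp add: dist_norm)
  have df: "f differentiable (at z)" and ddf: "(\<lambda>z. frechet_derivative f (at z) u) differentiable (at z)"
    if "z \<in> ball x r" for z
    using assms(3) that by (auto simp: numeral_2_eq_2 differentiable_on_eq_differentiable_at)
  define F where "F z = f (z + h *\<^sub>R v) - f z" for z
  have dF: "F differentiable (at (x + t *\<^sub>R u))" and
    F': "frechet_derivative F (at (x + t *\<^sub>R u)) u =
      frechet_derivative f (at (x + t *\<^sub>R u + h *\<^sub>R v)) u - frechet_derivative f (at (x + t *\<^sub>R u)) u"
    if t: "0 \<le> t" "t \<le> h" for t
  proof -
    have z: "x + t *\<^sub>R u \<in> ball x r" "x + t *\<^sub>R u + h *\<^sub>R v \<in> ball x r"
      using inb[of t 0] inb[of t h] t assms(1) by auto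
    have 1: "((\<lambda>z. z + h *\<^sub>R v) has_derivative (\<lambda>e. e)) (at (x + t *\<^sub>R u))"
      by (auto intro!: derivative_eq_intros)
    have 2: "(f has_derivative frechet_derivative f (at (x + t *\<^sub>R u + h *\<^sub>R v))) (at (x + t *\<^sub>R u + h *\<^sub>R v))"
      "(f has_derivative frechet_derivative f (at (x + t *\<^sub>R u))) (at (x + t *\<^sub>R u))"
      using df z frechet_derivative_works by blast+
    have "(F has_derivative (\<lambda>e. frechet_derivative f (at (x + t *\<^sub>R u + h *\<^sub>R v)) e
        - frechet_derivative f (at (x + t *\<^sub>R u)) e)) (at (x + t *\<^sub>R u))"
      unfolding F_def
      using has_derivative_diff[OF diff_chain_at[OF 1 2(1)] 2(2)] by (simp add: o_def)
    then show "F differentiable (at (x + t *\<^sub>R u))"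
      "frechet_derivative F (at (x + t *\<^sub>R u)) u =
      frechet_derivative f (at (x + t *\<^sub>R u + h *\<^sub>R v)) u - frechet_derivative f (at (x + t *\<^sub>R u)) u"
      by (auto simp: differentiable_def dest: frechet_derivative_at[symmetric])
  qed
  obtain s where s: "0 < s" "s < h"
    "F (x + h *\<^sub>R u) - F x = h * frechet_derivative F (at (x + s *\<^sub>R u)) u"
    using directional_MVT[OF assms(1) dF] by blast
  have "(\<lambda>z. frechet_derivative f (at z) u) differentiable (at (x + s *\<^sub>R u + t *\<^sub>R v))"
    if "0 \<le> t" "t \<le> h" for t
    using ddf[OF inb[of s t]] s that by simp
  from directional_MVT[OF assms(1) this] obtain t where t: "0 < t" "t < h"
    "frechet_derivative f (at (x + s *\<^sub>R u + h *\<^sub>R v)) u - frechet_derivative f (at (x + s *\<^sub>R u)) u =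
     h * frechet_derivative (\<lambda>z. frechet_derivative f (at z) u) (at (x + s *\<^sub>R u + t *\<^sub>R v)) v"
    by blast
  have "x + s *\<^sub>R u + t *\<^sub>R v \<in> ball x (h * (norm u + norm v) + h)"
    using near[of s t] s t assms(1) norm_minus_cancel[of "s *\<^sub>R u + t *\<^sub>R v"]
    by (simp add: dist_norm)
  moreover have "f (x + h *\<^sub>R u + h *\<^sub>R v) - f (x + h *\<^sub>R u) - f (x + h *\<^sub>R v) + f x =
    h\<^sup>2 * frechet_derivative (\<lambda>z. frechet_derivative f (at z) u) (at (x + s *\<^sub>R u + t *\<^sub>R v)) v"
    using s t F'[of s] by (simp add: F_def power2_eq_square)
  ultimately show ?thesis by blast
qed

text \<open>The second difference does not change when \<open>u\<close> and \<open>v\<close> are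
  exchanged. For every step \<open>h n\<close> the two mixed derivatives thus take a common value at
  points \<open>y n\<close> and \<open>z n\<close> of a ball that shrinks to \<open>x\<close>, and
  continuity gives equality in the limit.\<close>

lemma frechet_derivative_commute:
  fixes f :: "'x::real_normed_vector \<Rightarrow> real"
  assumes "open S" "Ck_on 2 S f" "x \<in> S"
  shows "frechet_derivative (\<lambda>z. frechet_derivative f (at z) u) (at x) v =
    frechet_derivative (\<lambda>z. frechet_derivative f (at z) v) (at x) u"
    (is "?G u v x = ?G v u x")
proof -
  obtain r where r: "r > 0" "ball x r \<subseteq> S"
    using assms by (meson openE)
  have C2: "Ck_on 2 (ball x r) f" using Ck_on_subset[OF assms(2) r(2)] .
  have cont: "isCont (?G a b) x" for a b
  proof -
    have "continuous_on S (?G a b)"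
      using assms(2) by (simp add: numeral_2_eq_2)
    then show ?thesis using assms by (simp add: continuous_on_eq_continuous_at)
  qed
  define c where "c = norm u + norm v"
  \<comment> \<open>Tends to 0 and satisfies \<open>h n * c < r\<close>, as
    \<open>second_difference\<close> requires; \<open>c + 1\<close> keeps the denominator positive
    when \<open>c = 0\<close>.\<close>
  define h where "h n = r / ((c + 1) * real (n + 2))" for n
  have c: "c \<ge> 0" by (simp add: c_def)
  have h: "h n > 0" "h n * c < r" for n
  proof -
    show "h n > 0" using r c by (simp add: h_def)
    have "c < (c + 1) * 1" by simp
    also have "\<dots> \<le> (c + 1) * real (n + 2)"
      using c by (intro mult_left_mono) auto
    finally have "c < (c + 1) * real (n + 2)" .
    then have "r * c < r * ((c + 1) * real (n + 2))"
      using r by simp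
    then show "h n * c < r" using r c by (simp add: h_def divide_simps add_nonneg_pos)
  qed
  have h0: "h \<longlonglongrightarrow> 0"
  proof -
    have "(\<lambda>n. r / (c + 1) * (1 / real (n + 2))) \<longlonglongrightarrow> r / (c + 1) * 0"
      by (intro tendsto_mult_left LIMSEQ_ignore_initial_segment lim_1_over_n)
    then show ?thesis by (simp add: h_def[abs_def])
  qed
  have "\<exists>y z. y \<in> ball x (h n * c + h n) \<and> z \<in> ball x (h n * c + h n) \<and> ?G u v y = ?G v u z" for n
  proof -
    obtain y where y: "y \<in> ball x (h n * c + h n)"
      "f (x + h n *\<^sub>R u + h n *\<^sub>R v) - f (x + h n *\<^sub>R u) - f (x + h n *\<^sub>R v) + f x = (h n)\<^sup>2 * ?G u v y"
      using second_difference[OF h(1) h(2)[unfolded c_def] C2] unfolding c_def by blast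
    obtain z where z: "z \<in> ball x (h n * c + h n)"
      "f (x + h n *\<^sub>R v + h n *\<^sub>R u) - f (x + h n *\<^sub>R v) - f (x + h n *\<^sub>R u) + f x = (h n)\<^sup>2 * ?G v u z"
      using second_difference[OF h(1) _ C2, of n v u] h(2)[of n]
      unfolding c_def by (auto simp: add.commute)
    have "f (x + h n *\<^sub>R u + h n *\<^sub>R v) = f (x + h n *\<^sub>R v + h n *\<^sub>R u)"
      by (simp add: ac_simps)
    then have "(h n)\<^sup>2 * ?G u v y = (h n)\<^sup>2 * ?G v u z"
      using y(2) z(2) by linarith
    then show ?thesis using y z h(1)[of n] by auto
  qed
  then obtain y z where yz: "\<And>n. y n \<in> ball x (h n * c + h n)" "\<And>n. z n \<in> ball x (h n * c + h n)"
    "\<And>n. ?G u v (y n) = ?G v u (z n)" by metis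
  have lim: "w \<longlonglongrightarrow> x" if "\<And>n. w n \<in> ball x (h n * c + h n)" for w
  proof -
    have "(\<lambda>n. h n * c + h n) \<longlonglongrightarrow> 0 * c + 0"
      by (rule tendsto_add[OF tendsto_mult_right[OF h0] h0])
    then have lim0: "(\<lambda>n. h n * c + h n) \<longlonglongrightarrow> 0" by simp
    have "norm (dist (w n) x) \<le> h n * c + h n" for n
      using that[of n] by (simp add: dist_commute)
    then have "(\<lambda>n. dist (w n) x) \<longlonglongrightarrow> 0"
      by (intro Lim_null_comparison[OF always_eventually lim0]) blast
    then show ?thesis by (rule iffD2[OF tendsto_dist_iff])
  qed
  have "(\<lambda>n. ?G u v (y n)) \<longlonglongrightarrow> ?G u v x" "(\<lambda>n. ?G v u (z n)) \<longlonglongrightarrow> ?G v u x"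
    by (rule isCont_tendsto_compose[OF cont lim[OF yz(1)]], rule isCont_tendsto_compose[OF cont lim[OF yz(2)]])
  then show ?thesis using yz(3) LIMSEQ_unique by auto
qed

section \<open>Charts, tangent vectors and local frames\<close>

lemma chartD:
  assumes "smooth_manifold \<A>" "(U, \<phi>) \<in> \<A>"
  shows open_chart_domain: "open U"
    and open_chart_range: "open (\<phi> ` U)"
    and homeomorphism_chart: "homeomorphism U (\<phi> ` U) \<phi> (inv_into U \<phi>)"
    and inj_on_chart: "inj_on \<phi> U"
proof -
  show *: "open U" "open (\<phi> ` U)" "homeomorphism U (\<phi> ` U) \<phi> (inv_into U \<phi>)"
    using assms by (force simp: smooth_manifold_def is_chart_def)+
  show "inj_on \<phi> U"
    using *(3) by (metis homeomorphism_def inj_on_inverseI)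
qed

lemma chart_at:
  assumes "smooth_manifold \<A>"
  obtains U \<phi> where "(U, \<phi>) \<in> \<A>" "p \<in> U"
proof -
  have "p \<in> (\<Union>c\<in>\<A>. fst c)" using assms by (simp add: smooth_manifold_def)
  then show ?thesis using that by force
qed

lemma open_chart_image:
  assumes "smooth_manifold \<A>" "(U, \<phi>) \<in> \<A>" "open W"
  shows "open (\<phi> ` (U \<inter> W))"
proof -
  note c = chartD[OF assms(1,2)]
  have "openin (top_of_set U) (U \<inter> W)" using assms(3) by (simp add: openin_open_Int)
  then have "openin (top_of_set (\<phi> ` U)) (\<phi> ` (U \<inter> W))"
    using homeomorphism_imp_open_map[OF c(3)] by blast
  then show ?thesis using c(2) by (simp add: openin_open_eq)
qed

lemma smooth_on_transition:
  assumes "smooth_manifold \<A>" "(U, \<phi>) \<in> \<A>" "(V, \<psi>) \<in> \<A>"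
  shows "smooth_on (\<phi> ` (U \<inter> V)) (\<lambda>x. \<psi> (inv_into U \<phi> x))"
  using assms unfolding smooth_manifold_def by (fastforce simp: o_def)

section \<open>Smooth functions on a manifold\<close>

lemma smooth_funD:
  "smooth_fun \<A> h \<Longrightarrow> (U, \<phi>) \<in> \<A> \<Longrightarrow> smooth_on (\<phi> ` U) (\<lambda>x. h (inv_into U \<phi> x))"
  by (fastforce simp: smooth_fun_def o_def)

lemma smooth_fun_const: "smooth_fun \<A> (\<lambda>p. c)"
  by (auto simp: smooth_fun_def o_def intro: smooth_on_const)

lemma smooth_fun_add:
  assumes "smooth_manifold \<A>" "smooth_fun \<A> h" "smooth_fun \<A> k"
  shows "smooth_fun \<A> (\<lambda>p. h p + k p)"
  using assms(2,3) open_chart_range[OF assms(1)]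
  by (force simp: smooth_fun_def o_def intro!: smooth_on_add)

lemma smooth_fun_mult:
  assumes "smooth_manifold \<A>" "smooth_fun \<A> h" "smooth_fun \<A> k"
  shows "smooth_fun \<A> (\<lambda>p. h p * k p)"
  using assms(2,3) open_chart_range[OF assms(1)]
  by (force simp: smooth_fun_def o_def intro!: smooth_on_mult)

lemma smooth_fun_diff:
  assumes "smooth_manifold \<A>" "smooth_fun \<A> h" "smooth_fun \<A> k"
  shows "smooth_fun \<A> (\<lambda>p. h p - k p)"
  using smooth_fun_add[OF assms(1,2) smooth_fun_mult[OF assms(1) smooth_fun_const[of _ "-1"] assms(3)]]
  by simp

lemma smooth_fun_power:
  assumes "smooth_manifold \<A>" "smooth_fun \<A> h"
  shows "smooth_fun \<A> (\<lambda>p. h p ^ n)"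
  by (induction n) (simp_all add: smooth_fun_const smooth_fun_mult assms)

lemma smooth_fun_sum:
  assumes "smooth_manifold \<A>" "\<And>i. i \<in> I \<Longrightarrow> smooth_fun \<A> (h i)"
  shows "smooth_fun \<A> (\<lambda>p. \<Sum>i\<in>I. h i p)"
  using assms(2)
  by (induction I rule: infinite_finite_induct) (auto intro: smooth_fun_const smooth_fun_add[OF assms(1)])

text \<open>Extension by zero from a chart domain. Near a point of \<open>U\<close> the transition
  map gives smoothness. A point outside \<open>U\<close> has a neighbourhood that misses the copy
  \<open>K'\<close> of \<open>K\<close>, and there the function is 0.\<close>

lemma smooth_fun_cutoff:
  fixes \<gamma> :: "'e::euclidean_space \<Rightarrow> real"
  assumes M: "smooth_manifold \<A>" and U: "(U, \<phi>) \<in> \<A>"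
    and K: "compact K" "K \<subseteq> \<phi> ` U"
    and \<gamma>: "smooth_on (\<phi> ` U) \<gamma>" "\<And>x. x \<in> \<phi> ` U - K \<Longrightarrow> \<gamma> x = 0"
  shows "smooth_fun \<A> (\<lambda>q. if q \<in> U then \<gamma> (\<phi> q) else 0)" (is "smooth_fun \<A> ?h")
  unfolding smooth_fun_def
proof clarify
  fix V \<psi> assume V: "(V, \<psi>) \<in> \<A>"
  note cU = chartD[OF M U] and cV = chartD[OF M V]
  define K' where "K' = inv_into U \<phi> ` K"
  have "compact K'"
    unfolding K'_def
    using cU(3) K by (intro compact_continuous_image) (auto simp: homeomorphism_def intro: continuous_on_subset)
  \<comment> \<open>Compact sets are closed because the manifold is Hausdorff; this makes the
    complement of \<open>K'\<close> a neighbourhood of the points outside \<open>U\<close>.\<close>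
  then have K': "closed K'" by (rule compact_imp_closed)
  show "smooth_on (\<psi> ` V) (?h \<circ> inv_into V \<psi>)"
  proof (rule smooth_on_local)
    fix x assume "x \<in> \<psi> ` V"
    then obtain q where q: "q \<in> V" "x = \<psi> q" by blast
    show "\<exists>T g. open T \<and> x \<in> T \<and> smooth_on T g \<and> (\<forall>y\<in>T. (?h \<circ> inv_into V \<psi>) y = g y)"
    proof (cases "q \<in> U")
      case True
      let ?T = "\<psi> ` (V \<inter> U)" and ?g = "\<lambda>y. \<gamma> (\<phi> (inv_into V \<psi> y))"
      have T: "open ?T" by (rule open_chart_image[OF M V cU(1)])
      have inv: "inv_into V \<psi> y \<in> U" if "y \<in> ?T" for y
        using that cV(4) by auto
      have "smooth_on ?T ?g"
        by (rule smooth_on_compose[OF T cU(2) _ smooth_on_transition[OF M V U] \<gamma>(1)]) (use inv in blast)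
      then show ?thesis
        using T inv q True by (intro exI[of _ ?T] exI[of _ ?g]) auto
    next
      case False
      let ?T = "\<psi> ` (V \<inter> - K')"
      have T: "open ?T" by (rule open_chart_image[OF M V]) (use K' in auto)
      have "q \<notin> K'"
        using False K unfolding K'_def by (auto dest!: subsetD intro: inv_into_into)
      moreover have h0: "?h r = 0" if "r \<in> V \<inter> - K'" for r
      proof (cases "r \<in> U")
        case True
        have "\<phi> r \<notin> K"
        proof
          assume "\<phi> r \<in> K"
          then have "inv_into U \<phi> (\<phi> r) \<in> K'" unfolding K'_def by blast
          then show False using that True cU(4) by simp
        qed
        then show ?thesis using True \<gamma>(2) by auto
      qed simp
      moreover have "(?h \<circ> inv_into V \<psi>) y = 0" if y: "y \<in> ?T" for y
      proof -
        obtain r where "r \<in> V \<inter> - K'" "y = \<psi> r" using y by blast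
        then show ?thesis using h0[of r] cV(4) by (simp split: if_split_asm)
      qed
      ultimately show ?thesis
        using T q smooth_on_const[of ?T 0]
        by (intro exI[of _ ?T] exI[of _ "\<lambda>_. 0"]) auto
    qed
  qed
qed

section \<open>Tangent vectors in coordinates\<close>

definition chart_vec ::
  "('a::topological_space, 'e::euclidean_space) chart set \<Rightarrow> 'a set \<Rightarrow> ('a \<Rightarrow> 'e) \<Rightarrow> 'a \<Rightarrow> 'e \<Rightarrow> 'a tvec"
  where "chart_vec \<A> U \<phi> p e = (\<lambda>h. if smooth_fun \<A> h
    then frechet_derivative (\<lambda>x. h (inv_into U \<phi> x)) (at (\<phi> p)) e else 0)"

lemma tangent_space_eq_chart_vecs:
  "tangent_space \<A> p = {v. \<exists>(U, \<phi>)\<in>\<A>. \<exists>e. p \<in> U \<and> v = chart_vec \<A> U \<phi> p e}"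
  unfolding tangent_space_def chart_vec_def comp_def ..

text \<open>In this form uniqueness of derivatives becomes available: additivity, the product rule
  and the change of charts follow by computing one derivative in two ways.\<close>

lemma has_derivative_in_chart:
  assumes "smooth_manifold \<A>" "(U, \<phi>) \<in> \<A>" "p \<in> U" "smooth_fun \<A> h"
  shows "((\<lambda>x. h (inv_into U \<phi> x)) has_derivative (\<lambda>e. chart_vec \<A> U \<phi> p e h)) (at (\<phi> p))"
proof -
  have "((\<lambda>x. h (inv_into U \<phi> x)) has_derivative
      frechet_derivative (\<lambda>x. h (inv_into U \<phi> x)) (at (\<phi> p))) (at (\<phi> p))"
    by (rule smooth_on_has_derivative[OF open_chart_range[OF assms(1,2)] smooth_funD[OF assms(4,2)]])
      (use assms in auto)
  then show ?thesis using assms by (simp add: chart_vec_def)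
qed

lemma linear_chart_vec:
  assumes "smooth_manifold \<A>" "(U, \<phi>) \<in> \<A>" "p \<in> U"
  shows "linear (chart_vec \<A> U \<phi> p)"
proof (rule linearI)
  have lin: "linear (\<lambda>e. chart_vec \<A> U \<phi> p e h)" if "smooth_fun \<A> h" for h
    using has_derivative_in_chart[OF assms that] by (rule has_derivative_linear)
  fix e e' :: 'b and c :: real
  show "chart_vec \<A> U \<phi> p (e + e') = chart_vec \<A> U \<phi> p e + chart_vec \<A> U \<phi> p e'"
  proof
    fix h
    show "chart_vec \<A> U \<phi> p (e + e') h = (chart_vec \<A> U \<phi> p e + chart_vec \<A> U \<phi> p e') h"
      using linear_add[OF lin[of h]] by (cases "smooth_fun \<A> h") (auto simp: chart_vec_def)
  qed
  show "chart_vec \<A> U \<phi> p (c *\<^sub>R e) = c *\<^sub>R chart_vec \<A> U \<phi> p e"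
  proof
    fix h
    show "chart_vec \<A> U \<phi> p (c *\<^sub>R e) h = (c *\<^sub>R chart_vec \<A> U \<phi> p e) h"
      using linear_cmul[OF lin[of h]]
      by (cases "smooth_fun \<A> h") (auto simp: chart_vec_def scaleR_fun_def)
  qed
qed

text \<open>The Jacobian of the transition map transforms the components. Hence the union over all
  charts in \<open>tangent_space\<close> collapses to the range of one linear map, which makes it a
  subspace.\<close>

lemma chart_vec_change:
  assumes M: "smooth_manifold \<A>" and U: "(U, \<phi>) \<in> \<A>" "p \<in> U" and V: "(V, \<psi>) \<in> \<A>" "p \<in> V"
  shows "chart_vec \<A> V \<psi> p e =
    chart_vec \<A> U \<phi> p (frechet_derivative (\<lambda>x. \<phi> (inv_into V \<psi> x)) (at (\<psi> p)) e)"
proof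
  fix h
  note cU = chartD[OF M U(1)] and cV = chartD[OF M V(1)]
  let ?t = "\<lambda>x. \<phi> (inv_into V \<psi> x)"
  show "chart_vec \<A> V \<psi> p e h = chart_vec \<A> U \<phi> p (frechet_derivative ?t (at (\<psi> p)) e) h"
  proof (cases "smooth_fun \<A> h")
    case True
    let ?T = "\<psi> ` (V \<inter> U)"
    have T: "open ?T" by (rule open_chart_image[OF M V(1) cU(1)])
    have p: "\<psi> p \<in> ?T" using U V by blast
    have 1: "(?t has_derivative frechet_derivative ?t (at (\<psi> p))) (at (\<psi> p))"
      using smooth_on_has_derivative[OF T smooth_on_transition[OF M V(1) U(1)] p] .
    have tp: "?t (\<psi> p) = \<phi> p" using cV(4) V(2) by simp
    have 2: "((\<lambda>x. h (inv_into U \<phi> x)) has_derivative (\<lambda>e. chart_vec \<A> U \<phi> p e h)) (at (?t (\<psi> p)))"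
      unfolding tp using has_derivative_in_chart[OF M U True] .
    have eq: "h (inv_into V \<psi> x) = ((\<lambda>x. h (inv_into U \<phi> x)) \<circ> ?t) x" if "x \<in> ?T" for x
      using that cU(4) cV(4) by auto
    have "((\<lambda>x. h (inv_into V \<psi> x)) has_derivative
        (\<lambda>e. chart_vec \<A> U \<phi> p e h) \<circ> frechet_derivative ?t (at (\<psi> p))) (at (\<psi> p))"
      by (rule has_derivative_transform_within_open[OF diff_chain_at[OF 1 2] T p]) (simp add: eq)
    from has_derivative_unique[OF this has_derivative_in_chart[OF M V True]]
    show ?thesis by (metis comp_apply)
  qed (simp add: chart_vec_def)
qed

lemma tangent_space_chart:
  assumes "smooth_manifold \<A>" "(U, \<phi>) \<in> \<A>" "p \<in> U"
  shows "tangent_space \<A> p = range (chart_vec \<A> U \<phi> p)"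
proof
  show "tangent_space \<A> p \<subseteq> range (chart_vec \<A> U \<phi> p)"
    using chart_vec_change[OF assms] by (auto simp: tangent_space_eq_chart_vecs)
  show "range (chart_vec \<A> U \<phi> p) \<subseteq> tangent_space \<A> p"
    using assms by (auto simp: tangent_space_eq_chart_vecs)
qed

lemma subspace_tangent_space: "smooth_manifold \<A> \<Longrightarrow> subspace (tangent_space \<A> p)"
  by (metis chart_at tangent_space_chart linear_chart_vec linear_subspace_image subspace_UNIV)

lemma tangent_vec_non_smooth: "v \<in> tangent_space \<A> p \<Longrightarrow> \<not> smooth_fun \<A> h \<Longrightarrow> v h = 0"
  by (auto simp: tangent_space_def)

lemma tangent_vec_const:
  assumes "smooth_manifold \<A>" "v \<in> tangent_space \<A> p"
  shows "v (\<lambda>q. c) = 0"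
  using assms(2) smooth_fun_const[of \<A> c] by (auto simp: tangent_space_def o_def)

lemma tangent_vec_add:
  assumes "smooth_manifold \<A>" "v \<in> tangent_space \<A> p" "smooth_fun \<A> h" "smooth_fun \<A> k"
  shows "v (\<lambda>q. h q + k q) = v h + v k"
proof -
  obtain U \<phi> where U: "(U, \<phi>) \<in> \<A>" "p \<in> U" by (rule chart_at[OF assms(1)])
  obtain e where v: "v = chart_vec \<A> U \<phi> p e"
    using assms(2) tangent_space_chart[OF assms(1) U] by blast
  note d = has_derivative_in_chart[OF assms(1) U]
  show ?thesis
    using has_derivative_unique[OF d[OF smooth_fun_add[OF assms(1,3,4)]]
        has_derivative_add[OF d[OF assms(3)] d[OF assms(4)]]]
    unfolding v by metis
qed

lemma tangent_vec_mult:
  assumes "smooth_manifold \<A>" "v \<in> tangent_space \<A> p" "smooth_fun \<A> h" "smooth_fun \<A> k"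
  shows "v (\<lambda>q. h q * k q) = h p * v k + k p * v h"
proof -
  obtain U \<phi> where U: "(U, \<phi>) \<in> \<A>" "p \<in> U" by (rule chart_at[OF assms(1)])
  obtain e where v: "v = chart_vec \<A> U \<phi> p e"
    using assms(2) tangent_space_chart[OF assms(1) U] by blast
  note d = has_derivative_in_chart[OF assms(1) U]
  have p: "inv_into U \<phi> (\<phi> p) = p" using inj_on_chart[OF assms(1) U(1)] U(2) by simp
  show ?thesis
    using fun_cong[OF has_derivative_unique[OF d[OF smooth_fun_mult[OF assms(1,3,4)]]
        has_derivative_mult[OF d[OF assms(3)] d[OF assms(4)]]], of e]
    unfolding v p by (simp add: mult.commute)
qed

lemma tangent_vec_sum:
  assumes "smooth_manifold \<A>" "v \<in> tangent_space \<A> p" "\<And>i. i \<in> I \<Longrightarrow> smooth_fun \<A> (h i)"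
  shows "v (\<lambda>q. \<Sum>i\<in>I. h i q) = (\<Sum>i\<in>I. v (h i))"
  using assms(3)
  by (induction I rule: infinite_finite_induct)
    (auto simp: tangent_vec_const[OF assms(1,2)] intro!: tangent_vec_add[OF assms(1,2), THEN trans] smooth_fun_sum[OF assms(1)])

lemma vector_fieldsD:
  assumes "X \<in> vector_fields \<A>"
  shows vector_field_tangent: "X p \<in> tangent_space \<A> p"
    and vector_field_smooth: "smooth_fun \<A> h \<Longrightarrow> smooth_fun \<A> (\<lambda>p. X p h)"
  using assms by (auto simp: vector_fields_def)

text \<open>
  A frame near the points where \<open>b \<noteq> 0\<close>. For a bump function \<open>b\<close> supported in a chart with
  coordinates \<open>x\<^sub>i\<close> take \<open>y i = b x\<^sub>i\<close> and \<open>E i = b \<partial>/\<partial>x\<^sub>i\<close>, extended by \<open>0\<close>. Since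
  \<open>b v(y i) - y i v(b) = b\<^sup>2 v(x\<^sub>i)\<close>, the tangent vector \<open>b\<^sup>3 v\<close> is a combination of the \<open>E i\<close>
  whose coefficients are given by globally defined smooth functions.
\<close>

definition frame_coeff :: "('a \<Rightarrow> real) \<Rightarrow> ('e \<Rightarrow> 'a \<Rightarrow> real) \<Rightarrow> 'e \<Rightarrow> 'a \<Rightarrow> 'a tvec \<Rightarrow> real" where
  "frame_coeff b y i q v = b q * v (y i) - y i q * v b"

definition local_frame ::
  "('a::topological_space, 'e::euclidean_space) chart set \<Rightarrow> ('a \<Rightarrow> real) \<Rightarrow> ('e \<Rightarrow> 'a \<Rightarrow> real) \<Rightarrow>
   ('e \<Rightarrow> 'a \<Rightarrow> 'a tvec) \<Rightarrow> bool" where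
  "local_frame \<A> b y E \<longleftrightarrow> smooth_fun \<A> b \<and> (\<forall>i. smooth_fun \<A> (y i)) \<and>
     (\<forall>i. E i \<in> vector_fields \<A>) \<and>
     (\<forall>q. \<forall>v\<in>tangent_space \<A> q. b q ^ 3 *\<^sub>R v = (\<Sum>i\<in>Basis. frame_coeff b y i q v *\<^sub>R E i q)) \<and>
     (\<forall>q. \<forall>i\<in>Basis. \<forall>j\<in>Basis. frame_coeff b y i q (E j q) = (if i = j then b q ^ 3 else 0)) \<and>
     (\<forall>i j q. lie_bracket (E i) (E j) q \<in> tangent_space \<A> q)"

section \<open>Bump functions and the construction of frames\<close>

lemma smooth_on_inner_left: "open S \<Longrightarrow> smooth_on S (\<lambda>x. x \<bullet> i)"
  by (rule smooth_on_bounded_linear[OF bounded_linear_inner_left])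

lemma ex_smooth_bump:
  fixes S :: "'e::euclidean_space set"
  assumes "open S" "x0 \<in> S"
  shows "\<exists>\<beta> K. smooth_on UNIV \<beta> \<and> \<beta> x0 \<noteq> (0::real) \<and> compact K \<and> K \<subseteq> S \<and> (\<forall>x. x \<notin> K \<longrightarrow> \<beta> x = 0)"
proof -
  obtain r where r: "r > 0" "cball x0 r \<subseteq> S"
    using assms by (meson open_contains_cball)
  \<comment> \<open>Squared radius minus squared distance, spelled out in coordinates so that the
    closure rules for sums and products apply; \<open>flat_exp 0\<close> then makes it 0 outside the
    ball.\<close>
  define d where "d x = r\<^sup>2 + (\<Sum>i\<in>Basis. (-1) * ((x \<bullet> i + (- (x0 \<bullet> i))) * (x \<bullet> i + (- (x0 \<bullet> i)))))" for x
  have d: "d x = r\<^sup>2 - (dist x0 x)\<^sup>2" for x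
  proof -
    have "(dist x0 x)\<^sup>2 = (x - x0) \<bullet> (x - x0)"
      by (simp add: dist_norm norm_minus_commute power2_norm_eq_inner[symmetric])
    also have "\<dots> = (\<Sum>i\<in>Basis. (x \<bullet> i + (- (x0 \<bullet> i))) * (x \<bullet> i + (- (x0 \<bullet> i))))"
      by (subst euclidean_inner) (simp add: inner_diff_left)
    finally show ?thesis unfolding d_def sum_distrib_left[symmetric] by simp
  qed
  have "smooth_on UNIV d"
    unfolding d_def[abs_def]
    by (intro smooth_on_add smooth_on_sum smooth_on_mult smooth_on_const smooth_on_inner_left open_UNIV)
  then have "smooth_on UNIV (\<lambda>x. flat_exp 0 (d x))"
    by (rule smooth_on_compose[OF open_UNIV open_UNIV subset_UNIV _ smooth_on_flat_exp])
  moreover have "flat_exp 0 (d x0) \<noteq> 0"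
    using r by (simp add: d flat_exp_def)
  moreover have "flat_exp 0 (d x) = 0" if "x \<notin> cball x0 r" for x
    using that r by (simp add: d flat_exp_def power_mono not_less)
  ultimately show ?thesis
    using r by (intro exI[of _ "\<lambda>x. flat_exp 0 (d x)"] exI[of _ "cball x0 r"]) simp
qed

lemma ex_local_frame:
  fixes \<A> :: "('a::{t2_space,second_countable_topology}, 'e::euclidean_space) chart set"
  assumes M: "smooth_manifold \<A>"
  obtains b y E where "b p \<noteq> 0" "local_frame \<A> b y E"
proof -
  obtain U \<phi> where U: "(U, \<phi>) \<in> \<A>" "p \<in> U" by (rule chart_at[OF M])
  note cU = chartD[OF M U(1)]
  obtain \<beta> K where \<beta>: "smooth_on UNIV \<beta>" "\<beta> (\<phi> p) \<noteq> (0::real)" "compact K" "K \<subseteq> \<phi> ` U"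
    "\<And>x. x \<notin> K \<Longrightarrow> \<beta> x = 0"
    using ex_smooth_bump[OF cU(2) imageI[OF U(2)]] by blast
  have \<beta>U: "smooth_on (\<phi> ` U) \<beta>" using \<beta>(1) smooth_on_subset by blast
  define b where "b q = (if q \<in> U then \<beta> (\<phi> q) else 0)" for q
  define y where "y i q = (if q \<in> U then \<beta> (\<phi> q) * (\<phi> q \<bullet> i) else 0)" for i q
  define E where "E i q = (if q \<in> U then chart_vec \<A> U \<phi> q (\<beta> (\<phi> q) *\<^sub>R i) else 0)" for i q
  have b: "smooth_fun \<A> b"
    unfolding b_def by (rule smooth_fun_cutoff[OF M U(1) \<beta>(3,4) \<beta>U]) (use \<beta>(5) in blast)
  have y: "smooth_fun \<A> (y i)" for i
    unfolding y_def
    by (rule smooth_fun_cutoff[OF M U(1) \<beta>(3,4), where \<gamma> = "\<lambda>x. \<beta> x * (x \<bullet> i)"])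
      (use \<beta>(5) in \<open>auto intro!: smooth_on_mult \<beta>U cU smooth_on_inner_left\<close>)
  \<comment> \<open>In the chart \<open>b\<close> reads as \<open>\<beta>\<close>, so the derivative
    of \<open>\<beta>\<close> is expressed by the action on the global function \<open>b\<close>.
    The same term occurs in \<open>dy\<close> and cancels in \<open>frame_coeff\<close>.\<close>
  have db: "(\<beta> has_derivative (\<lambda>e. chart_vec \<A> U \<phi> q e b)) (at (\<phi> q))" if "q \<in> U" for q
    by (rule has_derivative_transform_within_open[OF has_derivative_in_chart[OF M U(1) that b] cU(2)])
      (use that cU(4) in \<open>auto simp: b_def\<close>)
  have dy: "chart_vec \<A> U \<phi> q e (y i) = \<beta> (\<phi> q) * (e \<bullet> i) + chart_vec \<A> U \<phi> q e b * (\<phi> q \<bullet> i)"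
    if "q \<in> U" for q e i
  proof -
    have 1: "((\<lambda>x. \<beta> x * (x \<bullet> i)) has_derivative (\<lambda>e. chart_vec \<A> U \<phi> q e (y i))) (at (\<phi> q))"
      by (rule has_derivative_transform_within_open[OF has_derivative_in_chart[OF M U(1) that y] cU(2)])
        (use that cU(4) in \<open>auto simp: y_def\<close>)
    have 2: "((\<lambda>x. \<beta> x * (x \<bullet> i)) has_derivative
        (\<lambda>e. \<beta> (\<phi> q) * (e \<bullet> i) + chart_vec \<A> U \<phi> q e b * (\<phi> q \<bullet> i))) (at (\<phi> q))"
      by (intro has_derivative_mult db that has_derivative_inner_left has_derivative_ident)
    show ?thesis using fun_cong[OF has_derivative_unique[OF 1 2], of e] .
  qed
  have coeff: "frame_coeff b y i q (chart_vec \<A> U \<phi> q e) = \<beta> (\<phi> q) ^ 2 * (e \<bullet> i)" if "q \<in> U" for q e i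
    using that dy[OF that, of e i]
    by (simp add: frame_coeff_def b_def y_def power2_eq_square algebra_simps)
  have EU: "E i q = \<beta> (\<phi> q) *\<^sub>R chart_vec \<A> U \<phi> q i" if "q \<in> U" for i q
    using linear_cmul[OF linear_chart_vec[OF M U(1) that]] that by (simp add: E_def)
  have Et: "E i q \<in> tangent_space \<A> q" for i q
    using tangent_space_chart[OF M U(1), of q] subspace_0[OF subspace_tangent_space[OF M], of q]
    by (auto simp: E_def)
  have Eh: "E i q h = (if q \<in> U then \<beta> (\<phi> q) * frechet_derivative (\<lambda>x. h (inv_into U \<phi> x)) (at (\<phi> q)) i else 0)"
    if "smooth_fun \<A> h" for i q h
    using that EU[of q i] by (auto simp: scaleR_fun_def chart_vec_def) (simp add: E_def)
  have E: "E i \<in> vector_fields \<A>" for i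
    unfolding vector_fields_def
  proof (intro CollectI conjI allI impI Et)
    fix h assume h: "smooth_fun \<A> h"
    have "smooth_on (\<phi> ` U) (\<lambda>x. \<beta> x * frechet_derivative (\<lambda>x. h (inv_into U \<phi> x)) (at x) i)"
      by (intro smooth_on_mult \<beta>U cU smooth_on_frechet_derivative smooth_funD[OF h U(1)])
    from smooth_fun_cutoff[OF M U(1) \<beta>(3,4) this] show "smooth_fun \<A> (\<lambda>q. E i q h)"
      unfolding Eh[OF h] using \<beta>(5) by auto
  qed
  have frame: "b q ^ 3 *\<^sub>R v = (\<Sum>i\<in>Basis. frame_coeff b y i q v *\<^sub>R E i q)"
    if v: "v \<in> tangent_space \<A> q" for q v
  proof (cases "q \<in> U")
    case True
    then obtain e where e: "v = chart_vec \<A> U \<phi> q e"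
      using v tangent_space_chart[OF M U(1) True] by blast
    note lin = linear_chart_vec[OF M U(1) True]
    have sum: "v = (\<Sum>i\<in>Basis. (e \<bullet> i) *\<^sub>R chart_vec \<A> U \<phi> q i)"
      unfolding e by (subst (1) euclidean_representation[symmetric])
        (simp add: linear_sum[OF lin] linear_cmul[OF lin])
    have "frame_coeff b y i q v *\<^sub>R E i q = b q ^ 3 *\<^sub>R (e \<bullet> i) *\<^sub>R chart_vec \<A> U \<phi> q i" for i
      using True by (simp add: EU b_def coeff[OF True, of i e, folded e] power2_eq_square power3_eq_cube mult_ac)
    then show ?thesis by (simp only: scaleR_sum_right[symmetric] sum[symmetric])
  next
    case False
    then show ?thesis by (simp add: b_def E_def)
  qed
  have dual: "frame_coeff b y i q (E j q) = (if i = j then b q ^ 3 else 0)"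
    if "i \<in> Basis" "j \<in> Basis" for i j q
    using that coeff[of q i "\<beta> (\<phi> q) *\<^sub>R j"]
    by (auto simp: E_def b_def inner_Basis power2_eq_square power3_eq_cube frame_coeff_def y_def)
  have bracket: "lie_bracket (E i) (E j) q \<in> tangent_space \<A> q" for i j q
  proof (cases "q \<in> U")
    case False
    then have "lie_bracket (E i) (E j) q = 0"
      by (simp add: lie_bracket_def E_def zero_fun_def)
    then show ?thesis by (simp add: subspace_0 subspace_tangent_space M)
  next
    case True
    note lin = linear_chart_vec[OF M U(1) True]
    let ?c = "\<lambda>e. chart_vec \<A> U \<phi> q e b"
    \<comment> \<open>This is \<open>[b X, b Y] = b (X b) Y - b (Y b) X\<close> for coordinate
      fields \<open>X\<close> and \<open>Y\<close>, which commute by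
      \<open>frechet_derivative_commute\<close>.\<close>
    have "lie_bracket (E i) (E j) q =
      chart_vec \<A> U \<phi> q ((\<beta> (\<phi> q) * ?c i) *\<^sub>R j - (\<beta> (\<phi> q) * ?c j) *\<^sub>R i)"
    proof
      fix h
      show "lie_bracket (E i) (E j) q h =
        chart_vec \<A> U \<phi> q ((\<beta> (\<phi> q) * ?c i) *\<^sub>R j - (\<beta> (\<phi> q) * ?c j) *\<^sub>R i) h"
      proof (cases "smooth_fun \<A> h")
        case h: True
        let ?h = "\<lambda>x. h (inv_into U \<phi> x)"
        let ?D = "\<lambda>i x. frechet_derivative ?h (at x) i"
        note sh = smooth_funD[OF h U(1)]
        have q: "\<phi> q \<in> \<phi> ` U" using True by blast
        have "E k q (\<lambda>r. E l r h) = \<beta> (\<phi> q) * (\<beta> (\<phi> q) * frechet_derivative (?D l) (at (\<phi> q)) k + ?c k * ?D l (\<phi> q))" for k l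
        proof -
          have "((\<lambda>x. \<beta> x * ?D l x) has_derivative
              (\<lambda>e. \<beta> (\<phi> q) * frechet_derivative (?D l) (at (\<phi> q)) e + ?c e * ?D l (\<phi> q))) (at (\<phi> q))"
            by (intro has_derivative_mult db True
                smooth_on_has_derivative[OF cU(2) smooth_on_frechet_derivative[OF sh] q])
          then have "((\<lambda>x. E l (inv_into U \<phi> x) h) has_derivative
              (\<lambda>e. \<beta> (\<phi> q) * frechet_derivative (?D l) (at (\<phi> q)) e + ?c e * ?D l (\<phi> q))) (at (\<phi> q))"
            by (rule has_derivative_transform_within_open[OF _ cU(2) q])
              (use cU(4) in \<open>auto simp: Eh[OF h]\<close>)
          from fun_cong[OF has_derivative_unique[OF this has_derivative_in_chart[OF M U(1) True vector_field_smooth[OF E h]]], of k]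
          show ?thesis using True by (simp add: EU scaleR_fun_def)
        qed
        moreover have "frechet_derivative (?D j) (at (\<phi> q)) i = frechet_derivative (?D i) (at (\<phi> q)) j"
          using frechet_derivative_commute[OF cU(2) _ q] sh by (simp add: smooth_on_def)
        moreover have "chart_vec \<A> U \<phi> q e h = ?D e (\<phi> q)" for e
          using h by (simp add: chart_vec_def)
        ultimately show ?thesis
          using h unfolding linear_diff[OF lin] linear_cmul[OF lin]
          by (simp add: lie_bracket_def scaleR_fun_def algebra_simps)
      next
        case False
        \<comment> \<open>Frame fields are 0 on a non-smooth \<open>h\<close>, so the inner
          functions are constant and the bracket obeys the same convention as tangent
          vectors.\<close>
        then have "(\<lambda>r. E l r h) = (\<lambda>r. 0)" for l
          using tangent_vec_non_smooth[OF Et] by blast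
        then show ?thesis
          using False tangent_vec_const[OF M Et] by (simp add: lie_bracket_def chart_vec_def)
      qed
    qed
    then show ?thesis using tangent_space_chart[OF M U(1) True] by simp
  qed
  have "local_frame \<A> b y E"
    using b y E frame dual bracket by (simp add: local_frame_def)
  moreover have "b p \<noteq> 0" using \<beta>(2) U by (simp add: b_def)
  ultimately show ?thesis using that by blast
qed

section \<open>Vector fields along a map\<close>

text \<open>Makes ordinary vector fields the case of the identity map, so that closure properties
  are proved once for both kinds.\<close>

lemma vector_fields_along_ident: "vector_fields_along \<A> \<A> (\<lambda>p. p) = vector_fields \<A>"
  by (simp add: vector_fields_def vector_fields_along_def)

lemma vector_fields_alongD:
  assumes "V \<in> vector_fields_along \<A> \<B> f"
  shows vector_field_along_tangent: "V p \<in> tangent_space \<B> (f p)"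
    and vector_field_along_smooth: "smooth_fun \<B> h \<Longrightarrow> smooth_fun \<A> (\<lambda>p. V p h)"
  using assms by (auto simp: vector_fields_along_def)

lemma vector_fields_along_zero:
  assumes "smooth_manifold \<B>"
  shows "(\<lambda>p. 0) \<in> vector_fields_along \<A> \<B> f"
  using subspace_0[OF subspace_tangent_space[OF assms]]
  by (simp add: vector_fields_along_def smooth_fun_const)

lemma vector_fields_along_add:
  assumes "smooth_manifold \<A>" "smooth_manifold \<B>"
    "V \<in> vector_fields_along \<A> \<B> f" "W \<in> vector_fields_along \<A> \<B> f"
  shows "(\<lambda>p. V p + W p) \<in> vector_fields_along \<A> \<B> f"
  using assms(3,4)
  by (auto simp: vector_fields_along_def intro: subspace_add[OF subspace_tangent_space[OF assms(2)]]
      smooth_fun_add[OF assms(1)])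

lemma vector_fields_along_scale:
  assumes "smooth_manifold \<A>" "smooth_manifold \<B>"
    "smooth_fun \<A> c" "V \<in> vector_fields_along \<A> \<B> f"
  shows "(\<lambda>p. c p *\<^sub>R V p) \<in> vector_fields_along \<A> \<B> f"
proof -
  have "(c p *\<^sub>R V p) h = c p * V p h" for p h by (simp add: scaleR_fun_def)
  then show ?thesis
    using assms(3,4)
    by (auto simp: vector_fields_along_def
        intro: subspace_scale[OF subspace_tangent_space[OF assms(2)]] smooth_fun_mult[OF assms(1)])
qed

lemma vector_fields_along_sum:
  assumes "smooth_manifold \<A>" "smooth_manifold \<B>"
    "\<And>i. i \<in> I \<Longrightarrow> V i \<in> vector_fields_along \<A> \<B> f"
  shows "(\<lambda>p. \<Sum>i\<in>I. V i p) \<in> vector_fields_along \<A> \<B> f"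
  using assms(3)
  by (induction I rule: infinite_finite_induct)
    (simp_all add: vector_fields_along_zero[OF assms(2)] vector_fields_along_add[OF assms(1,2)])

lemma vector_fields_scale:
  assumes "smooth_manifold \<A>" "smooth_fun \<A> c" "X \<in> vector_fields \<A>"
  shows "(\<lambda>p. c p *\<^sub>R X p) \<in> vector_fields \<A>"
  using vector_fields_along_scale[where f = "\<lambda>p. p", OF assms(1,1,2), of X] assms(3)
  by (simp add: vector_fields_along_ident)

lemma vector_fields_sum:
  assumes "smooth_manifold \<A>" "\<And>i. i \<in> I \<Longrightarrow> X i \<in> vector_fields \<A>"
  shows "(\<lambda>p. \<Sum>i\<in>I. X i p) \<in> vector_fields \<A>"
  using vector_fields_along_sum[where f = "\<lambda>p. p", OF assms(1,1), of I X] assms(2)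
  by (simp add: vector_fields_along_ident)

section \<open>Applications of frames: extension of vectors and Lie brackets\<close>

lemma local_frameD:
  assumes "local_frame \<A> b y E"
  shows local_frame_smooth: "smooth_fun \<A> b" "smooth_fun \<A> (y i)"
    and local_frame_vector_field: "E i \<in> vector_fields \<A>"
    and local_frame_expansion: "v \<in> tangent_space \<A> q \<Longrightarrow>
      b q ^ 3 *\<^sub>R v = (\<Sum>i\<in>Basis. frame_coeff b y i q v *\<^sub>R E i q)"
    and local_frame_dual: "i \<in> Basis \<Longrightarrow> j \<in> Basis \<Longrightarrow>
      frame_coeff b y i q (E j q) = (if i = j then b q ^ 3 else 0)"
    and local_frame_bracket: "lie_bracket (E i) (E j) q \<in> tangent_space \<A> q"
  using assms unfolding local_frame_def by blast+

lemma frame_coeff_sum: "frame_coeff b y i q (\<Sum>j\<in>J. c j *\<^sub>R v j) = (\<Sum>j\<in>J. c j * frame_coeff b y i q (v j))"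
  by (induction J rule: infinite_finite_induct)
    (simp_all add: frame_coeff_def scaleR_fun_def algebra_simps)

text \<open>Constant coefficients suffice: those of \<open>v\<close> at \<open>p\<close>, divided by
  \<open>b p ^ 3\<close>, stay fixed while the frame fields vary.\<close>

lemma ex_vector_field_extension:
  assumes M: "smooth_manifold \<A>" and v: "v \<in> tangent_space \<A> p"
  obtains X where "X \<in> vector_fields \<A>" "X p = v"
proof -
  obtain b y E where b: "b p \<noteq> 0" "local_frame \<A> b y E" by (rule ex_local_frame[OF M])
  define X where "X q = (\<Sum>i\<in>Basis. (frame_coeff b y i p v / b p ^ 3) *\<^sub>R E i q)" for q
  have "X \<in> vector_fields \<A>"
    unfolding X_def[abs_def]
    by (intro vector_fields_sum vector_fields_scale M smooth_fun_const local_frame_vector_field[OF b(2)])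
  moreover have "X p = (1 / b p ^ 3) *\<^sub>R b p ^ 3 *\<^sub>R v"
    unfolding X_def local_frame_expansion[OF b(2) v] scaleR_sum_right by simp
  ultimately show ?thesis using b(1) by (intro that[of X]) auto
qed

text \<open>The coefficients apply \<open>V q\<close> only to the global functions \<open>b\<close>
  and \<open>y i\<close> and contain no division, so they are smooth even where the frame
  degenerates.\<close>

lemma smooth_frame_coeff_along:
  assumes "smooth_manifold \<A>" "smooth_fun \<A> (\<lambda>q. b (f q))" "\<And>i. smooth_fun \<A> (\<lambda>q. y i (f q))"
    "smooth_fun \<B> b" "smooth_fun \<B> (y i)" "V \<in> vector_fields_along \<A> \<B> f"
  shows "smooth_fun \<A> (\<lambda>q. frame_coeff b y i (f q) (V q))"
  unfolding frame_coeff_def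
  by (intro smooth_fun_diff smooth_fun_mult assms vector_field_along_smooth[OF assms(6)])

lemma sum_fun_apply: "(\<Sum>i\<in>I. V i) h = (\<Sum>i\<in>I. V i h)"
  by (induction I rule: infinite_finite_induct) simp_all

lemma lie_bracket_non_smooth:
  assumes "smooth_manifold \<A>" "X \<in> vector_fields \<A>" "Y \<in> vector_fields \<A>" "\<not> smooth_fun \<A> h"
  shows "lie_bracket X Y p h = 0"
proof -
  have "(\<lambda>q. Z q h) = (\<lambda>q. 0)" if "Z \<in> vector_fields \<A>" for Z
    using tangent_vec_non_smooth[OF vector_field_tangent[OF that] assms(4)] by blast
  then show ?thesis
    using tangent_vec_const[OF assms(1) vector_field_tangent[OF assms(2)]]
      tangent_vec_const[OF assms(1) vector_field_tangent[OF assms(3)]] assms(2,3)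
    by (simp add: lie_bracket_def)
qed

text \<open>Expanding both fields in a frame reduces the bracket to combinations of
  \<open>X\<close>, \<open>Y\<close>, the frame fields and the brackets of frame fields; the latter
  are tangent by the last clause of \<open>local_frame\<close>.\<close>

lemma lie_bracket_tangent:
  assumes M: "smooth_manifold \<A>" and X: "X \<in> vector_fields \<A>" and Y: "Y \<in> vector_fields \<A>"
  shows "lie_bracket X Y p \<in> tangent_space \<A> p"
proof -
  obtain b y E where b: "b p \<noteq> 0" "local_frame \<A> b y E" by (rule ex_local_frame[OF M])
  note fr = local_frameD[OF b(2)]
  define \<kappa> where "\<kappa> q = b q ^ 3" for q
  define c where "c V i q = frame_coeff b y i q (V q)" for V :: "'a \<Rightarrow> 'a tvec" and i q
  have k: "smooth_fun \<A> \<kappa>" unfolding \<kappa>_def[abs_def] by (rule smooth_fun_power[OF M fr(1)])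
  have c: "smooth_fun \<A> (c V i)" if "V \<in> vector_fields \<A>" for V i
    unfolding c_def[abs_def]
    by (rule smooth_frame_coeff_along[OF M, where f = "\<lambda>q. q" and \<B> = \<A>])
      (use fr(1,2) that in \<open>simp_all add: vector_fields_along_ident\<close>)
  have ex: "\<kappa> q * V q h = (\<Sum>i\<in>Basis. c V i q * E i q h)" if "V \<in> vector_fields \<A>" for V q h
    using fun_cong[OF fr(4)[OF vector_field_tangent[OF that]], of q h]
    by (simp add: \<kappa>_def c_def scaleR_fun_def sum_fun_apply)
  \<comment> \<open>The factor \<open>\<kappa> p\<close> is needed twice: the inner one arises from
    expanding \<open>Y\<close> before differentiating, the outer one allows \<open>X\<close> to be
    expanded in the second-order terms.\<close>
  have main: "\<kappa> p * (\<kappa> p * X p (\<lambda>q. Y q h) + Y p h * X p \<kappa>) =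
      (\<Sum>i\<in>Basis. \<kappa> p * E i p h * X p (c Y i)) +
      (\<Sum>i\<in>Basis. \<Sum>j\<in>Basis. c Y i p * c X j p * E j p (\<lambda>q. E i q h))"
    if X: "X \<in> vector_fields \<A>" and Y: "Y \<in> vector_fields \<A>" and h: "smooth_fun \<A> h" for X Y h
  proof -
    note Xp = vector_field_tangent[OF X, of p]
    have "\<kappa> p * X p (\<lambda>q. Y q h) + Y p h * X p \<kappa> = X p (\<lambda>q. \<kappa> q * Y q h)"
      by (rule tangent_vec_mult[OF M Xp k vector_field_smooth[OF Y h], symmetric])
    also have "\<dots> = (\<Sum>i\<in>Basis. X p (\<lambda>q. c Y i q * E i q h))"
      unfolding ex[OF Y]
      by (intro tangent_vec_sum[OF M Xp] smooth_fun_mult M c Y vector_field_smooth[OF fr(3) h])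
    also have "\<dots> = (\<Sum>i\<in>Basis. c Y i p * X p (\<lambda>q. E i q h) + E i p h * X p (c Y i))"
      by (intro sum.cong refl tangent_vec_mult[OF M Xp c[OF Y] vector_field_smooth[OF fr(3) h]])
    finally have "\<kappa> p * (\<kappa> p * X p (\<lambda>q. Y q h) + Y p h * X p \<kappa>) =
        (\<Sum>i\<in>Basis. \<kappa> p * E i p h * X p (c Y i) + c Y i p * (\<kappa> p * X p (\<lambda>q. E i q h)))"
      by (simp add: sum_distrib_left algebra_simps)
    then show ?thesis
      unfolding ex[OF X] by (simp add: sum.distrib sum_distrib_left mult.assoc)
  qed
  \<comment> \<open>\<open>\<kappa> p ^ 2\<close> times the bracket, read off from the difference of
    \<open>main\<close> for \<open>X, Y\<close> and for \<open>Y, X\<close>; the last two terms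
    compensate the derivatives of \<open>\<kappa>\<close>.\<close>
  define w where "w = (\<Sum>i\<in>Basis. (\<kappa> p * (X p (c Y i) - Y p (c X i))) *\<^sub>R E i p) +
      (\<Sum>i\<in>Basis. \<Sum>j\<in>Basis. (c Y i p * c X j p) *\<^sub>R lie_bracket (E j) (E i) p)
      - (\<kappa> p * X p \<kappa>) *\<^sub>R Y p + (\<kappa> p * Y p \<kappa>) *\<^sub>R X p"
  note sub = subspace_tangent_space[OF M, of p]
  have w: "w \<in> tangent_space \<A> p"
    unfolding w_def
    by (intro subspace_add[OF sub] subspace_diff[OF sub] subspace_sum[OF sub] subspace_scale[OF sub]
        fr(6) vector_field_tangent X Y fr(3))
  have "\<kappa> p ^ 2 * lie_bracket X Y p h = w h" for h
  proof (cases "smooth_fun \<A> h")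
    case True
    have swap: "(\<Sum>i\<in>Basis. \<Sum>j\<in>Basis. c X i p * c Y j p * E j p (\<lambda>q. E i q h)) =
        (\<Sum>i\<in>Basis. \<Sum>j\<in>Basis. c Y i p * c X j p * E i p (\<lambda>q. E j q h))"
      by (subst sum.swap) (simp add: mult.commute)
    show ?thesis
      using main[OF X Y True] main[OF Y X True]
      unfolding swap
      by (simp add: w_def lie_bracket_def scaleR_fun_def sum_fun_apply power2_eq_square
          algebra_simps sum_subtractf sum.distrib sum_distrib_left)
  next
    case False
    then show ?thesis
      using tangent_vec_non_smooth[OF w False] lie_bracket_non_smooth[OF M X Y False] by simp
  qed
  then have "\<kappa> p ^ 2 *\<^sub>R lie_bracket X Y p = w"
    by (simp add: scaleR_fun_def)
  then have "lie_bracket X Y p = (1 / \<kappa> p ^ 2) *\<^sub>R w"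
    using b(1) by (auto simp: \<kappa>_def)
  then show ?thesis using subspace_scale[OF sub w] by simp
qed

section \<open>Pull-back of functions and the differential\<close>

lemma smooth_fun_pullback:
  assumes M: "smooth_manifold \<A>" and M': "smooth_manifold \<B>" and f: "smooth_map \<A> \<B> f"
    and h: "smooth_fun \<B> h"
  shows "smooth_fun \<A> (\<lambda>p. h (f p))"
  unfolding smooth_fun_def
proof clarify
  fix U \<phi> assume U: "(U, \<phi>) \<in> \<A>"
  note cU = chartD[OF M U]
  show "smooth_on (\<phi> ` U) ((\<lambda>p. h (f p)) \<circ> inv_into U \<phi>)"
  proof (rule smooth_on_local)
    fix x assume "x \<in> \<phi> ` U"
    then obtain q where q: "q \<in> U" "x = \<phi> q" by blast
    obtain V \<psi> where V: "(V, \<psi>) \<in> \<B>" "f q \<in> V" by (rule chart_at[OF M'])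
    note cV = chartD[OF M' V(1)]
    let ?T = "\<phi> ` (U \<inter> f -` V)"
    have T: "open ?T"
      using f cV(1) by (intro open_chart_image[OF M U]) (simp add: smooth_map_def open_vimage)
    have sf: "smooth_on ?T (\<lambda>x. \<psi> (f (inv_into U \<phi> x)))"
      using f U V(1) unfolding smooth_map_def by (fastforce simp: o_def)
    have inv: "f (inv_into U \<phi> y) \<in> V" if "y \<in> ?T" for y
      using that cU(4) by auto
    let ?g = "\<lambda>y. h (inv_into V \<psi> (\<psi> (f (inv_into U \<phi> y))))"
    have "smooth_on ?T ?g"
      by (rule smooth_on_compose[OF T cV(2) _ sf smooth_funD[OF h V(1)]]) (use inv in blast)
    moreover have "((\<lambda>p. h (f p)) \<circ> inv_into U \<phi>) y = ?g y" if "y \<in> ?T" for y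
      using inv[OF that] cV(4) by simp
    ultimately show "\<exists>T g. open T \<and> x \<in> T \<and> smooth_on T g \<and> (\<forall>y\<in>T. ((\<lambda>p. h (f p)) \<circ> inv_into U \<phi>) y = g y)"
      using T q V(2) by (intro exI[of _ ?T] exI[of _ ?g]) auto
  qed
qed

lemma differential_tangent:
  assumes M: "smooth_manifold \<A>" and M': "smooth_manifold \<B>" and f: "smooth_map \<A> \<B> f"
    and v: "v \<in> tangent_space \<A> p"
  shows "differential \<B> f v \<in> tangent_space \<B> (f p)"
proof -
  obtain U \<phi> where U: "(U, \<phi>) \<in> \<A>" "p \<in> U" by (rule chart_at[OF M])
  obtain V \<psi> where V: "(V, \<psi>) \<in> \<B>" "f p \<in> V" by (rule chart_at[OF M'])
  note cU = chartD[OF M U(1)] and cV = chartD[OF M' V(1)]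
  obtain e where e: "v = chart_vec \<A> U \<phi> p e"
    using v tangent_space_chart[OF M U] by blast
  let ?T = "\<phi> ` (U \<inter> f -` V)" and ?t = "\<lambda>x. \<psi> (f (inv_into U \<phi> x))"
  have T: "open ?T"
    using f cV(1) by (intro open_chart_image[OF M U(1)]) (simp add: smooth_map_def open_vimage)
  have p: "\<phi> p \<in> ?T" using U V by blast
  have "smooth_on ?T ?t"
    using f U(1) V(1) unfolding smooth_map_def by (fastforce simp: o_def)
  then have 1: "(?t has_derivative frechet_derivative ?t (at (\<phi> p))) (at (\<phi> p))"
    by (rule smooth_on_has_derivative[OF T _ p])
  have tp: "?t (\<phi> p) = \<psi> (f p)" using cU(4) U(2) by simp
  have "differential \<B> f v h = chart_vec \<B> V \<psi> (f p) (frechet_derivative ?t (at (\<phi> p)) e) h" for h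
  proof (cases "smooth_fun \<B> h")
    case True
    have 2: "((\<lambda>x. h (inv_into V \<psi> x)) has_derivative (\<lambda>e. chart_vec \<B> V \<psi> (f p) e h)) (at (?t (\<phi> p)))"
      unfolding tp by (rule has_derivative_in_chart[OF M' V True])
    have eq: "((\<lambda>x. h (inv_into V \<psi> x)) \<circ> ?t) x = h (f (inv_into U \<phi> x))" if "x \<in> ?T" for x
      using that cU(4) cV(4) by auto
    have "((\<lambda>x. h (f (inv_into U \<phi> x))) has_derivative
        (\<lambda>e. chart_vec \<B> V \<psi> (f p) e h) \<circ> frechet_derivative ?t (at (\<phi> p))) (at (\<phi> p))"
      by (rule has_derivative_transform_within_open[OF diff_chain_at[OF 1 2] T p]) (use eq in blast)
    from fun_cong[OF has_derivative_unique[OF this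
        has_derivative_in_chart[OF M U smooth_fun_pullback[OF M M' f True]]], of e]
    show ?thesis using True by (simp add: differential_def e o_def)
  qed (simp add: differential_def chart_vec_def)
  then have "differential \<B> f v = chart_vec \<B> V \<psi> (f p) (frechet_derivative ?t (at (\<phi> p)) e)" by blast
  then show ?thesis using tangent_space_chart[OF M' V] by simp
qed

lemma differential_linear: "linear (differential \<B> f)"
  by (rule linearI) (auto simp: differential_def scaleR_fun_def)

lemma linear_map_on_sum:
  assumes "subspace S" "linear_map_on S L" "\<And>i. i \<in> I \<Longrightarrow> v i \<in> S"
  shows "L (\<Sum>i\<in>I. c i *\<^sub>R v i) = (\<Sum>i\<in>I. c i *\<^sub>R L (v i))"
  using assms(3)
proof (induction I rule: infinite_finite_induct)
  case (insert j I)
  have "(\<Sum>i\<in>I. c i *\<^sub>R v i) \<in> S" "c j *\<^sub>R v j \<in> S"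
    using insert.prems by (auto intro!: subspace_sum subspace_scale assms(1))
  then show ?case
    using insert assms(2) by (simp add: linear_map_on_def)
next
  case empty
  have "L (0 *\<^sub>R 0) = 0 *\<^sub>R L 0"
    using assms(1,2) by (simp only: linear_map_on_def subspace_0)
  then show ?case by simp
next
  case (infinite I)
  have "L (0 *\<^sub>R 0) = 0 *\<^sub>R L 0"
    using assms(1,2) by (simp only: linear_map_on_def subspace_0)
  then show ?case using infinite by simp
qed

section \<open>The covariant derivative along an immersion\<close>

locale derivative_along =
  fixes M :: "('a::{t2_space,second_countable_topology}, 'm::euclidean_space) chart set"
    and M' :: "('b::{t2_space,second_countable_topology}, 'd::euclidean_space) chart set"
    and f :: "'a \<Rightarrow> 'b"
    and g' :: "'b \<Rightarrow> 'b tvec \<Rightarrow> 'b tvec \<Rightarrow> real"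
    and nabla' :: "('b \<Rightarrow> 'b tvec) \<Rightarrow> ('b \<Rightarrow> 'b tvec) \<Rightarrow> 'b \<Rightarrow> 'b tvec"
    and D :: "('a \<Rightarrow> 'a tvec) \<Rightarrow> ('a \<Rightarrow> 'b tvec) \<Rightarrow> 'a \<Rightarrow> 'b tvec"
  assumes M: "smooth_manifold M" and M': "smooth_manifold M'"
    and f: "smooth_map M M' f"
    and metric: "riemannian_metric M' g'"
    and levi_civita: "levi_civita M' g' nabla'"
    and D: "induced_connection_along M M' f nabla' D"
begin

abbreviation "VF \<equiv> vector_fields M"
abbreviation "VF' \<equiv> vector_fields M'"
abbreviation "Along \<equiv> vector_fields_along M M' f"
abbreviation "T \<equiv> tangent_space M"
abbreviation "T' \<equiv> tangent_space M'"
abbreviation "df \<equiv> differential M' f"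

lemmas sub_T = subspace_tangent_space[OF M]
lemmas sub_T' = subspace_tangent_space[OF M']
lemmas Along_add = vector_fields_along_add[OF M M']
lemmas Along_scale = vector_fields_along_scale[OF M M']
lemmas Along_sum = vector_fields_along_sum[OF M M']
lemmas df_tangent = differential_tangent[OF M M' f]
lemmas df_linear = differential_linear[of M' f]

lemma Along_zero: "(\<lambda>p. 0) \<in> Along"
  by (rule vector_fields_along_zero[OF M'])

lemma df_apply: "smooth_fun M' h \<Longrightarrow> df v h = v (\<lambda>p. h (f p))"
  by (simp add: differential_def o_def)

lemma Along_comp: "Y \<in> VF' \<Longrightarrow> (\<lambda>p. Y (f p)) \<in> Along"
  using smooth_fun_pullback[OF M M' f vector_field_smooth]
  by (simp add: vector_fields_along_def vector_field_tangent)

lemma Along_df: "X \<in> VF \<Longrightarrow> (\<lambda>p. df (X p)) \<in> Along"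
  using smooth_fun_pullback[OF M M' f]
  by (simp add: vector_fields_along_def df_apply df_tangent vector_field_tangent vector_field_smooth)

lemma D_along: "X \<in> VF \<Longrightarrow> V \<in> Along \<Longrightarrow> D X V \<in> Along"
  using D by (simp add: induced_connection_along_def)

lemma D_tangent: "X \<in> VF \<Longrightarrow> V \<in> Along \<Longrightarrow> D X V p \<in> T' (f p)"
  by (rule vector_field_along_tangent[OF D_along])

lemma D_add: "X \<in> VF \<Longrightarrow> V \<in> Along \<Longrightarrow> W \<in> Along \<Longrightarrow> D X (\<lambda>p. V p + W p) p = D X V p + D X W p"
  using D by (simp add: induced_connection_along_def plus_fun_def)

lemma D_scale: "X \<in> VF \<Longrightarrow> V \<in> Along \<Longrightarrow> smooth_fun M c \<Longrightarrow>
    D X (\<lambda>p. c p *\<^sub>R V p) p = X p c *\<^sub>R V p + c p *\<^sub>R D X V p"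
  using D by (simp add: induced_connection_along_def)

lemma D_zero: "X \<in> VF \<Longrightarrow> D X (\<lambda>p. 0) p = 0"
  using D_scale[OF _ Along_zero smooth_fun_const, of X 0 p] by simp

lemma D_comp: "X \<in> VF \<Longrightarrow> Y \<in> VF' \<Longrightarrow> Z \<in> VF' \<Longrightarrow> Z (f p) = df (X p) \<Longrightarrow>
    D X (\<lambda>p. Y (f p)) p = nabla' Z Y (f p)"
  using D unfolding induced_connection_along_def comp_def by blast

lemma D_sum_scale:
  assumes "X \<in> VF" "\<And>i. i \<in> I \<Longrightarrow> V i \<in> Along" "\<And>i. i \<in> I \<Longrightarrow> smooth_fun M (c i)"
  shows "D X (\<lambda>p. \<Sum>i\<in>I. c i p *\<^sub>R V i p) p = (\<Sum>i\<in>I. X p (c i) *\<^sub>R V i p + c i p *\<^sub>R D X (V i) p)"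
  using assms(2,3)
proof (induction I rule: infinite_finite_induct)
  case (insert j I)
  have "D X (\<lambda>p. \<Sum>i\<in>insert j I. c i p *\<^sub>R V i p) p = D X (\<lambda>p. c j p *\<^sub>R V j p + (\<Sum>i\<in>I. c i p *\<^sub>R V i p)) p"
    unfolding sum.insert[OF insert.hyps] ..
  also have "\<dots> = D X (\<lambda>p. c j p *\<^sub>R V j p) p + D X (\<lambda>p. \<Sum>i\<in>I. c i p *\<^sub>R V i p) p"
    by (intro D_add assms(1) Along_sum Along_scale) (use insert.prems in auto)
  also have "\<dots> = (X p (c j) *\<^sub>R V j p + c j p *\<^sub>R D X (V j) p) + (\<Sum>i\<in>I. X p (c i) *\<^sub>R V i p + c i p *\<^sub>R D X (V i) p)"
    by (subst D_scale[OF assms(1)], use insert.prems in simp, use insert.prems in simp,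
        subst insert.IH) (use insert.prems in auto)
  finally show ?case unfolding sum.insert[OF insert.hyps] .
qed (simp_all add: D_zero assms(1))

section \<open>Rules for the ambient connection\<close>

lemma nabla_facts:
  assumes "Z \<in> VF'" "Y \<in> VF'"
  shows nabla_tangent: "nabla' Z Y q \<in> T' q"
    and nabla_add: "W \<in> VF' \<Longrightarrow> nabla' Z (\<lambda>q. Y q + W q) q = nabla' Z Y q + nabla' Z W q"
    and nabla_scale: "nabla' Z (\<lambda>q. k *\<^sub>R Y q) q = k *\<^sub>R nabla' Z Y q"
    and nabla_scale_left: "nabla' (\<lambda>q. k *\<^sub>R Z q) Y q = k *\<^sub>R nabla' Z Y q"
proof -
  have c: "affine_connection M' nabla'" using levi_civita by (simp add: levi_civita_def)
  show "nabla' Z Y q \<in> T' q"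
    using c assms unfolding affine_connection_def by (meson vector_field_tangent)
  show "W \<in> VF' \<Longrightarrow> nabla' Z (\<lambda>q. Y q + W q) q = nabla' Z Y q + nabla' Z W q"
    using c assms by (simp add: affine_connection_def plus_fun_def)
  have "nabla' Z (\<lambda>q. k *\<^sub>R Y q) = (\<lambda>q. Z q (\<lambda>_. k) *\<^sub>R Y q + k *\<^sub>R nabla' Z Y q)"
    using c assms smooth_fun_const[of M' k] unfolding affine_connection_def by blast
  then show "nabla' Z (\<lambda>q. k *\<^sub>R Y q) q = k *\<^sub>R nabla' Z Y q"
    using tangent_vec_const[OF M' vector_field_tangent[OF assms(1)]] by simp
  have "nabla' (\<lambda>q. k *\<^sub>R Z q) Y = (\<lambda>q. k *\<^sub>R nabla' Z Y q)"
    using c assms smooth_fun_const[of M' k] unfolding affine_connection_def by blast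
  then show "nabla' (\<lambda>q. k *\<^sub>R Z q) Y q = k *\<^sub>R nabla' Z Y q" by simp
qed

lemma nabla_metric:
  "X \<in> VF' \<Longrightarrow> Y \<in> VF' \<Longrightarrow> Z \<in> VF' \<Longrightarrow>
    X p (\<lambda>q. g' q (Y q) (Z q)) = g' p (nabla' X Y p) (Z p) + g' p (Y p) (nabla' X Z p)"
  using levi_civita unfolding levi_civita_def by blast

lemma nabla_torsion:
  assumes "X \<in> VF'" "Y \<in> VF'"
  shows "nabla' X Y p - nabla' Y X p = lie_bracket X Y p"
proof -
  have "nabla' X Y - nabla' Y X = lie_bracket X Y"
    using levi_civita assms unfolding levi_civita_def by blast
  from fun_cong[OF this, of p] show ?thesis by (simp only: minus_apply)
qed

section \<open>From restrictions of ambient fields to all fields along the map\<close>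

lemma VF'_sum_const:
  "(\<And>i. i \<in> I \<Longrightarrow> F i \<in> VF') \<Longrightarrow> (\<lambda>q. \<Sum>i\<in>I. k i *\<^sub>R F i q) \<in> VF'"
  by (intro vector_fields_sum[OF M'] vector_fields_scale[OF M'] smooth_fun_const)

lemma nabla_sum_const:
  assumes "Z \<in> VF'" "\<And>i. i \<in> I \<Longrightarrow> F i \<in> VF'"
  shows "nabla' Z (\<lambda>q. \<Sum>i\<in>I. k i *\<^sub>R F i q) q = (\<Sum>i\<in>I. k i *\<^sub>R nabla' Z (F i) q)"
  using assms(2)
proof (induction I rule: infinite_finite_induct)
  case (insert j I)
  have "nabla' Z (\<lambda>q. \<Sum>i\<in>insert j I. k i *\<^sub>R F i q) q = nabla' Z (\<lambda>q. k j *\<^sub>R F j q + (\<Sum>i\<in>I. k i *\<^sub>R F i q)) q"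
    unfolding sum.insert[OF insert.hyps] ..
  also have "\<dots> = nabla' Z (\<lambda>q. k j *\<^sub>R F j q) q + nabla' Z (\<lambda>q. \<Sum>i\<in>I. k i *\<^sub>R F i q) q"
    by (intro nabla_add assms(1) VF'_sum_const vector_fields_scale[OF M'] smooth_fun_const)
      (use insert.prems in auto)
  also have "\<dots> = k j *\<^sub>R nabla' Z (F j) q + (\<Sum>i\<in>I. k i *\<^sub>R nabla' Z (F i) q)"
    by (subst nabla_scale[OF assms(1)], use insert.prems in simp, subst insert.IH)
      (use insert.prems in auto)
  finally show ?case unfolding sum.insert[OF insert.hyps] .
next
  case (infinite I)
  have "(\<lambda>q. 0) \<in> VF'" using vector_fields_along_zero[OF M', of M' "\<lambda>p. p"] by (simp add: vector_fields_along_ident)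
  from nabla_scale[OF assms(1) this, of 0] show ?case
    unfolding sum.infinite[OF infinite.hyps] scaleR_zero_left .
next
  case empty
  have "(\<lambda>q. 0) \<in> VF'" using vector_fields_along_zero[OF M', of M' "\<lambda>p. p"] by (simp add: vector_fields_along_ident)
  from nabla_scale[OF assms(1) this, of 0] show ?case
    unfolding sum.empty scaleR_zero_left .
qed

text \<open>Differentiates the expansion of \<open>\<kappa> q *\<^sub>R W q\<close> by the Leibniz
  rule on both sides. In the last term the coefficients are frozen at \<open>p\<close>: what stands
  under \<open>nabla'\<close> is then a field on the ambient manifold, to which identities for
  \<open>nabla'\<close> apply.\<close>

lemma D_expansion:
  assumes X: "X \<in> VF" and Z: "Z \<in> VF'" "Z (f p) = df (X p)" and W: "W \<in> Along"
    and F: "\<And>i. i \<in> I \<Longrightarrow> F i \<in> VF'" and c: "\<And>i. i \<in> I \<Longrightarrow> smooth_fun M (c i)"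
    and k: "smooth_fun M \<kappa>" and eq: "\<And>q. \<kappa> q *\<^sub>R W q = (\<Sum>i\<in>I. c i q *\<^sub>R F i (f q))"
  shows "X p \<kappa> *\<^sub>R W p + \<kappa> p *\<^sub>R D X W p =
    (\<Sum>i\<in>I. X p (c i) *\<^sub>R F i (f p)) + nabla' Z (\<lambda>q. \<Sum>i\<in>I. c i p *\<^sub>R F i q) (f p)"
proof -
  have "X p \<kappa> *\<^sub>R W p + \<kappa> p *\<^sub>R D X W p = D X (\<lambda>q. \<Sum>i\<in>I. c i q *\<^sub>R F i (f q)) p"
    unfolding D_scale[OF X W k, symmetric] eq ..
  also have "\<dots> = (\<Sum>i\<in>I. X p (c i) *\<^sub>R F i (f p) + c i p *\<^sub>R D X (\<lambda>q. F i (f q)) p)"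
    by (rule D_sum_scale[OF X]) (auto intro: Along_comp F c)
  also have "\<dots> = (\<Sum>i\<in>I. X p (c i) *\<^sub>R F i (f p)) + nabla' Z (\<lambda>q. \<Sum>i\<in>I. c i p *\<^sub>R F i q) (f p)"
    by (simp add: sum.distrib D_comp[OF X F Z] nabla_sum_const[OF Z(1) F])
  finally show ?thesis .
qed

text \<open>An ambient frame around \<open>f p\<close>, pulled back by \<open>f\<close>. The
  function \<open>\<kappa>\<close> is the cube of the pulled-back bump function; it may vanish away
  from \<open>p\<close> and so stays on the left instead of being divided out.\<close>

lemma ex_frame_along:
  fixes p :: 'a
  obtains \<kappa> :: "'a \<Rightarrow> real" and c :: "('a \<Rightarrow> 'b tvec) \<Rightarrow> 'd \<Rightarrow> 'a \<Rightarrow> real" and E :: "'d \<Rightarrow> 'b \<Rightarrow> 'b tvec"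
  where "smooth_fun M \<kappa>" "\<kappa> p \<noteq> 0" "\<And>i. E i \<in> VF'" "\<And>V i. V \<in> Along \<Longrightarrow> smooth_fun M (c V i)"
    "\<And>V q. V \<in> Along \<Longrightarrow> \<kappa> q *\<^sub>R V q = (\<Sum>i\<in>Basis. c V i q *\<^sub>R E i (f q))"
proof -
  obtain b y E where b: "b (f p) \<noteq> 0" "local_frame M' b y E" by (rule ex_local_frame[OF M'])
  note fr = local_frameD[OF b(2)]
  show ?thesis
  proof (rule that[of "\<lambda>q. b (f q) ^ 3" E "\<lambda>V i q. frame_coeff b y i (f q) (V q)"])
    show "smooth_fun M (\<lambda>q. b (f q) ^ 3)"
      by (intro smooth_fun_power M smooth_fun_pullback[OF M M' f] fr)
    show "smooth_fun M (\<lambda>q. frame_coeff b y i (f q) (V q))" if "V \<in> Along" for V i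
      by (rule smooth_frame_coeff_along[OF M _ _ fr(1,2) that])
        (intro smooth_fun_pullback[OF M M' f] fr)+
  qed (use b fr(3) fr(4)[OF vector_field_along_tangent] in auto)
qed

lemma D_parallel:
  assumes P': "tensor_field_11 M' P'"
    and par: "\<And>X Y p. X \<in> VF' \<Longrightarrow> Y \<in> VF' \<Longrightarrow> nabla' X (\<lambda>q. P' q (Y q)) p = P' p (nabla' X Y p)"
    and X: "X \<in> VF" and V: "V \<in> Along" and PV: "(\<lambda>q. P' (f q) (V q)) \<in> Along"
  shows "D X (\<lambda>q. P' (f q) (V q)) p = P' (f p) (D X V p)"
proof -
  obtain \<kappa> c and E :: "'d \<Rightarrow> 'b \<Rightarrow> 'b tvec" where fr: "smooth_fun M \<kappa>" "\<kappa> p \<noteq> 0" "\<And>i. E i \<in> VF'"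
    "\<And>V i. V \<in> Along \<Longrightarrow> smooth_fun M (c V i)"
    "\<And>V q. V \<in> Along \<Longrightarrow> \<kappa> q *\<^sub>R V q = (\<Sum>i\<in>Basis. c V i q *\<^sub>R E i (f q))"
    by (rule ex_frame_along[of p]) (rule that)
  obtain Z where Z: "Z \<in> VF'" "Z (f p) = df (X p)"
    using ex_vector_field_extension[OF M' df_tangent[OF vector_field_tangent[OF X]]] by blast
  have lin: "linear_map_on (T' q) (P' q)" for q using P' by (simp add: tensor_field_11_def)
  have PE: "(\<lambda>q. P' q (E i q)) \<in> VF'" for i using P' fr(3) by (simp add: tensor_field_11_def)
  have lsum: "P' q (\<Sum>i\<in>Basis. k i *\<^sub>R E i q) = (\<Sum>i\<in>Basis. k i *\<^sub>R P' q (E i q))" for k q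
    by (rule linear_map_on_sum[OF sub_T' lin]) (rule vector_field_tangent[OF fr(3)])
  let ?W = "\<lambda>q. \<Sum>i\<in>Basis. c V i p *\<^sub>R E i q" and ?S = "\<Sum>i\<in>Basis. X p (c V i) *\<^sub>R E i (f p)"
  have W: "?W \<in> VF'" by (rule VF'_sum_const[OF fr(3)])
  have S: "?S \<in> T' (f p)"
    by (intro subspace_sum[OF sub_T'] subspace_scale[OF sub_T'] vector_field_tangent[OF fr(3)])
  have 1: "X p \<kappa> *\<^sub>R V p + \<kappa> p *\<^sub>R D X V p = ?S + nabla' Z ?W (f p)"
    by (rule D_expansion[OF X Z V fr(3) fr(4)[OF V] fr(1) fr(5)[OF V]])
  have 2: "X p \<kappa> *\<^sub>R P' (f p) (V p) + \<kappa> p *\<^sub>R D X (\<lambda>q. P' (f q) (V q)) p =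
      (\<Sum>i\<in>Basis. X p (c V i) *\<^sub>R P' (f p) (E i (f p))) +
      nabla' Z (\<lambda>q. \<Sum>i\<in>Basis. c V i p *\<^sub>R P' q (E i q)) (f p)"
  proof (rule D_expansion[OF X Z PV PE fr(4)[OF V] fr(1)])
    fix q
    have "\<kappa> q *\<^sub>R P' (f q) (V q) = P' (f q) (\<kappa> q *\<^sub>R V q)"
      using lin[of "f q"] vector_field_along_tangent[OF V] by (simp add: linear_map_on_def)
    then show "\<kappa> q *\<^sub>R P' (f q) (V q) = (\<Sum>i\<in>Basis. c V i q *\<^sub>R P' (f q) (E i (f q)))"
      unfolding fr(5)[OF V] lsum .
  qed
  have t: "V p \<in> T' (f p)" "D X V p \<in> T' (f p)" "nabla' Z ?W (f p) \<in> T' (f p)"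
    using vector_field_along_tangent[OF V] D_tangent[OF X V] nabla_tangent[OF Z(1) W] by auto
  have "X p \<kappa> *\<^sub>R P' (f p) (V p) + \<kappa> p *\<^sub>R P' (f p) (D X V p) = P' (f p) (X p \<kappa> *\<^sub>R V p + \<kappa> p *\<^sub>R D X V p)"
    using lin[of "f p"] t by (simp add: linear_map_on_def subspace_scale[OF sub_T'])
  also have "\<dots> = P' (f p) ?S + P' (f p) (nabla' Z ?W (f p))"
    unfolding 1 using lin[of "f p"] S t by (simp add: linear_map_on_def)
  also have "\<dots> = X p \<kappa> *\<^sub>R P' (f p) (V p) + \<kappa> p *\<^sub>R D X (\<lambda>q. P' (f q) (V q)) p"
    unfolding 2 par[OF Z(1) W, symmetric] lsum ..
  finally show ?thesis using fr(2) by simp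
qed

lemma metric_facts:
  shows metric_linear: "v \<in> T' q \<Longrightarrow> linear_map_on (T' q) (g' q v)"
    and metric_sym: "v \<in> T' q \<Longrightarrow> w \<in> T' q \<Longrightarrow> g' q v w = g' q w v"
    and metric_smooth: "Y \<in> VF' \<Longrightarrow> Z \<in> VF' \<Longrightarrow> smooth_fun M' (\<lambda>q. g' q (Y q) (Z q))"
  using metric unfolding riemannian_metric_def by blast+

lemma metric_bilinear:
  assumes "v \<in> T' q" "w \<in> T' q" "x \<in> T' q"
  shows metric_add_right: "g' q v (w + x) = g' q v w + g' q v x"
    and metric_scale_right: "g' q v (k *\<^sub>R w) = k * g' q v w"
    and metric_add_left: "g' q (w + x) v = g' q w v + g' q x v"
    and metric_scale_left: "g' q (k *\<^sub>R w) v = k * g' q w v"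
proof -
  show 1: "g' q v (w + x) = g' q v w + g' q v x" "g' q v (k *\<^sub>R w) = k * g' q v w"
    using metric_linear[OF assms(1)] assms by (simp_all add: linear_map_on_def)
  show "g' q (w + x) v = g' q w v + g' q x v" "g' q (k *\<^sub>R w) v = k * g' q w v"
    using 1 metric_sym[of _ q v] assms subspace_add[OF sub_T'] subspace_scale[OF sub_T'] by metis+
qed

lemma metric_sum_right:
  assumes "v \<in> T' q" "\<And>i. i \<in> I \<Longrightarrow> w i \<in> T' q"
  shows "g' q v (\<Sum>i\<in>I. k i *\<^sub>R w i) = (\<Sum>i\<in>I. k i * g' q v (w i))"
  using linear_map_on_sum[OF sub_T' metric_linear[OF assms(1)] assms(2), of I "\<lambda>i. i"]
    linear_map_on_sum[OF sub_T' metric_linear[OF assms(1)], of I w k] assms(2) by simp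

lemma metric_sum_left:
  assumes "v \<in> T' q" "\<And>i. i \<in> I \<Longrightarrow> w i \<in> T' q"
  shows "g' q (\<Sum>i\<in>I. k i *\<^sub>R w i) v = (\<Sum>i\<in>I. k i * g' q (w i) v)"
proof -
  have "(\<Sum>i\<in>I. k i *\<^sub>R w i) \<in> T' q"
    by (intro subspace_sum[OF sub_T'] subspace_scale[OF sub_T'] assms(2))
  then show ?thesis
    using metric_sum_right[OF assms, of I "\<lambda>i. i"] metric_sum_right[OF assms] assms
    by (simp add: metric_sym[of _ q v])
qed

text \<open>Multiplied by \<open>\<kappa>\<close> once for each argument, the inner product becomes
  a double sum of coefficients times pulled-back ambient functions. The product rule separates the
  derivatives of the coefficients from a frozen part, to which \<open>nabla_metric\<close> applies,
  and \<open>D_expansion\<close> reassembles the pieces. The terms with \<open>X p \<kappa>\<close>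
  occur on both sides and cancel.\<close>

lemma D_metric:
  assumes X: "X \<in> VF" and V: "V \<in> Along" and W: "W \<in> Along"
    and VW: "smooth_fun M (\<lambda>q. g' (f q) (V q) (W q))"
  shows "X p (\<lambda>q. g' (f q) (V q) (W q)) = g' (f p) (D X V p) (W p) + g' (f p) (V p) (D X W p)"
proof -
  obtain \<kappa> c and E :: "'d \<Rightarrow> 'b \<Rightarrow> 'b tvec" where fr: "smooth_fun M \<kappa>" "\<kappa> p \<noteq> 0" "\<And>i. E i \<in> VF'"
    "\<And>V i. V \<in> Along \<Longrightarrow> smooth_fun M (c V i)"
    "\<And>V q. V \<in> Along \<Longrightarrow> \<kappa> q *\<^sub>R V q = (\<Sum>i\<in>Basis. c V i q *\<^sub>R E i (f q))"
    by (rule ex_frame_along[of p]) (rule that)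
  obtain Z where Z: "Z \<in> VF'" "Z (f p) = df (X p)"
    using ex_vector_field_extension[OF M' df_tangent[OF vector_field_tangent[OF X]]] by blast
  let ?\<phi> = "\<lambda>q. g' (f q) (V q) (W q)"
  let ?C = "\<lambda>V q. \<Sum>i\<in>Basis. c V i p *\<^sub>R E i q" and ?S = "\<lambda>V. \<Sum>i\<in>Basis. X p (c V i) *\<^sub>R E i (f p)"
  let ?e = "\<lambda>i j q. g' q (E i q) (E j q)"
  note Et = vector_field_tangent[OF fr(3)]
  note Xp = vector_field_tangent[OF X, of p]
  have C: "?C V \<in> VF'" for V by (rule VF'_sum_const[OF fr(3)])
  have S: "?S V \<in> T' (f p)" for V
    by (intro subspace_sum[OF sub_T'] subspace_scale[OF sub_T'] Et)
  have ee: "g' q (\<Sum>i\<in>Basis. k i *\<^sub>R E i q) (\<Sum>j\<in>Basis. l j *\<^sub>R E j q) =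
      (\<Sum>i\<in>Basis. \<Sum>j\<in>Basis. k i * l j * ?e i j q)" for k l q
  proof -
    have "(\<Sum>j\<in>Basis. l j *\<^sub>R E j q) \<in> T' q"
      by (intro subspace_sum[OF sub_T'] subspace_scale[OF sub_T'] Et)
    then show ?thesis
      by (simp add: metric_sum_left metric_sum_right Et sum_distrib_left mult.assoc)
  qed
  have exp: "X p \<kappa> *\<^sub>R U p + \<kappa> p *\<^sub>R D X U p = ?S U + nabla' Z (?C U) (f p)" if "U \<in> Along" for U
    by (rule D_expansion[OF X Z that fr(3) fr(4)[OF that] fr(1) fr(5)[OF that]])
  have e: "smooth_fun M' (?e i j)" for i j by (rule metric_smooth[OF fr(3) fr(3)])
  note ef = smooth_fun_pullback[OF M M' f e]
  have tV: "U q \<in> T' (f q)" if "U \<in> Along" for U q using vector_field_along_tangent[OF that] .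
  have "\<kappa> q * (\<kappa> q * ?\<phi> q) = (\<Sum>i\<in>Basis. \<Sum>j\<in>Basis. c V i q * c W j q * ?e i j (f q))" for q
  proof -
    have "\<kappa> q * (\<kappa> q * ?\<phi> q) = g' (f q) (\<kappa> q *\<^sub>R V q) (\<kappa> q *\<^sub>R W q)"
      using tV[OF V, of q] tV[OF W, of q]
      by (simp add: metric_scale_left metric_scale_right subspace_scale[OF sub_T'])
    then show ?thesis unfolding fr(5)[OF V] fr(5)[OF W] ee .
  qed
  then have "X p (\<lambda>q. \<kappa> q * (\<kappa> q * ?\<phi> q)) =
      X p (\<lambda>q. \<Sum>i\<in>Basis. \<Sum>j\<in>Basis. c V i q * c W j q * ?e i j (f q))" by simp
  also have "\<dots> = (\<Sum>i\<in>Basis. \<Sum>j\<in>Basis. X p (\<lambda>q. c V i q * c W j q * ?e i j (f q)))"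
    by (subst tangent_vec_sum[OF M Xp], intro smooth_fun_sum smooth_fun_mult M fr(4) V W ef,
        subst tangent_vec_sum[OF M Xp], intro smooth_fun_mult M fr(4) V W ef, rule refl)
  also have "\<dots> = (\<Sum>i\<in>Basis. \<Sum>j\<in>Basis. c V i p * c W j p * X p (\<lambda>q. ?e i j (f q))
       + X p (c V i) * c W j p * ?e i j (f p) + c V i p * X p (c W j) * ?e i j (f p))"
    by (intro sum.cong refl, subst tangent_vec_mult[OF M Xp smooth_fun_mult[OF M fr(4)[OF V] fr(4)[OF W]] ef],
        subst tangent_vec_mult[OF M Xp fr(4)[OF V] fr(4)[OF W]]) (simp add: algebra_simps)
  also have "\<dots> = (\<Sum>i\<in>Basis. \<Sum>j\<in>Basis. c V i p * c W j p * X p (\<lambda>q. ?e i j (f q)))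
      + g' (f p) (?S V) (?C W (f p)) + g' (f p) (?C V (f p)) (?S W)"
    unfolding ee by (simp add: sum.distrib)
  also have "(\<Sum>i\<in>Basis. \<Sum>j\<in>Basis. c V i p * c W j p * X p (\<lambda>q. ?e i j (f q))) =
      X p (\<lambda>q. g' (f q) (?C V (f q)) (?C W (f q)))"
  proof -
    have "X p (\<lambda>q. c V i p * c W j p * ?e i j (f q)) = c V i p * c W j p * X p (\<lambda>q. ?e i j (f q))" for i j
      using tangent_vec_mult[OF M Xp smooth_fun_const ef, of "c V i p * c W j p"]
        tangent_vec_const[OF M Xp] by simp
    then show ?thesis
      unfolding ee
      by (subst tangent_vec_sum[OF M Xp], intro smooth_fun_sum smooth_fun_mult M smooth_fun_const ef,
        subst tangent_vec_sum[OF M Xp], intro smooth_fun_mult M smooth_fun_const ef) simp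
  qed
  also have "\<dots> = Z (f p) (\<lambda>q. g' q (?C V q) (?C W q))"
    unfolding Z(2) by (rule df_apply[OF metric_smooth[OF C C], symmetric])
  also have "\<dots> = g' (f p) (nabla' Z (?C V) (f p)) (?C W (f p)) + g' (f p) (?C V (f p)) (nabla' Z (?C W) (f p))"
    by (rule nabla_metric[OF Z(1) C C])
  also have "g' (f p) (nabla' Z (?C V) (f p)) (?C W (f p)) + g' (f p) (?C V (f p)) (nabla' Z (?C W) (f p))
      + g' (f p) (?S V) (?C W (f p)) + g' (f p) (?C V (f p)) (?S W) =
      g' (f p) (?S V + nabla' Z (?C V) (f p)) (?C W (f p)) + g' (f p) (?C V (f p)) (?S W + nabla' Z (?C W) (f p))"
    using metric_add_left[OF vector_field_tangent[OF C[of W]] S[of V] nabla_tangent[OF Z(1) C[of V]]]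
      metric_add_right[OF vector_field_tangent[OF C[of V]] S[of W] nabla_tangent[OF Z(1) C[of W]]] by linarith
  also have "\<dots> = g' (f p) (X p \<kappa> *\<^sub>R V p + \<kappa> p *\<^sub>R D X V p) (\<kappa> p *\<^sub>R W p) +
      g' (f p) (\<kappa> p *\<^sub>R V p) (X p \<kappa> *\<^sub>R W p + \<kappa> p *\<^sub>R D X W p)"
    unfolding exp[OF V] exp[OF W] fr(5)[OF V] fr(5)[OF W] ..
  also have "\<dots> = 2 * \<kappa> p * X p \<kappa> * ?\<phi> p + \<kappa> p * \<kappa> p * (g' (f p) (D X V p) (W p) + g' (f p) (V p) (D X W p))"
  proof -
    note t = tV[OF V, of p] tV[OF W, of p] D_tangent[OF X V, of p] D_tangent[OF X W, of p]
    note ts = t[THEN subspace_scale[OF sub_T']]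
    show ?thesis
      using t ts
      by (simp add: metric_add_left[of _ "f p"] metric_add_right metric_scale_left metric_scale_right
          subspace_add[OF sub_T'] algebra_simps)
  qed
  also have "X p (\<lambda>q. \<kappa> q * (\<kappa> q * ?\<phi> q)) = 2 * \<kappa> p * X p \<kappa> * ?\<phi> p + \<kappa> p * \<kappa> p * X p ?\<phi>"
    unfolding tangent_vec_mult[OF M Xp fr(1) smooth_fun_mult[OF M fr(1) VW]] tangent_vec_mult[OF M Xp fr(1) VW]
    by (simp add: algebra_simps)
  finally show ?thesis using fr(2) by simp
qed

lemma D_torsion:
  assumes X: "X \<in> VF" and Y: "Y \<in> VF"
  shows "D X (\<lambda>q. df (Y q)) p - D Y (\<lambda>q. df (X q)) p = df (lie_bracket X Y p)"
proof -
  obtain \<kappa> c and E :: "'d \<Rightarrow> 'b \<Rightarrow> 'b tvec" where fr: "smooth_fun M \<kappa>" "\<kappa> p \<noteq> 0" "\<And>i. E i \<in> VF'"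
    "\<And>V i. V \<in> Along \<Longrightarrow> smooth_fun M (c V i)"
    "\<And>V q. V \<in> Along \<Longrightarrow> \<kappa> q *\<^sub>R V q = (\<Sum>i\<in>Basis. c V i q *\<^sub>R E i (f q))"
    by (rule ex_frame_along[of p]) (rule that)
  define d where "d X = c (\<lambda>q. df (X q))" for X :: "'a \<Rightarrow> 'a tvec"
  have d: "smooth_fun M (d X i)" if "X \<in> VF" for X i
    unfolding d_def by (rule fr(4)[OF Along_df[OF that]])
  have ex: "\<kappa> q *\<^sub>R df (X q) = (\<Sum>i\<in>Basis. d X i q *\<^sub>R E i (f q))" if "X \<in> VF" for X q
    unfolding d_def by (rule fr(5)[OF Along_df[OF that]])
  define C where "C X q = (\<Sum>i\<in>Basis. d X i p *\<^sub>R E i q)" for X :: "'a \<Rightarrow> 'a tvec" and q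
  have C: "C X \<in> VF'" for X unfolding C_def[abs_def] by (rule VF'_sum_const[OF fr(3)])
  have Cp: "C X (f p) = \<kappa> p *\<^sub>R df (X p)" if "X \<in> VF" for X
    using ex[OF that] by (simp add: C_def)
  have exp: "X p \<kappa> *\<^sub>R df (Y p) + \<kappa> p *\<^sub>R D X (\<lambda>q. df (Y q)) p =
      (\<Sum>i\<in>Basis. X p (d Y i) *\<^sub>R E i (f p)) + (1 / \<kappa> p) *\<^sub>R nabla' (C X) (C Y) (f p)"
    if X: "X \<in> VF" and Y: "Y \<in> VF" for X Y
  proof -
    \<comment> \<open>An extension of \<open>df (X p)\<close> is needed in
      \<open>D_expansion\<close>. Taking a multiple of \<open>C X\<close> gives
      \<open>nabla'\<close> two frozen arguments, as \<open>nabla_torsion\<close> requires.\<close>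
    have Z: "(\<lambda>q. (1 / \<kappa> p) *\<^sub>R C X q) \<in> VF'"
      by (rule vector_fields_scale[OF M' smooth_fun_const C])
    have Zp: "(1 / \<kappa> p) *\<^sub>R C X (f p) = df (X p)" using Cp[OF X] fr(2) by simp
    show ?thesis
      using D_expansion[OF X Z Zp Along_df[OF Y] fr(3) d[OF Y] fr(1) ex[OF Y]]
      unfolding nabla_scale_left[OF C C] C_def[symmetric, abs_def] by simp
  qed
  let ?L = "D X (\<lambda>q. df (Y q)) p - D Y (\<lambda>q. df (X q)) p"
  have h: "?L h = df (lie_bracket X Y p) h" if h: "smooth_fun M' h" for h
  proof -
    note hf = smooth_fun_pullback[OF M M' f h]
    note Ehf = smooth_fun_pullback[OF M M' f vector_field_smooth[OF fr(3) h]]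
    have CC: "C X (f p) (\<lambda>q. C Y q h) = \<kappa> p * (\<Sum>i\<in>Basis. d Y i p * X p (\<lambda>q. E i (f q) h))"
      if X: "X \<in> VF" for X Y
    proof -
      note Xp = vector_field_tangent[OF X, of p]
      have "C X (f p) (\<lambda>q. C Y q h) = \<kappa> p * X p (\<lambda>q. C Y (f q) h)"
        unfolding Cp[OF X] by (simp add: scaleR_fun_def df_apply[OF vector_field_smooth[OF C h]])
      also have "X p (\<lambda>q. C Y (f q) h) = X p (\<lambda>q. \<Sum>i\<in>Basis. d Y i p * E i (f q) h)"
        by (simp add: C_def sum_fun_apply scaleR_fun_def)
      also have "\<dots> = (\<Sum>i\<in>Basis. X p (\<lambda>q. d Y i p * E i (f q) h))"
        by (intro tangent_vec_sum[OF M Xp] smooth_fun_mult M smooth_fun_const Ehf)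
      also have "\<dots> = (\<Sum>i\<in>Basis. d Y i p * X p (\<lambda>q. E i (f q) h))"
        using tangent_vec_mult[OF M Xp smooth_fun_const Ehf] tangent_vec_const[OF M Xp] by simp
      finally show ?thesis .
    qed
    have der: "(\<Sum>i\<in>Basis. d Y i p * X p (\<lambda>q. E i (f q) h)) + (\<Sum>i\<in>Basis. X p (d Y i) * E i (f p) h) =
        \<kappa> p * X p (\<lambda>q. Y q (\<lambda>r. h (f r))) + X p \<kappa> * Y p (\<lambda>r. h (f r))"
      if X: "X \<in> VF" and Y: "Y \<in> VF" for X Y
    proof -
      note Xp = vector_field_tangent[OF X, of p]
      have eq: "\<kappa> q * Y q (\<lambda>r. h (f r)) = (\<Sum>i\<in>Basis. d Y i q * E i (f q) h)" for q
        using fun_cong[OF ex[OF Y, of q], of h]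
        by (simp add: scaleR_fun_def sum_fun_apply df_apply[OF h])
      have "(\<Sum>i\<in>Basis. d Y i p * X p (\<lambda>q. E i (f q) h)) + (\<Sum>i\<in>Basis. X p (d Y i) * E i (f p) h) =
          (\<Sum>i\<in>Basis. X p (\<lambda>q. d Y i q * E i (f q) h))"
        by (simp add: tangent_vec_mult[OF M Xp d[OF Y] Ehf] sum.distrib mult.commute)
      also have "\<dots> = X p (\<lambda>q. \<Sum>i\<in>Basis. d Y i q * E i (f q) h)"
        by (intro tangent_vec_sum[OF M Xp, symmetric] smooth_fun_mult M d Y Ehf)
      also have "\<dots> = X p (\<lambda>q. \<kappa> q * Y q (\<lambda>r. h (f r)))" unfolding eq ..
      also have "\<dots> = \<kappa> p * X p (\<lambda>q. Y q (\<lambda>r. h (f r))) + X p \<kappa> * Y p (\<lambda>r. h (f r))"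
        by (simp add: tangent_vec_mult[OF M Xp fr(1) vector_field_smooth[OF Y hf]])
      finally show ?thesis .
    qed
    have e: "X p \<kappa> * Y p (\<lambda>r. h (f r)) + \<kappa> p * D X (\<lambda>q. df (Y q)) p h =
        (\<Sum>i\<in>Basis. X p (d Y i) * E i (f p) h) + 1 / \<kappa> p * nabla' (C X) (C Y) (f p) h"
      if X: "X \<in> VF" and Y: "Y \<in> VF" for X Y
      using fun_cong[OF exp[OF X Y], of h] by (simp add: scaleR_fun_def sum_fun_apply df_apply[OF h])
    have "nabla' (C X) (C Y) (f p) h - nabla' (C Y) (C X) (f p) h =
        \<kappa> p * ((\<Sum>i\<in>Basis. d Y i p * X p (\<lambda>q. E i (f q) h)) - (\<Sum>i\<in>Basis. d X i p * Y p (\<lambda>q. E i (f q) h)))"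
      using fun_cong[OF nabla_torsion[OF C C], of X Y "f p" h] CC[OF X, of Y] CC[OF Y, of X] by (simp add: lie_bracket_def right_diff_distrib)
    then have "1 / \<kappa> p * nabla' (C X) (C Y) (f p) h - 1 / \<kappa> p * nabla' (C Y) (C X) (f p) h =
        (\<Sum>i\<in>Basis. d Y i p * X p (\<lambda>q. E i (f q) h)) - (\<Sum>i\<in>Basis. d X i p * Y p (\<lambda>q. E i (f q) h))"
      using fr(2) unfolding right_diff_distrib[symmetric] by simp
    then have "\<kappa> p * ?L h = \<kappa> p * lie_bracket X Y p (\<lambda>r. h (f r))"
      using e[OF X Y] e[OF Y X] der[OF X Y] der[OF Y X]
      by (simp add: lie_bracket_def right_diff_distrib)
    then show ?thesis using fr(2) df_apply[OF h] by simp
  qed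
  have "?L \<in> T' (f p)"
    by (intro subspace_diff[OF sub_T'] D_tangent Along_df X Y)
  then have "?L h = df (lie_bracket X Y p) h" for h
    using h[of h] tangent_vec_non_smooth[of ?L M' "f p" h] by (cases "smooth_fun M' h") (simp_all add: differential_def)
  then show ?thesis by blast
qed

end

section \<open>The structure induced on a submanifold\<close>

lemma linear_inj_same_dim_surj:
  fixes F :: "'x::euclidean_space \<Rightarrow> 'y::euclidean_space"
  assumes "linear F" "\<And>x. F x = 0 \<Longrightarrow> x = 0" "DIM('x) = DIM('y)"
  shows "\<exists>x. F x = y"
proof -
  have "inj F" using assms(1,2) by (simp add: linear_injective_0)
  then have "dim (range F) = DIM('y)"
    using dim_image_eq[OF assms(1), of UNIV] assms(3) by simp
  then have "span (range F) = UNIV"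
    by (simp add: dim_eq_full)
  moreover have "subspace (range F)"
    using linear_subspace_image[OF assms(1) subspace_UNIV] .
  ultimately have "range F = UNIV" by (metis span_eq_iff)
  then show ?thesis by (metis surjD)
qed

text \<open>The bookkeeping for \<open>nijenhuis_eq\<close>: \<open>c3\<close> and \<open>c4\<close>
  are the covariant derivatives of the images under \<open>P\<close> along each other,
  \<open>q1\<close> and \<open>q2\<close> are \<open>P\<close> applied to the mixed ones. The
  leading terms \<open>c1\<close>, \<open>c2\<close>, \<open>a\<close>, \<open>b\<close> cancel, and
  so does \<open>l\<close>, which \<open>q1\<close> and \<open>q2\<close> share.\<close>

lemma nijenhuis_cancellation:
  fixes c1 :: "'v::ab_group_add"
  assumes "c3 = c1 + s1 + k1" "c4 = c2 + s2 + k2" "q1 = b + s3 + l" "q2 = a + s4 + l"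
  shows "c3 - c4 + (a - b) - (c1 - q1) - (q2 - c2) = (s1 - s4) - (s2 - s3) + (k1 - k2)"
  unfolding assms by (simp add: algebra_simps)

text \<open>The vanishing of the normal connection is built into \<open>weingarten\<close>, which
  has no normal term. Normality and the determinant condition enter later, as premises of single
  lemmas.\<close>

locale induced_submanifold = derivative_along M M' f g' nabla' D
  for M :: "('a::{t2_space,second_countable_topology}, 'm::euclidean_space) chart set"
    and M' :: "('b::{t2_space,second_countable_topology}, 'd::euclidean_space) chart set"
    and f g' nabla' D +
  fixes g :: "'a \<Rightarrow> 'a tvec \<Rightarrow> 'a tvec \<Rightarrow> real"
    and P' :: "'b \<Rightarrow> 'b tvec \<Rightarrow> 'b tvec"
    and N :: "'r::finite \<Rightarrow> 'a \<Rightarrow> 'b tvec"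
    and P :: "'a \<Rightarrow> 'a tvec \<Rightarrow> 'a tvec"
    and u :: "'r \<Rightarrow> 'a \<Rightarrow> 'a tvec \<Rightarrow> real"
    and \<xi> :: "'r \<Rightarrow> 'a \<Rightarrow> 'a tvec"
    and a :: "'a \<Rightarrow> real ^ 'r ^ 'r"
    and A :: "'r \<Rightarrow> 'a \<Rightarrow> 'a tvec \<Rightarrow> 'a tvec"
  assumes dim: "DIM('d) = DIM('m) + CARD('r)"
    and g: "riemannian_metric M g"
    and immersion: "isometric_immersion M M' g g' f"
    and frame: "orthonormal_normal_frame M M' g' f N"
    and P': "almost_product_riemannian M' g' P'"
    and parallel: "\<And>X Y p. X \<in> VF' \<Longrightarrow> Y \<in> VF' \<Longrightarrow> nabla' X (\<lambda>q. P' q (Y q)) p = P' p (nabla' X Y p)"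
    and induced: "induced_structure M M' P' f N P u \<xi> a"
    and A: "\<And>\<alpha>. tensor_field_11 M (A \<alpha>)"
    and weingarten: "\<And>\<alpha> X p. X \<in> VF \<Longrightarrow> D X (N \<alpha>) p = - df (A \<alpha> p (X p))"
begin

section \<open>Splitting into tangential and normal parts\<close>

lemma extend:
  assumes "v \<in> T p"
  obtains X where "X \<in> VF" "X p = v"
  using ex_vector_field_extension[OF M assms] .

lemma df_inj: "v \<in> T p \<Longrightarrow> w \<in> T p \<Longrightarrow> df v = df w \<Longrightarrow> v = w"
  using immersion unfolding isometric_immersion_def inj_on_def by blast

lemma isometry: "v \<in> T p \<Longrightarrow> w \<in> T p \<Longrightarrow> g p v w = g' (f p) (df v) (df w)"
  using immersion unfolding isometric_immersion_def by blast

lemma N_facts: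
  shows N_along: "N \<alpha> \<in> Along"
    and N_normal: "v \<in> T p \<Longrightarrow> g' (f p) (df v) (N \<alpha> p) = 0"
    and N_orthonormal: "g' (f p) (N \<alpha> p) (N \<beta> p) = (if \<alpha> = \<beta> then 1 else 0)"
  using frame unfolding orthonormal_normal_frame_def by blast+

lemma N_tangent: "N \<alpha> p \<in> T' (f p)"
  by (rule vector_field_along_tangent[OF N_along])

lemma N_sum_tangent: "(\<Sum>\<alpha>\<in>UNIV. s \<alpha> *\<^sub>R N \<alpha> p) \<in> T' (f p)"
  by (intro subspace_sum[OF sub_T'] subspace_scale[OF sub_T'] N_tangent)

lemma metric_N:
  assumes "v \<in> T p"
  shows "g' (f p) (df v + (\<Sum>\<alpha>\<in>UNIV. s \<alpha> *\<^sub>R N \<alpha> p)) (N \<beta> p) = s \<beta>"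
proof -
  have "g' (f p) (\<Sum>\<alpha>\<in>UNIV. s \<alpha> *\<^sub>R N \<alpha> p) (N \<beta> p) = (\<Sum>\<alpha>\<in>UNIV. s \<alpha> * g' (f p) (N \<alpha> p) (N \<beta> p))"
    by (rule metric_sum_left[OF N_tangent N_tangent])
  also have "\<dots> = s \<beta>" by (simp add: N_orthonormal if_distrib cong: if_cong)
  finally show ?thesis
    unfolding metric_add_left[OF N_tangent df_tangent[OF assms] N_sum_tangent] N_normal[OF assms] by simp
qed

lemma decomposition_unique:
  assumes "v \<in> T p" "w \<in> T p"
    "df v + (\<Sum>\<alpha>\<in>UNIV. s \<alpha> *\<^sub>R N \<alpha> p) = df w + (\<Sum>\<alpha>\<in>UNIV. t \<alpha> *\<^sub>R N \<alpha> p)"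
  shows "v = w" "s = t"
proof -
  have "s \<beta> = t \<beta>" for \<beta>
    using metric_N[OF assms(1), of s \<beta>] metric_N[OF assms(2), of t \<beta>] unfolding assms(3) by simp
  then show st: "s = t" by (rule ext)
  have "df v = df w" using assms(3) unfolding st add_right_cancel .
  then show "v = w" by (rule df_inj[OF assms(1,2)])
qed

text \<open>\<open>\<Phi>\<close> builds an ambient vector from components in a tangent frame and in
  the normal frame, injectively by \<open>decomposition_unique\<close>. Followed by the coordinates
  \<open>\<sigma>\<close> it is a linear injection between Euclidean spaces whose dimensions agree
  by \<open>dim\<close>, hence onto; injectivity of \<open>\<sigma>\<close> on the tangent space
  leads back to \<open>w\<close>.\<close>

lemma decomposition_exists:
  assumes w: "w \<in> T' (f p)"
  shows "\<exists>v\<in>T p. \<exists>s. w = df v + (\<Sum>\<alpha>\<in>UNIV. s \<alpha> *\<^sub>R N \<alpha> p)"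
proof -
  obtain b y E where b: "b p \<noteq> 0" "local_frame M b y E" by (rule ex_local_frame[OF M])
  obtain b' y' E' where b': "b' (f p) \<noteq> 0" "local_frame M' b' y' E'" by (rule ex_local_frame[OF M'])
  note fr = local_frameD[OF b(2)] and fr' = local_frameD[OF b'(2)]
  define \<tau> where "\<tau> x = (\<Sum>i\<in>Basis. (x \<bullet> i) *\<^sub>R E i p)" for x :: 'm
  \<comment> \<open>The tangent space is a subspace of a function space; \<open>\<sigma>\<close>
    moves the question to the model space, where dimensions can be compared.\<close>
  define \<sigma> where "\<sigma> w = (\<Sum>i\<in>Basis. frame_coeff b' y' i (f p) w *\<^sub>R i)" for w
  define \<Phi> where "\<Phi> z = df (\<tau> (fst z)) + (\<Sum>\<alpha>\<in>UNIV. (snd z $ \<alpha>) *\<^sub>R N \<alpha> p)" for z :: "'m \<times> (real ^ 'r)"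
  have \<tau>: "\<tau> x \<in> T p" for x
    unfolding \<tau>_def by (intro subspace_sum[OF sub_T] subspace_scale[OF sub_T] vector_field_tangent[OF fr(3)])
  have \<tau>_lin: "linear \<tau>"
    by (rule linearI) (simp_all only: \<tau>_def inner_add_left inner_scaleR_left scaleR_add_left
        sum.distrib scaleR_scaleR[symmetric] scaleR_sum_right[symmetric])
  have \<tau>_0: "x = 0" if "\<tau> x = 0" for x
  proof (rule euclidean_eqI)
    fix j :: 'm assume j: "j \<in> Basis"
    have "0 = frame_coeff b y j p (\<tau> x)" unfolding that by (simp add: frame_coeff_def)
    also have "\<dots> = (\<Sum>i\<in>Basis. (x \<bullet> i) * (if j = i then b p ^ 3 else 0))"
      unfolding \<tau>_def frame_coeff_sum by (intro sum.cong refl) (simp add: fr(5)[OF j])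
    also have "\<dots> = (x \<bullet> j) * b p ^ 3" using j by (simp add: if_distrib cong: if_cong)
    finally show "x \<bullet> j = 0 \<bullet> j" using b(1) by simp
  qed
  have \<sigma>_lin: "linear \<sigma>"
    by (rule linearI) (simp_all add: \<sigma>_def frame_coeff_def scaleR_fun_def algebra_simps
        sum.distrib scaleR_sum_right sum_subtractf)
  have \<sigma>_inj: "v = w" if "v \<in> T' (f p)" "w \<in> T' (f p)" "\<sigma> v = \<sigma> w" for v w
  proof -
    have "frame_coeff b' y' i (f p) v = frame_coeff b' y' i (f p) w" if "i \<in> Basis" for i
      using arg_cong[OF \<open>\<sigma> v = \<sigma> w\<close>, of "\<lambda>x. x \<bullet> i"] that by (simp add: \<sigma>_def)
    then have "b' (f p) ^ 3 *\<^sub>R v = b' (f p) ^ 3 *\<^sub>R w"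
      unfolding fr'(4)[OF that(1)] fr'(4)[OF that(2)] by (intro sum.cong refl) simp
    then show ?thesis using b'(1) by (metis scaleR_cancel_left power_not_zero)
  qed
  have \<Phi>: "\<Phi> z \<in> T' (f p)" for z
    unfolding \<Phi>_def by (intro subspace_add[OF sub_T'] df_tangent \<tau> N_sum_tangent)
  have \<Phi>_lin: "linear \<Phi>"
  proof (rule linearI)
    show "\<Phi> (z + z') = \<Phi> z + \<Phi> z'" for z z'
      by (simp only: \<Phi>_def fst_add snd_add linear_add[OF \<tau>_lin] linear_add[OF df_linear]
          vector_add_component scaleR_add_left sum.distrib add_ac)
    show "\<Phi> (k *\<^sub>R z) = k *\<^sub>R \<Phi> z" for k z
      by (simp only: \<Phi>_def fst_scaleR snd_scaleR linear_cmul[OF \<tau>_lin] linear_cmul[OF df_linear]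
          vector_scaleR_component scaleR_add_right scaleR_sum_right scaleR_scaleR real_scaleR_def)
  qed
  have "\<exists>z. (\<sigma> \<circ> \<Phi>) z = \<sigma> w"
  proof (rule linear_inj_same_dim_surj[OF linear_compose[OF \<Phi>_lin \<sigma>_lin]])
    fix z :: "'m \<times> (real ^ 'r)" assume "(\<sigma> \<circ> \<Phi>) z = 0"
    then have "\<sigma> (\<Phi> z) = \<sigma> (\<Phi> 0)" using linear_0[OF \<sigma>_lin] linear_0[OF \<Phi>_lin] by simp
    then have "\<Phi> z = \<Phi> 0" by (rule \<sigma>_inj[OF \<Phi> \<Phi>])
    from decomposition_unique[OF \<tau> \<tau> this[unfolded \<Phi>_def]]
    have "\<tau> (fst z) = 0" "($) (snd z) = ($) 0" using linear_0[OF \<tau>_lin] by (simp_all add: fun_eq_iff)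
    then show "z = 0" using \<tau>_0 by (simp add: prod_eq_iff vec_eq_iff fun_eq_iff)
  qed (simp add: dim)
  then obtain z where "\<sigma> (\<Phi> z) = \<sigma> w" by auto
  then have "w = \<Phi> z" using \<sigma>_inj[OF \<Phi> w] by metis
  then show ?thesis using \<tau> unfolding \<Phi>_def by blast
qed

section \<open>Algebraic relations of the induced structure\<close>

lemma A_tangent: "v \<in> T p \<Longrightarrow> A \<alpha> p v \<in> T p"
  using A[of \<alpha>] unfolding tensor_field_11_def by blast

lemma P'_facts:
  shows P'_tangent: "v \<in> T' q \<Longrightarrow> P' q v \<in> T' q"
    and P'_linear: "linear_map_on (T' q) (P' q)"
    and P'_tensor: "tensor_field_11 M' P'"
    and P'_involution: "v \<in> T' q \<Longrightarrow> P' q (P' q v) = v"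
    and P'_isometry: "v \<in> T' q \<Longrightarrow> w \<in> T' q \<Longrightarrow> g' q (P' q v) (P' q w) = g' q v w"
  using P' unfolding almost_product_riemannian_def tensor_field_11_def by blast+

lemma P'_sym: "v \<in> T' q \<Longrightarrow> w \<in> T' q \<Longrightarrow> g' q (P' q v) w = g' q v (P' q w)"
  using P'_isometry[of v q "P' q w"] P'_tangent[of w q] P'_involution[of w q] by simp

lemma P'_add_N_sum:
  assumes "v \<in> T' (f p)"
  shows "P' (f p) (v + (\<Sum>\<alpha>\<in>UNIV. s \<alpha> *\<^sub>R N \<alpha> p)) =
    P' (f p) v + (\<Sum>\<alpha>\<in>UNIV. s \<alpha> *\<^sub>R P' (f p) (N \<alpha> p))"
proof -
  have "P' (f p) (v + (\<Sum>\<alpha>\<in>UNIV. s \<alpha> *\<^sub>R N \<alpha> p)) =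
      P' (f p) v + P' (f p) (\<Sum>\<alpha>\<in>UNIV. s \<alpha> *\<^sub>R N \<alpha> p)"
    using P'_linear[of "f p"] assms N_sum_tangent unfolding linear_map_on_def by blast
  also have "P' (f p) (\<Sum>\<alpha>\<in>UNIV. s \<alpha> *\<^sub>R N \<alpha> p) = (\<Sum>\<alpha>\<in>UNIV. s \<alpha> *\<^sub>R P' (f p) (N \<alpha> p))"
    by (rule linear_map_on_sum[OF sub_T' P'_linear N_tangent])
  finally show ?thesis .
qed

lemma induced_facts:
  shows P_tangent: "v \<in> T p \<Longrightarrow> P p v \<in> T p"
    and P_linear: "linear_map_on (T p) (P p)"
    and P_field: "X \<in> VF \<Longrightarrow> (\<lambda>p. P p (X p)) \<in> VF"
    and u_linear: "linear_map_on (T p) (u \<alpha> p)"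
    and u_smooth: "X \<in> VF \<Longrightarrow> smooth_fun M (\<lambda>p. u \<alpha> p (X p))"
    and \<xi>_tangent: "\<xi> \<alpha> p \<in> T p"
    and P'_N: "P' (f p) (N \<alpha> p) = df (\<xi> \<alpha> p) + (\<Sum>\<beta>\<in>UNIV. a p $ \<alpha> $ \<beta> *\<^sub>R N \<beta> p)"
proof -
  have 1: "tensor_field_11 M P" "one_form M (u \<alpha>)" "\<xi> \<alpha> \<in> VF"
    using induced unfolding induced_structure_def by blast+
  show "v \<in> T p \<Longrightarrow> P p v \<in> T p" "linear_map_on (T p) (P p)" "X \<in> VF \<Longrightarrow> (\<lambda>p. P p (X p)) \<in> VF"
    using 1(1) unfolding tensor_field_11_def by blast+
  show "linear_map_on (T p) (u \<alpha> p)" "X \<in> VF \<Longrightarrow> smooth_fun M (\<lambda>p. u \<alpha> p (X p))"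
    using 1(2) unfolding one_form_def by blast+
  show "\<xi> \<alpha> p \<in> T p" by (rule vector_field_tangent[OF 1(3)])
  show "P' (f p) (N \<alpha> p) = df (\<xi> \<alpha> p) + (\<Sum>\<beta>\<in>UNIV. a p $ \<alpha> $ \<beta> *\<^sub>R N \<beta> p)"
    using induced unfolding induced_structure_def by blast
qed

lemma P'_df:
  assumes "v \<in> T p"
  shows "P' (f p) (df v) = df (P p v) + (\<Sum>\<alpha>\<in>UNIV. u \<alpha> p v *\<^sub>R N \<alpha> p)"
proof -
  obtain X where "X \<in> VF" "X p = v" by (rule extend[OF assms])
  then show ?thesis using induced unfolding induced_structure_def by blast
qed

lemma linear_map_on_facts:
  assumes "linear_map_on (T p) L" "v \<in> T p" "w \<in> T p"
  shows map_add: "L (v + w) = L v + L w"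
    and map_diff: "L (v - w) = L v - L w"
proof -
  show "L (v + w) = L v + L w"
    using assms unfolding linear_map_on_def by blast
  have 2: "(-1) *\<^sub>R w \<in> T p" by (rule subspace_scale[OF sub_T assms(3)])
  have "L (v + (-1) *\<^sub>R w) = L v + (-1) *\<^sub>R L w"
    using assms 2 unfolding linear_map_on_def by metis
  then show "L (v - w) = L v - L w" by (simp only: scaleR_minus1_left add_uminus_conv_diff)
qed

lemma T_sum: "(\<And>\<alpha>. v \<alpha> \<in> T p) \<Longrightarrow> (\<Sum>\<alpha>\<in>I. k \<alpha> *\<^sub>R v \<alpha>) \<in> T p"
  by (intro subspace_sum[OF sub_T] subspace_scale[OF sub_T])

lemma g_linear: "v \<in> T p \<Longrightarrow> linear_map_on (T p) (g p v)"
  and g_sym: "v \<in> T p \<Longrightarrow> w \<in> T p \<Longrightarrow> g p v w = g p w v"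
  and g_pos: "v \<in> T p \<Longrightarrow> v \<noteq> 0 \<Longrightarrow> g p v v > 0"
  using g unfolding riemannian_metric_def by blast+

lemma g_P_sym:
  assumes "v \<in> T p" "w \<in> T p"
  shows "g p (P p v) w = g p v (P p w)"
proof -
  have *: "g' (f p) (P' (f p) (df v)) (df w) = g p (P p v) w" if v: "v \<in> T p" and w: "w \<in> T p" for v w
  proof -
    have "g' (f p) (\<Sum>\<alpha>\<in>UNIV. u \<alpha> p v *\<^sub>R N \<alpha> p) (df w) = (\<Sum>\<alpha>\<in>UNIV. u \<alpha> p v * g' (f p) (N \<alpha> p) (df w))"
      by (rule metric_sum_left[OF df_tangent[OF w] N_tangent])
    also have "\<dots> = 0"
      using N_normal[OF w] metric_sym[OF N_tangent df_tangent[OF w]] by simp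
    finally show ?thesis
      unfolding P'_df[OF v] metric_add_left[OF df_tangent[OF w] df_tangent[OF P_tangent[OF v]] N_sum_tangent]
        isometry[OF P_tangent[OF v] w] by simp
  qed
  show ?thesis
    using *[OF assms] *[OF assms(2,1)] P'_sym[OF df_tangent df_tangent, OF assms]
      metric_sym[OF df_tangent[OF assms(1)] P'_tangent[OF df_tangent[OF assms(2)]]]
      g_sym[OF assms(1) P_tangent[OF assms(2)]] by simp
qed

text \<open>Compares the components along \<open>N \<beta> p\<close> after applying
  \<open>P'\<close> twice to \<open>N \<alpha> p\<close>: the involution gives the identity matrix,
  the splitting gives \<open>u \<beta> p (\<xi> \<alpha> p)\<close> plus an entry of the square of
  \<open>a p\<close>.\<close>

lemma u_\<xi>:
  "u \<beta> p (\<xi> \<alpha> p) = (mat 1 - a p ** a p) $ \<alpha> $ \<beta>"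
proof -
  have lin: "P' (f p) (df (\<xi> \<alpha> p) + (\<Sum>\<beta>\<in>UNIV. a p $ \<alpha> $ \<beta> *\<^sub>R N \<beta> p)) =
      P' (f p) (df (\<xi> \<alpha> p)) + (\<Sum>\<gamma>\<in>UNIV. a p $ \<alpha> $ \<gamma> *\<^sub>R P' (f p) (N \<gamma> p))"
    by (rule P'_add_N_sum[OF df_tangent[OF \<xi>_tangent]])
  have 1: "g' (f p) (P' (f p) (P' (f p) (N \<alpha> p))) (N \<beta> p) = (if \<alpha> = \<beta> then 1 else 0)"
    unfolding P'_involution[OF N_tangent] by (rule N_orthonormal)
  have "g' (f p) (\<Sum>\<gamma>\<in>UNIV. a p $ \<alpha> $ \<gamma> *\<^sub>R P' (f p) (N \<gamma> p)) (N \<beta> p) =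
      (\<Sum>\<gamma>\<in>UNIV. a p $ \<alpha> $ \<gamma> * g' (f p) (P' (f p) (N \<gamma> p)) (N \<beta> p))"
    by (rule metric_sum_left[OF N_tangent P'_tangent[OF N_tangent]])
  also have "\<dots> = (a p ** a p) $ \<alpha> $ \<beta>"
    unfolding P'_N metric_N[OF \<xi>_tangent] by (simp add: matrix_matrix_mult_def)
  finally have 2: "g' (f p) (\<Sum>\<gamma>\<in>UNIV. a p $ \<alpha> $ \<gamma> *\<^sub>R P' (f p) (N \<gamma> p)) (N \<beta> p) = (a p ** a p) $ \<alpha> $ \<beta>" .
  have "(\<Sum>\<gamma>\<in>UNIV. a p $ \<alpha> $ \<gamma> *\<^sub>R P' (f p) (N \<gamma> p)) \<in> T' (f p)"
    by (intro subspace_sum[OF sub_T'] subspace_scale[OF sub_T'] P'_tangent N_tangent)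
  from metric_add_left[OF N_tangent P'_tangent[OF df_tangent[OF \<xi>_tangent]] this, of \<alpha> \<beta>] 1 2
  have "(if \<alpha> = \<beta> then 1 else 0) = u \<beta> p (\<xi> \<alpha> p) + (a p ** a p) $ \<alpha> $ \<beta>"
    unfolding P'_N[of p \<alpha>] lin P'_df[OF \<xi>_tangent] metric_N[OF P_tangent[OF \<xi>_tangent]] by simp
  then show ?thesis by (simp add: mat_def)
qed

text \<open>This is the Levi-Civita connection of \<open>M\<close>.\<close>

definition cov :: "('a \<Rightarrow> 'a tvec) \<Rightarrow> ('a \<Rightarrow> 'a tvec) \<Rightarrow> 'a \<Rightarrow> 'a tvec" where
  "cov X Y p = (SOME w. w \<in> T p \<and>
     D X (\<lambda>q. df (Y q)) p = df w + (\<Sum>\<alpha>\<in>UNIV. g p (A \<alpha> p (X p)) (Y p) *\<^sub>R N \<alpha> p))"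

text \<open>Differentiating the orthogonality of \<open>df (Y q)\<close> and
  \<open>N \<alpha> q\<close> moves the derivative onto \<open>N \<alpha>\<close>, where the
  Weingarten formula identifies the normal coefficients. What is left is the tangential part chosen
  in \<open>cov\<close>.\<close>

lemma gauss:
  assumes X: "X \<in> VF" and Y: "Y \<in> VF"
  shows cov_tangent: "cov X Y p \<in> T p"
    and gauss_formula: "D X (\<lambda>q. df (Y q)) p =
      df (cov X Y p) + (\<Sum>\<alpha>\<in>UNIV. g p (A \<alpha> p (X p)) (Y p) *\<^sub>R N \<alpha> p)"
proof -
  note Yp = vector_field_tangent[OF Y, of p] and AXp = A_tangent[OF vector_field_tangent[OF X, of p]]
  obtain w s where w: "w \<in> T p" and D: "D X (\<lambda>q. df (Y q)) p = df w + (\<Sum>\<alpha>\<in>UNIV. s \<alpha> *\<^sub>R N \<alpha> p)"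
    using decomposition_exists[OF D_tangent[OF X Along_df[OF Y]]] by blast
  have "s \<alpha> = g p (A \<alpha> p (X p)) (Y p)" for \<alpha>
  proof -
    \<comment> \<open>Being constant, this function meets the smoothness premise of
      \<open>D_metric\<close>.\<close>
    have 0: "(\<lambda>q. g' (f q) (df (Y q)) (N \<alpha> q)) = (\<lambda>q. 0)"
      using N_normal[OF vector_field_tangent[OF Y]] by blast
    have "0 = g' (f p) (D X (\<lambda>q. df (Y q)) p) (N \<alpha> p) + g' (f p) (df (Y p)) (D X (N \<alpha>) p)"
      using D_metric[OF X Along_df[OF Y] N_along, of \<alpha> p] smooth_fun_const[of M 0]
        tangent_vec_const[OF M vector_field_tangent[OF X], of p 0] unfolding 0 by simp
    also have "g' (f p) (D X (\<lambda>q. df (Y q)) p) (N \<alpha> p) = s \<alpha>"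
      unfolding D by (rule metric_N[OF w])
    also have "D X (N \<alpha>) p = (-1) *\<^sub>R df (A \<alpha> p (X p))"
      unfolding weingarten[OF X] by (rule scaleR_minus1_left[symmetric])
    also have "g' (f p) (df (Y p)) ((-1) *\<^sub>R df (A \<alpha> p (X p))) = - g p (A \<alpha> p (X p)) (Y p)"
      using metric_scale_right[OF df_tangent[OF Yp] df_tangent[OF AXp] df_tangent[OF AXp], where k = "-1"]
        g_sym[OF Yp AXp] isometry[OF Yp AXp] by simp
    finally show ?thesis by simp
  qed
  then have "w \<in> T p \<and> D X (\<lambda>q. df (Y q)) p = df w + (\<Sum>\<alpha>\<in>UNIV. g p (A \<alpha> p (X p)) (Y p) *\<^sub>R N \<alpha> p)"
    using w D by simp
  from someI[where P = "\<lambda>w. w \<in> T p \<and> D X (\<lambda>q. df (Y q)) p = df w + (\<Sum>\<alpha>\<in>UNIV. g p (A \<alpha> p (X p)) (Y p) *\<^sub>R N \<alpha> p)", OF this]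
  show "cov X Y p \<in> T p" "D X (\<lambda>q. df (Y q)) p =
      df (cov X Y p) + (\<Sum>\<alpha>\<in>UNIV. g p (A \<alpha> p (X p)) (Y p) *\<^sub>R N \<alpha> p)"
    unfolding cov_def by blast+
qed

text \<open>In the torsion identity for \<open>D\<close> the bracket contributes a purely tangential
  term. The tangential parts therefore give the first claim and the normal parts the second.\<close>

lemma cov_torsion:
  assumes X: "X \<in> VF" and Y: "Y \<in> VF"
  shows bracket_cov: "lie_bracket X Y p = cov X Y p - cov Y X p"
    and second_fundamental_form_sym: "g p (A \<alpha> p (X p)) (Y p) = g p (A \<alpha> p (Y p)) (X p)"
proof -
  let ?h = "\<lambda>X Y \<alpha>. g p (A \<alpha> p (X p)) (Y p)"
  note t = lie_bracket_tangent[OF M X Y, of p]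
  have "df (cov X Y p) + (\<Sum>\<alpha>\<in>UNIV. ?h X Y \<alpha> *\<^sub>R N \<alpha> p) =
      (df (cov Y X p) + (\<Sum>\<alpha>\<in>UNIV. ?h Y X \<alpha> *\<^sub>R N \<alpha> p)) + df (lie_bracket X Y p)"
    unfolding gauss_formula[OF X Y, symmetric] gauss_formula[OF Y X, symmetric] D_torsion[OF X Y, symmetric]
    by (subst add.commute) (rule diff_add_cancel[symmetric])
  then have eq: "df (cov X Y p) + (\<Sum>\<alpha>\<in>UNIV. ?h X Y \<alpha> *\<^sub>R N \<alpha> p) =
      df (cov Y X p + lie_bracket X Y p) + (\<Sum>\<alpha>\<in>UNIV. ?h Y X \<alpha> *\<^sub>R N \<alpha> p)"
    unfolding linear_add[OF df_linear] by (simp only: add_ac)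
  note u = decomposition_unique[OF cov_tangent[OF X Y] subspace_add[OF sub_T cov_tangent[OF Y X] t] eq]
  show "lie_bracket X Y p = cov X Y p - cov Y X p" unfolding u(1) by (simp only: add_diff_cancel_left')
  show "?h X Y \<alpha> = ?h Y X \<alpha>" by (rule fun_cong[OF u(2)])
qed

lemma g_A_sym:
  assumes v: "v \<in> T p" and w: "w \<in> T p"
  shows "g p (A \<alpha> p v) w = g p v (A \<alpha> p w)"
proof -
  obtain X where X: "X \<in> VF" "X p = v" by (rule extend[OF v])
  obtain Y where Y: "Y \<in> VF" "Y p = w" by (rule extend[OF w])
  show ?thesis
    using second_fundamental_form_sym[OF X(1) Y(1), of p \<alpha>] g_sym[OF v A_tangent[OF w]] X Y by simp
qed

text \<open>Computes the derivative of \<open>P' (f q) (df (Y q))\<close> in two ways: by splitting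
  the field first, and by moving \<open>P'\<close> out of \<open>D\<close> and splitting afterwards.
  The claims compare tangential and normal parts.\<close>

lemma cov_P:
  assumes X: "X \<in> VF" and Y: "Y \<in> VF"
  shows cov_P_tangential: "cov X (\<lambda>q. P q (Y q)) p = P p (cov X Y p) +
      (\<Sum>\<alpha>\<in>UNIV. u \<alpha> p (Y p) *\<^sub>R A \<alpha> p (X p)) + (\<Sum>\<alpha>\<in>UNIV. g p (A \<alpha> p (X p)) (Y p) *\<^sub>R \<xi> \<alpha> p)"
    and cov_P_normal: "g p (A \<beta> p (X p)) (P p (Y p)) + X p (\<lambda>q. u \<beta> q (Y q)) =
      u \<beta> p (cov X Y p) + (\<Sum>\<alpha>\<in>UNIV. g p (A \<alpha> p (X p)) (Y p) * a p $ \<alpha> $ \<beta>)"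
proof -
  note PY = P_field[OF Y]
  let ?h = "\<lambda>\<alpha>. g p (A \<alpha> p (X p)) (Y p)"
  have AX: "A \<alpha> p (X p) \<in> T p" for \<alpha> by (rule A_tangent[OF vector_field_tangent[OF X]])
  have fields: "(\<lambda>q. u \<alpha> q (Y q) *\<^sub>R N \<alpha> q) \<in> Along" for \<alpha>
    by (rule Along_scale[OF u_smooth[OF Y] N_along])
  have PY_eq: "(\<lambda>q. P' (f q) (df (Y q))) = (\<lambda>q. df (P q (Y q)) + (\<Sum>\<alpha>\<in>UNIV. u \<alpha> q (Y q) *\<^sub>R N \<alpha> q))"
    using P'_df[OF vector_field_tangent[OF Y]] by blast
  \<comment> \<open>The smoothness premise of \<open>D_parallel\<close>, obtained from the splitting
    because both of its parts are smooth.\<close>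
  have along: "(\<lambda>q. P' (f q) (df (Y q))) \<in> Along"
    unfolding PY_eq by (intro Along_add Along_df PY Along_sum fields)
  have "D X (\<lambda>q. P' (f q) (df (Y q))) p =
      D X (\<lambda>q. df (P q (Y q))) p + D X (\<lambda>q. \<Sum>\<alpha>\<in>UNIV. u \<alpha> q (Y q) *\<^sub>R N \<alpha> q) p"
    unfolding PY_eq by (intro D_add X Along_df PY Along_sum fields)
  also have "D X (\<lambda>q. \<Sum>\<alpha>\<in>UNIV. u \<alpha> q (Y q) *\<^sub>R N \<alpha> q) p =
      (\<Sum>\<alpha>\<in>UNIV. X p (\<lambda>q. u \<alpha> q (Y q)) *\<^sub>R N \<alpha> p + u \<alpha> p (Y p) *\<^sub>R D X (N \<alpha>) p)"
    by (rule D_sum_scale[OF X N_along u_smooth[OF Y]])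
  also have "\<dots> = (\<Sum>\<alpha>\<in>UNIV. X p (\<lambda>q. u \<alpha> q (Y q)) *\<^sub>R N \<alpha> p) - df (\<Sum>\<alpha>\<in>UNIV. u \<alpha> p (Y p) *\<^sub>R A \<alpha> p (X p))"
    unfolding weingarten[OF X] sum.distrib linear_sum[OF df_linear] linear_cmul[OF df_linear]
      scaleR_minus_right sum_negf by (simp only: add_uminus_conv_diff)
  also have "D X (\<lambda>q. df (P q (Y q))) p = df (cov X (\<lambda>q. P q (Y q)) p) +
      (\<Sum>\<alpha>\<in>UNIV. g p (A \<alpha> p (X p)) (P p (Y p)) *\<^sub>R N \<alpha> p)"
    by (rule gauss_formula[OF X PY])
  finally have 1: "D X (\<lambda>q. P' (f q) (df (Y q))) p = df (cov X (\<lambda>q. P q (Y q)) p) +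
      (\<Sum>\<alpha>\<in>UNIV. g p (A \<alpha> p (X p)) (P p (Y p)) *\<^sub>R N \<alpha> p) +
      ((\<Sum>\<alpha>\<in>UNIV. X p (\<lambda>q. u \<alpha> q (Y q)) *\<^sub>R N \<alpha> p) - df (\<Sum>\<alpha>\<in>UNIV. u \<alpha> p (Y p) *\<^sub>R A \<alpha> p (X p)))" .
  have "D X (\<lambda>q. P' (f q) (df (Y q))) p = P' (f p) (D X (\<lambda>q. df (Y q)) p)"
  proof (rule D_parallel[where V = "\<lambda>q. df (Y q)", OF P'_tensor _ X Along_df[OF Y]])
    show "nabla' X (\<lambda>q. P' q (Y q)) p = P' p (nabla' X Y p)" if "X \<in> VF'" "Y \<in> VF'" for X Y p
      by (rule parallel[OF that])
    show "(\<lambda>q. P' (f q) (df (Y q))) \<in> Along" by (rule along)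
  qed
  also have "\<dots> = P' (f p) (df (cov X Y p)) + (\<Sum>\<alpha>\<in>UNIV. ?h \<alpha> *\<^sub>R P' (f p) (N \<alpha> p))"
    unfolding gauss_formula[OF X Y] by (rule P'_add_N_sum[OF df_tangent[OF cov_tangent[OF X Y]]])
  also have "P' (f p) (df (cov X Y p)) = df (P p (cov X Y p)) + (\<Sum>\<alpha>\<in>UNIV. u \<alpha> p (cov X Y p) *\<^sub>R N \<alpha> p)"
    by (rule P'_df[OF cov_tangent[OF X Y]])
  also have "(\<Sum>\<alpha>\<in>UNIV. ?h \<alpha> *\<^sub>R P' (f p) (N \<alpha> p)) =
      df (\<Sum>\<alpha>\<in>UNIV. ?h \<alpha> *\<^sub>R \<xi> \<alpha> p) + (\<Sum>\<beta>\<in>UNIV. (\<Sum>\<alpha>\<in>UNIV. ?h \<alpha> * a p $ \<alpha> $ \<beta>) *\<^sub>R N \<beta> p)"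
  proof -
    have "(\<Sum>\<alpha>\<in>UNIV. \<Sum>\<beta>\<in>UNIV. (?h \<alpha> * a p $ \<alpha> $ \<beta>) *\<^sub>R N \<beta> p) =
        (\<Sum>\<beta>\<in>UNIV. (\<Sum>\<alpha>\<in>UNIV. ?h \<alpha> * a p $ \<alpha> $ \<beta>) *\<^sub>R N \<beta> p)"
      by (subst sum.swap) (simp only: scaleR_sum_left)
    then show ?thesis
      unfolding P'_N scaleR_add_right sum.distrib linear_sum[OF df_linear] linear_cmul[OF df_linear]
        scaleR_sum_right scaleR_scaleR by (simp only:)
  qed
  finally have 2: "D X (\<lambda>q. P' (f q) (df (Y q))) p =
      df (P p (cov X Y p)) + (\<Sum>\<alpha>\<in>UNIV. u \<alpha> p (cov X Y p) *\<^sub>R N \<alpha> p) +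
      (df (\<Sum>\<alpha>\<in>UNIV. ?h \<alpha> *\<^sub>R \<xi> \<alpha> p) + (\<Sum>\<beta>\<in>UNIV. (\<Sum>\<alpha>\<in>UNIV. ?h \<alpha> * a p $ \<alpha> $ \<beta>) *\<^sub>R N \<beta> p))" .
  let ?s1 = "\<Sum>\<alpha>\<in>UNIV. u \<alpha> p (Y p) *\<^sub>R A \<alpha> p (X p)" and ?s2 = "\<Sum>\<alpha>\<in>UNIV. ?h \<alpha> *\<^sub>R \<xi> \<alpha> p"
  have group: "c + n + (m - s) = d + k + (e + j) \<Longrightarrow> c + (n + m) = d + s + e + (k + j)"
    for c n m s d k e j :: "'b tvec"
    by (simp only: algebra_simps)
  have eq: "df (cov X (\<lambda>q. P q (Y q)) p) +
      (\<Sum>\<beta>\<in>UNIV. (g p (A \<beta> p (X p)) (P p (Y p)) + X p (\<lambda>q. u \<beta> q (Y q))) *\<^sub>R N \<beta> p) =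
      df (P p (cov X Y p) + ?s1 + ?s2) +
      (\<Sum>\<beta>\<in>UNIV. (u \<beta> p (cov X Y p) + (\<Sum>\<alpha>\<in>UNIV. ?h \<alpha> * a p $ \<alpha> $ \<beta>)) *\<^sub>R N \<beta> p)"
    unfolding scaleR_add_left sum.distrib linear_add[OF df_linear]
    by (rule group[OF trans[OF 1[symmetric] 2]])
  have t: "P p (cov X Y p) + ?s1 + ?s2 \<in> T p"
    by (intro subspace_add[OF sub_T] P_tangent cov_tangent X Y T_sum AX \<xi>_tangent)
  note uniq = decomposition_unique[OF cov_tangent[OF X PY] t eq]
  show "cov X (\<lambda>q. P q (Y q)) p = P p (cov X Y p) + ?s1 + ?s2" by (rule uniq(1))
  show "g p (A \<beta> p (X p)) (P p (Y p)) + X p (\<lambda>q. u \<beta> q (Y q)) =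
      u \<beta> p (cov X Y p) + (\<Sum>\<alpha>\<in>UNIV. g p (A \<alpha> p (X p)) (Y p) * a p $ \<alpha> $ \<beta>)"
    by (rule fun_cong[OF uniq(2)])
qed

end

text \<open>Six alternating swaps return to the start with three changes of sign: \<open>t x y z = t
  y x z = - t z x y = - t x z y = t y z x = t z y x = - t x y z\<close>.\<close>

lemma sym_skew_zero:
  fixes t :: "'x \<Rightarrow> 'x \<Rightarrow> 'x \<Rightarrow> real"
  assumes "\<And>x y z. x \<in> S \<Longrightarrow> y \<in> S \<Longrightarrow> z \<in> S \<Longrightarrow> t x y z = t y x z"
    and "\<And>x y z. x \<in> S \<Longrightarrow> y \<in> S \<Longrightarrow> z \<in> S \<Longrightarrow> t x y z = - t z y x"
    and "x \<in> S" "y \<in> S" "z \<in> S"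
  shows "t x y z = 0"
  using assms(1)[of x y z] assms(2)[of y x z] assms(1)[of z x y] assms(2)[of x z y] assms(1)[of y z x]
    assms(2)[of z y x] assms(3-5) by simp

section \<open>From normality to vanishing commutators\<close>

context induced_submanifold
begin

definition commutator :: "'r \<Rightarrow> 'a \<Rightarrow> 'a tvec \<Rightarrow> 'a tvec" where
  "commutator \<alpha> p v = A \<alpha> p (P p v) - P p (A \<alpha> p v)"

lemma commutator_tangent: "v \<in> T p \<Longrightarrow> commutator \<alpha> p v \<in> T p"
  unfolding commutator_def by (intro subspace_diff[OF sub_T] A_tangent P_tangent)

lemma commutator_skew:
  assumes "v \<in> T p" "w \<in> T p"
  shows "g p w (commutator \<alpha> p v) = - g p v (commutator \<alpha> p w)"
proof -
  have "g p w (commutator \<alpha> p v) = g p w (A \<alpha> p (P p v)) - g p w (P p (A \<alpha> p v))"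
    if "v \<in> T p" "w \<in> T p" for v w
    unfolding commutator_def
    by (rule map_diff[OF g_linear]) (intro A_tangent P_tangent that)+
  moreover have "g p w (A \<alpha> p (P p v)) = g p v (P p (A \<alpha> p w))" if "v \<in> T p" "w \<in> T p" for v w
    using that A_tangent P_tangent g_A_sym[of w p "P p v" \<alpha>] g_P_sym[of v p "A \<alpha> p w"]
      g_sym[of "A \<alpha> p w" p "P p v"] by simp
  ultimately show ?thesis using assms by simp
qed

lemma P_sum:
  assumes "\<And>\<alpha>. v \<alpha> \<in> T p"
  shows "P p (\<Sum>\<alpha>\<in>UNIV. k \<alpha> *\<^sub>R v \<alpha>) = (\<Sum>\<alpha>\<in>UNIV. k \<alpha> *\<^sub>R P p (v \<alpha>))"
  by (rule linear_map_on_sum[OF sub_T P_linear assms])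

text \<open>Antisymmetrizes \<open>cov_P_normal\<close>. The sums containing \<open>a\<close> agree
  by symmetry of the second fundamental form, the terms in \<open>cov\<close> match \<open>u\<close>
  of the bracket, and self-adjointness of \<open>A \<beta>\<close> brings the rest into this
  form.\<close>

lemma ext_deriv_u:
  assumes X: "X \<in> VF" and Y: "Y \<in> VF"
  shows "2 * ext_deriv (u \<beta>) X Y p = g p (A \<beta> p (P p (X p))) (Y p) - g p (A \<beta> p (P p (Y p))) (X p)"
proof -
  note Xp = vector_field_tangent[OF X, of p] and Yp = vector_field_tangent[OF Y, of p]
  have "u \<beta> p (lie_bracket X Y p) = u \<beta> p (cov X Y p) - u \<beta> p (cov Y X p)"
    unfolding bracket_cov[OF X Y] by (rule map_diff[OF u_linear cov_tangent[OF X Y] cov_tangent[OF Y X]])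
  moreover have "(\<Sum>\<alpha>\<in>UNIV. g p (A \<alpha> p (Y p)) (X p) * a p $ \<alpha> $ \<beta>) =
      (\<Sum>\<alpha>\<in>UNIV. g p (A \<alpha> p (X p)) (Y p) * a p $ \<alpha> $ \<beta>)"
    by (simp only: second_fundamental_form_sym[OF Y X])
  moreover have "g p (A \<beta> p v) (P p w) = g p (A \<beta> p (P p w)) v" if v: "v \<in> T p" and w: "w \<in> T p" for v w
    using g_A_sym[OF v P_tangent[OF w], of \<beta>] g_sym[OF v A_tangent[OF P_tangent[OF w]], of \<beta>] by simp
  ultimately show ?thesis
    using cov_P_normal[OF X Y, of p \<beta>] cov_P_normal[OF Y X, of p \<beta>] Xp Yp by (simp add: ext_deriv_def)
qed

text \<open>Each bracket is a difference of values of \<open>cov\<close>, and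
  \<open>cov_P_tangential\<close> expands those whose second argument is an image under
  \<open>P\<close>. The terms along \<open>\<xi> \<alpha> p\<close> form exterior derivatives by
  \<open>ext_deriv_u\<close>.\<close>

lemma nijenhuis_eq:
  assumes X: "X \<in> VF" and Y: "Y \<in> VF"
  shows "nijenhuis P X Y p =
    (\<Sum>\<alpha>\<in>UNIV. u \<alpha> p (Y p) *\<^sub>R commutator \<alpha> p (X p)) - (\<Sum>\<alpha>\<in>UNIV. u \<alpha> p (X p) *\<^sub>R commutator \<alpha> p (Y p)) +
    2 *\<^sub>R (\<Sum>\<alpha>\<in>UNIV. ext_deriv (u \<alpha>) X Y p *\<^sub>R \<xi> \<alpha> p)"
proof -
  note PX = P_field[OF X] and PY = P_field[OF Y]
  let ?PX = "\<lambda>q. P q (X q)" and ?PY = "\<lambda>q. P q (Y q)"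
  have At: "A \<alpha> p (Z p) \<in> T p" if "Z \<in> VF" for \<alpha> Z by (rule A_tangent[OF vector_field_tangent[OF that]])
  \<comment> \<open>The contribution of \<open>P p (\<xi> \<alpha> p)\<close>, the same for both
    mixed terms by symmetry of the second fundamental form.\<close>
  define l where "l = (\<Sum>\<alpha>\<in>UNIV. g p (A \<alpha> p (X p)) (Y p) *\<^sub>R P p (\<xi> \<alpha> p))"
  have P_cov: "P p (cov V (\<lambda>q. P q (W q)) p) = P p (P p (cov V W p)) +
      (\<Sum>\<alpha>\<in>UNIV. u \<alpha> p (W p) *\<^sub>R P p (A \<alpha> p (V p))) + (\<Sum>\<alpha>\<in>UNIV. g p (A \<alpha> p (V p)) (W p) *\<^sub>R P p (\<xi> \<alpha> p))"
    if V: "V \<in> VF" and W: "W \<in> VF" for V W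
  proof -
    note t = P_tangent[OF cov_tangent[OF V W]] T_sum[OF At[OF V]] T_sum[OF \<xi>_tangent]
    show ?thesis
      unfolding cov_P_tangential[OF V W] map_add[OF P_linear subspace_add[OF sub_T t(1,2)] t(3)]
        map_add[OF P_linear t(1,2)] P_sum[OF At[OF V]] P_sum[OF \<xi>_tangent] ..
  qed
  have q1: "P p (cov Y ?PX p) = P p (P p (cov Y X p)) + (\<Sum>\<alpha>\<in>UNIV. u \<alpha> p (X p) *\<^sub>R P p (A \<alpha> p (Y p))) + l"
    unfolding P_cov[OF Y X] l_def second_fundamental_form_sym[OF Y X] ..
  have q2: "P p (cov X ?PY p) = P p (P p (cov X Y p)) + (\<Sum>\<alpha>\<in>UNIV. u \<alpha> p (Y p) *\<^sub>R P p (A \<alpha> p (X p))) + l"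
    unfolding P_cov[OF X Y] l_def ..
  have P_bracket: "P p (lie_bracket V W p) = P p (cov V W p) - P p (cov W V p)"
    if V: "V \<in> VF" and W: "W \<in> VF" for V W
    unfolding bracket_cov[OF V W] by (rule map_diff[OF P_linear cov_tangent[OF V W] cov_tangent[OF W V]])
  have PP_bracket: "P p (P p (lie_bracket X Y p)) = P p (P p (cov X Y p)) - P p (P p (cov Y X p))"
    unfolding P_bracket[OF X Y]
    by (rule map_diff[OF P_linear P_tangent[OF cov_tangent[OF X Y]] P_tangent[OF cov_tangent[OF Y X]]])
  have du: "(\<Sum>\<alpha>\<in>UNIV. g p (A \<alpha> p (P p (X p))) (Y p) *\<^sub>R \<xi> \<alpha> p) - (\<Sum>\<alpha>\<in>UNIV. g p (A \<alpha> p (P p (Y p))) (X p) *\<^sub>R \<xi> \<alpha> p) =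
      2 *\<^sub>R (\<Sum>\<alpha>\<in>UNIV. ext_deriv (u \<alpha>) X Y p *\<^sub>R \<xi> \<alpha> p)"
    unfolding scaleR_sum_right scaleR_scaleR ext_deriv_u[OF X Y] scaleR_diff_left sum_subtractf ..
  have "nijenhuis P X Y p = cov ?PX ?PY p - cov ?PY ?PX p + (P p (P p (cov X Y p)) - P p (P p (cov Y X p)))
      - (P p (cov ?PX Y p) - P p (cov Y ?PX p)) - (P p (cov X ?PY p) - P p (cov ?PY X p))"
    unfolding nijenhuis_def bracket_cov[OF PX PY] PP_bracket P_bracket[OF PX Y] P_bracket[OF X PY] ..
  also have "\<dots> = ((\<Sum>\<alpha>\<in>UNIV. u \<alpha> p (Y p) *\<^sub>R A \<alpha> p (P p (X p))) - (\<Sum>\<alpha>\<in>UNIV. u \<alpha> p (Y p) *\<^sub>R P p (A \<alpha> p (X p)))) -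
      ((\<Sum>\<alpha>\<in>UNIV. u \<alpha> p (X p) *\<^sub>R A \<alpha> p (P p (Y p))) - (\<Sum>\<alpha>\<in>UNIV. u \<alpha> p (X p) *\<^sub>R P p (A \<alpha> p (Y p)))) +
      ((\<Sum>\<alpha>\<in>UNIV. g p (A \<alpha> p (P p (X p))) (Y p) *\<^sub>R \<xi> \<alpha> p) - (\<Sum>\<alpha>\<in>UNIV. g p (A \<alpha> p (P p (Y p))) (X p) *\<^sub>R \<xi> \<alpha> p))"
    by (rule nijenhuis_cancellation[OF cov_P_tangential[OF PX Y] cov_P_tangential[OF PY X] q1 q2])
  finally show ?thesis
    unfolding du commutator_def scaleR_diff_right sum_subtractf .
qed

lemma normal_imp_symmetric:
  assumes normal: "normal_structure M P u \<xi>" and v: "v \<in> T p" and w: "w \<in> T p"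
  shows "(\<Sum>\<alpha>\<in>UNIV. u \<alpha> p w *\<^sub>R commutator \<alpha> p v) = (\<Sum>\<alpha>\<in>UNIV. u \<alpha> p v *\<^sub>R commutator \<alpha> p w)"
proof -
  obtain X where X: "X \<in> VF" "X p = v" by (rule extend[OF v])
  obtain Y where Y: "Y \<in> VF" "Y p = w" by (rule extend[OF w])
  have "nijenhuis P X Y p - 2 *\<^sub>R (\<Sum>\<alpha>\<in>UNIV. ext_deriv (u \<alpha>) X Y p *\<^sub>R \<xi> \<alpha> p) = 0"
    using normal X Y unfolding normal_structure_def by blast
  then show ?thesis
    unfolding nijenhuis_eq[OF X(1) Y(1)] add_diff_cancel_right' X(2) Y(2) by (rule iffD1[OF right_minus_eq])
qed

lemma normal_imp_sum_commutator_zero: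
  assumes normal: "normal_structure M P u \<xi>" and v: "v \<in> T p" and w: "w \<in> T p"
  shows "(\<Sum>\<alpha>\<in>UNIV. u \<alpha> p w *\<^sub>R commutator \<alpha> p v) = 0"
proof -
  define t where "t x y z = g p z (\<Sum>\<alpha>\<in>UNIV. u \<alpha> p y *\<^sub>R commutator \<alpha> p x)" for x y z
  have t: "t x y z = (\<Sum>\<alpha>\<in>UNIV. u \<alpha> p y * g p z (commutator \<alpha> p x))" if "x \<in> T p" "z \<in> T p" for x y z
    using linear_map_on_sum[OF sub_T g_linear[OF that(2)] commutator_tangent[OF that(1)]]
    by (simp add: t_def)
  \<comment> \<open>With the sum itself as third argument, \<open>t v w ?w\<close> is its squared
    length, so positivity of \<open>g\<close> makes the sum 0.\<close>
  let ?w = "\<Sum>\<alpha>\<in>UNIV. u \<alpha> p w *\<^sub>R commutator \<alpha> p v"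
  have w': "?w \<in> T p" by (rule T_sum[OF commutator_tangent[OF v]])
  have "t v w ?w = 0"
  proof (rule sym_skew_zero[of "T p" t, OF _ _ v w w'])
    show "t x y z = t y x z" if "x \<in> T p" "y \<in> T p" "z \<in> T p" for x y z
      unfolding t_def normal_imp_symmetric[OF normal that(1,2)] ..
    show "t x y z = - t z y x" if "x \<in> T p" "y \<in> T p" "z \<in> T p" for x y z
      unfolding t[OF that(1,3)] t[OF that(3,1)] commutator_skew[OF that(1,3)]
      by (simp add: sum_negf)
  qed
  then show ?thesis using g_pos[OF w'] unfolding t_def by force
qed

lemma normal_imp_commutator_zero:
  assumes normal: "normal_structure M P u \<xi>" and det: "det (mat 1 - a p ** a p) \<noteq> 0" and v: "v \<in> T p"
  shows "commutator \<gamma> p v = 0"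
proof -
  let ?Q = "mat 1 - a p ** a p"
  \<comment> \<open>Row \<open>\<gamma>\<close> of a left inverse combines the vanishing sums for
    the vectors \<open>\<xi> \<beta> p\<close> into the single commutator with index
    \<open>\<gamma>\<close>.\<close>
  obtain R where R: "R ** ?Q = mat 1"
    using det invertible_det_nz[of ?Q] unfolding invertible_def by blast
  have "commutator \<gamma> p v = (\<Sum>\<alpha>\<in>UNIV. (R ** ?Q) $ \<gamma> $ \<alpha> *\<^sub>R commutator \<alpha> p v)"
  proof -
    have "(\<Sum>\<alpha>\<in>UNIV. mat 1 $ \<gamma> $ \<alpha> *\<^sub>R commutator \<alpha> p v) =
        (\<Sum>\<alpha>\<in>UNIV. if \<gamma> = \<alpha> then commutator \<alpha> p v else 0)"
      by (intro sum.cong refl) (simp add: mat_def)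
    also have "\<dots> = commutator \<gamma> p v" by (simp only: sum.delta'[OF finite_class.finite_UNIV] UNIV_I if_True)
    finally show ?thesis unfolding R by (rule sym)
  qed
  also have "\<dots> = (\<Sum>\<alpha>\<in>UNIV. \<Sum>\<beta>\<in>UNIV. R $ \<gamma> $ \<beta> *\<^sub>R ?Q $ \<beta> $ \<alpha> *\<^sub>R commutator \<alpha> p v)"
    by (simp only: matrix_matrix_mult_def vec_lambda_beta scaleR_sum_left scaleR_scaleR)
  also have "\<dots> = (\<Sum>\<beta>\<in>UNIV. R $ \<gamma> $ \<beta> *\<^sub>R (\<Sum>\<alpha>\<in>UNIV. u \<alpha> p (\<xi> \<beta> p) *\<^sub>R commutator \<alpha> p v))"
    unfolding u_\<xi> by (subst sum.swap) (simp only: scaleR_sum_right)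
  also have "\<dots> = 0"
    unfolding normal_imp_sum_commutator_zero[OF normal v \<xi>_tangent] scaleR_zero_right by (rule sum.neutral_const)
  finally show ?thesis .
qed

end

theorem theorem4p1:
  fixes M :: "('a::{t2_space,second_countable_topology}, 'm::euclidean_space) chart set"
    and M' :: "('b::{t2_space,second_countable_topology}, 'd::euclidean_space) chart set"
    and g :: "'a \<Rightarrow> 'a tvec \<Rightarrow> 'a tvec \<Rightarrow> real"
    and g' :: "'b \<Rightarrow> 'b tvec \<Rightarrow> 'b tvec \<Rightarrow> real"
    and P' :: "'b \<Rightarrow> 'b tvec \<Rightarrow> 'b tvec"
    and nabla' :: "('b \<Rightarrow> 'b tvec) \<Rightarrow> ('b \<Rightarrow> 'b tvec) \<Rightarrow> 'b \<Rightarrow> 'b tvec"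
    and D :: "('a \<Rightarrow> 'a tvec) \<Rightarrow> ('a \<Rightarrow> 'b tvec) \<Rightarrow> 'a \<Rightarrow> 'b tvec"
    and f :: "'a \<Rightarrow> 'b"
    and N :: "'r::finite \<Rightarrow> 'a \<Rightarrow> 'b tvec"
    and P :: "'a \<Rightarrow> 'a tvec \<Rightarrow> 'a tvec"
    and u :: "'r \<Rightarrow> 'a \<Rightarrow> 'a tvec \<Rightarrow> real"
    and \<xi> :: "'r \<Rightarrow> 'a \<Rightarrow> 'a tvec"
    and a :: "'a \<Rightarrow> real ^ 'r ^ 'r"
    and A :: "'r \<Rightarrow> 'a \<Rightarrow> 'a tvec \<Rightarrow> 'a tvec"
    and l :: "'r \<Rightarrow> 'r \<Rightarrow> 'a \<Rightarrow> 'a tvec \<Rightarrow> real"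
  assumes "smooth_manifold M" and "smooth_manifold M'"
    and "DIM('d) = DIM('m) + CARD('r)"
    and "locally_product_riemannian M' g' nabla' P'"
    and "riemannian_metric M g"
    and "isometric_immersion M M' g g' f"
    and "orthonormal_normal_frame M M' g' f N"
    and "induced_structure M M' P' f N P u \<xi> a"
    and "normal_structure M P u \<xi>"
    and "induced_connection_along M M' f nabla' D"
    and "weingarten_formula M M' f D N A l"
    and "\<And>\<alpha> \<beta> p v. v \<in> tangent_space M p \<Longrightarrow> l \<alpha> \<beta> p v = 0"
    and "\<And>p. det (mat 1 - a p ** a p) \<noteq> 0"
  shows "\<forall>\<alpha>. \<forall>p. \<forall>v\<in>tangent_space M p. P p (A \<alpha> p v) = A \<alpha> p (P p v)"
proof -
  have locally_product: "almost_product_riemannian M' g' P'" "levi_civita M' g' nabla'"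
    using assms(4) unfolding locally_product_riemannian_def by blast+
  have parallel: "nabla' X (\<lambda>q. P' q (Y q)) p - P' p (nabla' X Y p) = 0"
      if "X \<in> vector_fields M'" "Y \<in> vector_fields M'" for X Y p
    using assms(4) that unfolding locally_product_riemannian_def by blast
  have tensor: "tensor_field_11 M (A \<alpha>)" for \<alpha>
    using assms(11) unfolding weingarten_formula_def by blast
  have weingarten: "D X (N \<alpha>) p = - differential M' f (A \<alpha> p (X p))" if X: "X \<in> vector_fields M" for \<alpha> X p
  proof -
    have "D X (N \<alpha>) p = - differential M' f (A \<alpha> p (X p)) + (\<Sum>\<beta>\<in>UNIV. l \<alpha> \<beta> p (X p) *\<^sub>R N \<beta> p)"
      using assms(11) X unfolding weingarten_formula_def by blast
    then show ?thesis
      unfolding assms(12)[OF vector_field_tangent[OF X]] scaleR_zero_left sum.neutral_const add_0_right .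
  qed
  interpret induced_submanifold M M' f g' nabla' D g P' N P u \<xi> a A
  proof unfold_locales
    show "smooth_manifold M" "smooth_manifold M'" by fact+
    show "smooth_map M M' f" using assms(6) by (simp add: isometric_immersion_def)
    show "riemannian_metric M' g'" using locally_product(1) by (simp add: almost_product_riemannian_def)
    show "levi_civita M' g' nabla'" by fact
    show "induced_connection_along M M' f nabla' D" by fact
    show "DIM('d) = DIM('m) + CARD('r)" by fact
    show "riemannian_metric M g" "isometric_immersion M M' g g' f" "orthonormal_normal_frame M M' g' f N" by fact+
    show "almost_product_riemannian M' g' P'" by fact
    show "nabla' X (\<lambda>q. P' q (Y q)) p = P' p (nabla' X Y p)"
      if "X \<in> vector_fields M'" "Y \<in> vector_fields M'" for X Y p
      using parallel[OF that] by (rule iffD1[OF right_minus_eq])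
    show "induced_structure M M' P' f N P u \<xi> a" by fact
    show "tensor_field_11 M (A \<alpha>)" for \<alpha> by (rule tensor)
    show "D X (N \<alpha>) p = - differential M' f (A \<alpha> p (X p))" if "X \<in> vector_fields M" for \<alpha> X p
      by (rule weingarten[OF that])
  qed
  have "A \<alpha> p (P p v) - P p (A \<alpha> p v) = 0" if "v \<in> tangent_space M p" for \<alpha> p v
    using normal_imp_commutator_zero[OF assms(9) assms(13) that] unfolding commutator_def .
  then show ?thesis by (metis right_minus_eq)
qed

end
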